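(* Let $\Omega\subset\mathbb{R}^3$ be a compact polyhedral domain with a partition $\partial\Omega=D\cup N$ of its boundary into disjoint sets. Let $\mathcal{F}$ be an open face of $\partial\Omega$ such that $\mathcal{F}\cap D$ is a Lipschitz domain of $\mathcal{F}$ with nonempty complement $\mathcal{F}\cap N$ (in $\mathcal F$). Then there exist mixed data $f\in W^{1,2}(\partial\Omega)$ and $g\in L^2(N)$ for which there is no function $u$ with $\triangle u=0$ in $\Omega$, $u\to f$ nontangentially a.e. on $D$, $\partial_\nu u\to g$ nontangentially a.e. on $N$, and $(\nabla u)^*\in L^2(\partial\Omega)$.
   Context: A compact polyhedral domain is the interior $\Omega$, assumed connected, of a compact polyhedron of $\mathbb{R}^3$. Surface measure is $ds$; $\nu=\nu_P$ is the outer unit normal at a.e. $P\in\partial\Omega$; $L^2$ and $W^{1,2}$ on the boundary are taken with respect to $ds$. "$\mathcal F\cap D$ is a Lipschitz domain of $\mathcal F$" means it is a domain of the plane region $\mathcal F$ whose boundary is locally, in suitable rectangular coordinates of the plane of $\mathcal F$, the graph of a Lipschitz function with the domain lying on one side of the graph. Fix $\alpha>0$. The nontangential approach region at $P\in\partial\Omega$ is $\Gamma(P)=\{X\in\Omega:|X-P|<(1+\alpha)\,\mathrm{dist}(X,\partial\Omega)\}$, and $w^*(P)=\sup_{X\in\Gamma(P)}|w(X)|$; different $\alpha$ give comparable $L^p$ norms, so $\alpha$ is suppressed. "$u\to f$ nontangentially" at $P$ means $\lim_{\Gamma(P)\ni X\to P}u(X)=f(P)$, and "$\partial_\nu u\to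 g$ nontangentially" at $P$ means $\lim_{\Gamma(P)\ni X\to P}\nu_P\cdot\nabla u(X)=g(P)$. *)

theory Defs
  imports "HOL-Analysis.Analysis"
begin

section \<open>Polyhedral domains and their faces\<close>

text \<open>A compact polyhedron is the underlying set of a finite simplicial complex; its boundary is not
  required to be locally a Lipschitz graph.\<close>

definition compact_polyhedron :: "(real^3) set \<Rightarrow> bool" where
  "compact_polyhedron K \<longleftrightarrow> (\<exists>\<C>. simplicial_complex \<C> \<and> K = \<Union>\<C>)"

definition compact_polyhedral_domain :: "(real^3) set \<Rightarrow> bool" where
  "compact_polyhedral_domain \<Omega> \<longleftrightarrow>
     (\<exists>K. compact_polyhedron K \<and> \<Omega> = interior K) \<and> connected \<Omega> \<and> \<Omega> \<noteq> {}"

text \<open>The vector n is the outer unit normal at the boundary point P where \<open>\<Omega>\<close> coincides near P with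
  the half space \<open>(X - P) \<bullet> n < 0\<close>. As the interior of a closed set cannot lie on both sides of its
  boundary, for a polyhedral domain such an n exists at every boundary point near which the
  boundary is a plane, that is, off the finitely many edges and vertices.\<close>

definition is_outer_normal :: "(real^3) set \<Rightarrow> real^3 \<Rightarrow> real^3 \<Rightarrow> bool" where
  "is_outer_normal \<Omega> P n \<longleftrightarrow>
     norm n = 1 \<and> (\<exists>r>0. \<Omega> \<inter> ball P r = {X \<in> ball P r. (X - P) \<bullet> n < 0})"

definition outer_normal :: "(real^3) set \<Rightarrow> real^3 \<Rightarrow> real^3" where
  "outer_normal \<Omega> P = (THE n. is_outer_normal \<Omega> P n)"

definition flat_boundary :: "(real^3) set \<Rightarrow> (real^3) set" where
  "flat_boundary \<Omega> = {P. \<exists>n. is_outer_normal \<Omega> P n}"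

definition open_faces :: "(real^3) set \<Rightarrow> (real^3) set set" where
  "open_faces \<Omega> = components (flat_boundary \<Omega>)"

text \<open>Rectangular coordinates of the plane containing a face F are given by an isometric embedding
  of \<open>\<real>\<^sup>2\<close> whose range contains F (such an embedding is automatically affine).\<close>

definition rectangular_coords :: "(real^3) set \<Rightarrow> (real^2 \<Rightarrow> real^3) \<Rightarrow> bool" where
  "rectangular_coords F \<phi> \<longleftrightarrow> (\<forall>x y. dist (\<phi> x) (\<phi> y) = dist x y) \<and> F \<subseteq> range \<phi>"

text \<open>E is a domain of the plane region F, with boundary taken in F, that lies locally
  strictly above a Lipschitz graph.\<close>

definition lipschitz_domain_of :: "(real^3) set \<Rightarrow> (real^3) set \<Rightarrow> bool" where
  "lipschitz_domain_of F E \<longleftrightarrow>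
     E \<noteq> {} \<and> connected E \<and> openin (top_of_set F) E \<and>
     (\<forall>Q \<in> top_of_set F frontier_of E.
        \<exists>\<phi> \<psi> L r. rectangular_coords F \<phi> \<and> L-lipschitz_on UNIV (\<psi> :: real \<Rightarrow> real) \<and> r > 0 \<and>
          (\<forall>x. \<phi> x \<in> F \<inter> ball Q r \<longrightarrow> (\<phi> x \<in> E \<longleftrightarrow> \<psi> (x$1) < x$2)))"


section \<open>Surface measure and boundary function spaces\<close>

text \<open>The area of a subset of a face is the Lebesgue measure of its coordinate image, which does not
  depend on the choice of rectangular coordinates. Edges and vertices are null sets of the
  surface measure.\<close>

definition face_area :: "(real^3) set \<Rightarrow> (real^3) set \<Rightarrow> ennreal" where
  "face_area F A = emeasure lborel ((SOME \<phi>. rectangular_coords F \<phi>) -` (A \<inter> F))"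

definition surface_measure :: "(real^3) set \<Rightarrow> (real^3) measure" where
  "surface_measure \<Omega> = measure_of UNIV (sets borel) (\<lambda>A. \<Sum>F\<in>open_faces \<Omega>. face_area F A)"

lemma flat_boundary_near:
  assumes "norm n = 1" "r > 0" and eq: "\<Omega> \<inter> ball P r = {X \<in> ball P r. (X - P) \<bullet> n < 0}"
    and Q: "Q \<in> ball P r"
  shows "Q \<in> flat_boundary \<Omega> \<longleftrightarrow> (Q - P) \<bullet> n = 0"
proof
  assume "(Q - P) \<bullet> n = 0"
  then have dot: "(X - Q) \<bullet> n = (X - P) \<bullet> n" for X by (simp add: inner_diff_left)
  obtain s where s: "s > 0" "ball Q s \<subseteq> ball P r"
    using Q by (meson open_ball open_contains_ball)
  have "\<Omega> \<inter> ball Q s = {X \<in> ball Q s. (X - Q) \<bullet> n < 0}"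
    using s(2) eq unfolding dot by blast
  then show "Q \<in> flat_boundary \<Omega>"
    using assms(1) s(1) unfolding flat_boundary_def is_outer_normal_def by blast
next
  assume "Q \<in> flat_boundary \<Omega>"
  then obtain m s where m: "norm m = 1" "s > 0"
      and ms: "\<Omega> \<inter> ball Q s = {X \<in> ball Q s. (X - Q) \<bullet> m < 0}"
    unfolding flat_boundary_def is_outer_normal_def by blast
  have "Q \<notin> \<Omega>"
  proof
    assume "Q \<in> \<Omega>"
    then have "Q \<in> {X \<in> ball Q s. (X - Q) \<bullet> m < 0}" using ms m(2) by (metis IntI centre_in_ball)
    then show False by simp
  qed
  then have ge: "(Q - P) \<bullet> n \<ge> 0" using eq Q by (metis (mono_tags, lifting) IntD1 mem_Collect_eq not_less)
  have "open (ball P r \<inter> {X. (X - P) \<bullet> n > 0})"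
    by (intro open_Int open_ball open_Collect_less continuous_intros)
  moreover have "(Q - P) \<bullet> n > 0 \<Longrightarrow> Q \<in> ball P r \<inter> {X. (X - P) \<bullet> n > 0}" using Q by simp
  ultimately have "(Q - P) \<bullet> n > 0 \<Longrightarrow> \<exists>e>0. ball Q e \<subseteq> ball P r \<inter> {X. (X - P) \<bullet> n > 0}"
    by (meson open_contains_ball)
  moreover have False if e: "e > 0" "ball Q e \<subseteq> ball P r \<inter> {X. (X - P) \<bullet> n > 0}" for e
  proof -
    define t where "t = min e s / 2"
    let ?X = "Q - t *\<^sub>R m"
    have t: "t > 0" "t < e" "t < s" using e(1) m(2) by (auto simp: t_def)
    have "dist Q ?X = t" using t m by (simp add: dist_norm)
    then have X: "?X \<in> ball Q e" "?X \<in> ball Q s" using t by auto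
    have "m \<bullet> m = 1" using m(1) by (simp add: norm_eq_1)
    then have "(?X - Q) \<bullet> m < 0" using t by simp
    then have "?X \<in> \<Omega>" using ms X by blast
    moreover have "?X \<in> ball P r" "(?X - P) \<bullet> n > 0" using subsetD[OF e(2) X(1)] by simp_all
    ultimately have "?X \<in> {X \<in> ball P r. (X - P) \<bullet> n < 0}" using eq by blast
    then show False using \<open>(?X - P) \<bullet> n > 0\<close> by auto
  qed
  ultimately show "(Q - P) \<bullet> n = 0" using ge by fastforce
qed

lemma flat_boundary_borel: "flat_boundary \<Omega> \<in> sets borel"
proof -
  let ?B = "flat_boundary \<Omega>"
  have "\<forall>P\<in>?B. \<exists>n r. norm n = 1 \<and> r > 0 \<and> \<Omega> \<inter> ball P r = {X \<in> ball P r. (X - P) \<bullet> n < 0}"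
    unfolding flat_boundary_def is_outer_normal_def by blast
  from bchoice[OF this] obtain n where
    "\<forall>P\<in>?B. \<exists>r. norm (n P) = 1 \<and> r > 0 \<and> \<Omega> \<inter> ball P r = {X \<in> ball P r. (X - P) \<bullet> n P < 0}" ..
  from bchoice[OF this] obtain r where
    "\<forall>P\<in>?B. norm (n P) = 1 \<and> r P > 0 \<and>
      \<Omega> \<inter> ball P (r P) = {X \<in> ball P (r P). (X - P) \<bullet> n P < 0}" ..
  then have nr: "norm (n P) = 1 \<and> r P > 0 \<and>
      \<Omega> \<inter> ball P (r P) = {X \<in> ball P (r P). (X - P) \<bullet> n P < 0}" if "P \<in> ?B" for P
    using that by (rule bspec)
  define U where "U = (\<Union>P\<in>?B. ball P (r P))"
  have oU: "open U" unfolding U_def by (intro open_UN ballI open_ball)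
  have "?B = closure ?B \<inter> U"
  proof
    show "?B \<subseteq> closure ?B \<inter> U"
    proof
      fix Q assume "Q \<in> ?B"
      then have "Q \<in> ball Q (r Q)" using nr by simp
      then show "Q \<in> closure ?B \<inter> U"
        using \<open>Q \<in> ?B\<close> closure_subset[of ?B] unfolding U_def by blast
    qed
    show "closure ?B \<inter> U \<subseteq> ?B"
    proof
      fix Q assume "Q \<in> closure ?B \<inter> U"
      then obtain P where P: "P \<in> ?B" "Q \<in> ball P (r P)" and Q: "Q \<in> closure ?B"
        unfolding U_def by blast
      have iff: "X \<in> ?B \<longleftrightarrow> (X - P) \<bullet> n P = 0" if "X \<in> ball P (r P)" for X
        using flat_boundary_near[of "n P" "r P" \<Omega> P X] nr[OF P(1)] that by blast
      have cl: "closed {X. (X - P) \<bullet> n P = 0}"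
        by (intro closed_Collect_eq continuous_intros)
      have "Q \<in> closure (ball P (r P) \<inter> ?B)"
        using open_Int_closure_subset[of "ball P (r P)" ?B] P(2) Q by blast
      also have "\<dots> \<subseteq> {X. (X - P) \<bullet> n P = 0}"
        by (rule closure_minimal[OF _ cl]) (use iff in blast)
      finally show "Q \<in> ?B" using iff P(2) by blast
    qed
  qed
  moreover have "closure ?B \<inter> U \<in> sets borel" using oU by simp
  ultimately show ?thesis by metis
qed

lemma open_faces_borel:
  assumes "F \<in> open_faces \<Omega>" shows "F \<in> sets borel"
proof -
  obtain C where "closed C" "F = flat_boundary \<Omega> \<inter> C"
    using closedin_component[of F "flat_boundary \<Omega>"] assms
    unfolding open_faces_def closedin_closed by blast
  then show ?thesis using flat_boundary_borel[of \<Omega>] by (simp add: sets.Int)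
qed

lemma emeasure_surface_measure:
  assumes "A \<in> sets borel" and coords: "\<And>F. F \<in> open_faces \<Omega> \<Longrightarrow> \<exists>\<phi>. rectangular_coords F \<phi>"
  shows "emeasure (surface_measure \<Omega>) A = (\<Sum>F\<in>open_faces \<Omega>. face_area F A)"
proof (rule emeasure_measure_of[OF surface_measure_def])
  let ?\<phi> = "\<lambda>F. SOME \<phi>. rectangular_coords F \<phi>"
  have meas: "?\<phi> F \<in> borel_measurable borel" if "F \<in> open_faces \<Omega>" for F
  proof -
    have "rectangular_coords F (?\<phi> F)" using coords[OF that] by (rule someI_ex)
    then have "1-lipschitz_on UNIV (?\<phi> F)"
      by (intro lipschitz_onI) (auto simp: rectangular_coords_def)
    then show ?thesis by (intro borel_measurable_continuous_onI lipschitz_on_continuous_on)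
  qed
  show "sets (borel :: (real^3) measure) \<subseteq> Pow UNIV" by simp
  show "positive (sets (surface_measure \<Omega>)) (\<lambda>A. \<Sum>F\<in>open_faces \<Omega>. face_area F A)"
    by (simp add: positive_def face_area_def)
  have sets_eq: "sets (surface_measure \<Omega>) = sets borel"
    unfolding surface_measure_def
    by (metis sets.sets_measure_of_eq space_borel)
  show "A \<in> sets (surface_measure \<Omega>)" using assms sets_eq by simp
  show "countably_additive (sets (surface_measure \<Omega>)) (\<lambda>A. \<Sum>F\<in>open_faces \<Omega>. face_area F A)"
    unfolding sets_eq
  proof (rule countably_additiveI)
    fix A :: "nat \<Rightarrow> (real^3) set"
    assume A: "range A \<subseteq> sets borel" "disjoint_family A"
    have "(\<Sum>i. face_area F (A i)) = face_area F (\<Union>i. A i)" if F: "F \<in> open_faces \<Omega>" for F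
    proof -
      have "(\<Sum>i. emeasure lborel (?\<phi> F -` (A i \<inter> F))) = emeasure lborel (\<Union>i. ?\<phi> F -` (A i \<inter> F))"
      proof (rule suminf_emeasure)
        show "range (\<lambda>i. ?\<phi> F -` (A i \<inter> F)) \<subseteq> sets lborel"
          using measurable_sets[OF meas[OF F]] A(1) open_faces_borel[OF F] by auto
        show "disjoint_family (\<lambda>i. ?\<phi> F -` (A i \<inter> F))"
          using A(2) by (auto simp: disjoint_family_on_def)
      qed
      moreover have "(\<Union>i. ?\<phi> F -` (A i \<inter> F)) = ?\<phi> F -` ((\<Union>i. A i) \<inter> F)" by blast
      ultimately show ?thesis by (simp add: face_area_def)
    qed
    then show "(\<Sum>i. \<Sum>F\<in>open_faces \<Omega>. face_area F (A i)) = (\<Sum>F\<in>open_faces \<Omega>. face_area F (\<Union>i. A i))"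
      by (subst suminf_sum) auto
  qed
qed
definition L2_on :: "'a measure \<Rightarrow> 'a set \<Rightarrow> ('a \<Rightarrow> 'b::{second_countable_topology, banach}) \<Rightarrow> bool"
  where "L2_on M A f \<longleftrightarrow>
     set_borel_measurable M A f \<and> set_integrable M A (\<lambda>x. (norm (f x))\<^sup>2)"

definition grad :: "(real^'n \<Rightarrow> real) \<Rightarrow> real^'n \<Rightarrow> real^'n" where
  "grad u X = (\<chi> i. frechet_derivative u (at X) (axis i 1))"

definition C1_fun :: "(real^'n \<Rightarrow> real) \<Rightarrow> bool" where
  "C1_fun \<phi> \<longleftrightarrow> (\<forall>X. \<phi> differentiable (at X)) \<and> continuous_on UNIV (grad \<phi>)"

text \<open>The components of \<open>\<nu> \<times> \<nabla>\<close> are the tangential derivatives \<open>\<nu>\<^sub>j \<partial>\<^sub>k - \<nu>\<^sub>k \<partial>\<^sub>j\<close>. By Stokes'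
  theorem \<open>\<nu> \<times> \<nabla>(f \<phi>)\<close> has integral 0 over the closed surface \<open>\<partial>\<Omega>\<close>, so that the weak tangential
  derivative T of f (equal to \<open>\<nu> \<times> \<nabla>f\<close> for smooth f) is defined by integration by parts
  against C1 functions on space. Testing over the whole of \<open>\<partial>\<Omega>\<close>, and not face by face, makes
  the traces of f match across edges.\<close>

definition W12_boundary :: "(real^3) set \<Rightarrow> (real^3 \<Rightarrow> real) \<Rightarrow> bool" where
  "W12_boundary \<Omega> f \<longleftrightarrow>
     L2_on (surface_measure \<Omega>) (frontier \<Omega>) f \<and>
     (\<exists>T :: real^3 \<Rightarrow> real^3. L2_on (surface_measure \<Omega>) (frontier \<Omega>) T \<and>
        (\<forall>\<phi>. C1_fun \<phi> \<longrightarrow>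
           (LINT P:frontier \<Omega>|surface_measure \<Omega>. f P *\<^sub>R cross3 (outer_normal \<Omega> P) (grad \<phi> P)) =
           - (LINT P:frontier \<Omega>|surface_measure \<Omega>. \<phi> P *\<^sub>R T P)))"


section \<open>Harmonic functions and nontangential behaviour\<close>

definition hessian :: "(real^'n \<Rightarrow> real) \<Rightarrow> real^'n \<Rightarrow> real^'n^'n" where
  "hessian u X = matrix (frechet_derivative (grad u) (at X))"

definition laplacian :: "(real^'n \<Rightarrow> real) \<Rightarrow> real^'n \<Rightarrow> real" where
  "laplacian u X = trace (hessian u X)"

definition harmonic_on :: "(real^'n) set \<Rightarrow> (real^'n \<Rightarrow> real) \<Rightarrow> bool" where
  "harmonic_on \<Omega> u \<longleftrightarrow>
     (\<forall>X\<in>\<Omega>. u differentiable (at X) \<and> grad u differentiable (at X)) \<and>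
     continuous_on \<Omega> (hessian u) \<and> (\<forall>X\<in>\<Omega>. laplacian u X = 0)"

definition approach_region :: "real \<Rightarrow> (real^3) set \<Rightarrow> real^3 \<Rightarrow> (real^3) set" where
  "approach_region \<alpha> \<Omega> P = {X \<in> \<Omega>. norm (X - P) < (1 + \<alpha>) * infdist X (frontier \<Omega>)}"

text \<open>As a supremum over the \<open>X\<close> of multiples of indicators of the open sets of those P with
  \<open>|X - P| < (1 + \<alpha>) dist(X, \<partial>\<Omega>)\<close>, this function is lower semicontinuous, hence Borel.\<close>

definition nt_max :: "real \<Rightarrow> (real^3) set \<Rightarrow> (real^3 \<Rightarrow> 'b::real_normed_vector) \<Rightarrow> real^3 \<Rightarrow> ennreal"
  where "nt_max \<alpha> \<Omega> w P = (SUP X\<in>approach_region \<alpha> \<Omega> P. ennreal (norm (w X)))"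

definition nt_limit :: "real \<Rightarrow> (real^3) set \<Rightarrow> (real^3 \<Rightarrow> real) \<Rightarrow> real^3 \<Rightarrow> real \<Rightarrow> bool" where
  "nt_limit \<alpha> \<Omega> w P l \<longleftrightarrow> (w \<longlongrightarrow> l) (at P within approach_region \<alpha> \<Omega> P)"

end

theory Submission
  imports Defs
begin

text \<open>The datum on D is f = 0; the datum g on N is square integrable, but too singular along the
  interface of D and N inside the face F.

  Suppose first that the interface is a straight line. Use coordinates (a, s, t): a along the
  interface, s the distance from it inside the face, positive on the side of N, and t the height
  above the face, and let v + i w be the reciprocal square root of s + i t. By the Cauchy-Riemann equations
  the field \<open>(v u\<^sub>a, v u\<^sub>s + w u\<^sub>t, v u\<^sub>t - w u\<^sub>s)\<close> is divergence free for every harmonic u. Its flux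
  through the face is the integral of \<open>v u\<^sub>t - w u\<^sub>s\<close>. On N, w vanishes and the first term pairs v with the
  Neumann datum; on D, v vanishes and \<open>u\<^sub>s\<close> is a tangential derivative of u = 0. After a cut-off,
  all other terms are controlled by the square integral of the nontangential maximal function of the
  gradient. So the pairing of g with v over N is finite whenever a solution with f = 0 exists.
  But the square of v is 1 / s on N, which has a logarithmically divergent integral, so there is a
  square integrable g for which the pairing diverges.

  A Lipschitz interface need not contain any straight piece. But for every \<open>\<eta>\<close> it has a piece,
  of some length comparable to \<open>\<rho>\<close>, that stays within \<open>\<eta> \<rho>\<close> of a line: take a chord whose slope
  almost attains the supremum of all slopes (\<open>lipschitz_almost_affine\<close>, \<open>flat_interface_pieces\<close>).
  On it the singularity of v is moved to the depth \<open>\<epsilon> = \<eta> \<rho>\<close> below the face, and v is divided by the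
  square root of \<open>\<rho>\<close>, which makes the problem invariant under scaling. The errors so made, and those
  from the deviation of the interface, then have square integrals bounded independently of \<open>\<eta>\<close>
  and \<open>\<rho>\<close>, and the pairing with g is bounded likewise (\<open>mixed_pairing_bound\<close>, \<open>pairing_le\<close>), whereas
  the square integral of v over the part of N grows like \<open>ln (1 / \<eta>)\<close> (\<open>test_datum_norm_ge\<close>). A
  superposition of normalised test functions, one for each of a sequence of \<open>\<eta>\<close>, is then a g
  whose pairings are unbounded (\<open>unbounded_pairing\<close>); it admits no solution.

  Apart from this argument one has to know that the surface measure is the area on each
  face. It is a sum over all faces, which is only meaningful because a polyhedral domain has finitely
  many of them (\<open>finite_open_faces\<close>) and each lies in a plane (\<open>open_face_plane\<close>).\<close>

section \<open>The divergence theorem on a box\<close>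

lemma integral_derivative:
  fixes f f' :: "real \<Rightarrow> real"
  assumes "a \<le> b" "\<And>x. x \<in> {a..b} \<Longrightarrow> (f has_real_derivative f' x) (at x within {a..b})"
  shows "integral {a..b} f' = f b - f a"
  using fundamental_theorem_of_calculus[of a b f f'] assms
  by (simp add: has_real_derivative_iff_has_vector_derivative integral_unique)

text \<open>Only the bottom of the box carries flux, because the fields vanish on the other faces. For each
  component the order of integration is chosen so that the innermost variable is that of its
  derivative.\<close>

lemma divergence_theorem_box:
  fixes W1 W2 W3 W1' W2' W3' :: "real \<Rightarrow> real \<Rightarrow> real \<Rightarrow> real"
    and a0 a1 s0 s1 t0 t1 :: real
  defines "B \<equiv> cbox (a0, s0, t0) (a1, s1, t1)"
  assumes le: "a0 \<le> a1" "s0 \<le> s1" "t0 \<le> t1"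
    and d1: "\<And>a s t. (a, s, t) \<in> B \<Longrightarrow> ((\<lambda>x. W1 x s t) has_real_derivative W1' a s t) (at a within {a0..a1})"
    and d2: "\<And>a s t. (a, s, t) \<in> B \<Longrightarrow> ((\<lambda>x. W2 a x t) has_real_derivative W2' a s t) (at s within {s0..s1})"
    and d3: "\<And>a s t. (a, s, t) \<in> B \<Longrightarrow> ((\<lambda>x. W3 a s x) has_real_derivative W3' a s t) (at t within {t0..t1})"
    and c1: "continuous_on B (\<lambda>(a, s, t). W1' a s t)"
    and c2: "continuous_on B (\<lambda>(a, s, t). W2' a s t)"
    and c3: "continuous_on B (\<lambda>(a, s, t). W3' a s t)"
    and z1: "\<And>s t. W1 a0 s t = 0" "\<And>s t. W1 a1 s t = 0"
    and z2: "\<And>a t. W2 a s0 t = 0" "\<And>a t. W2 a s1 t = 0"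
    and z3: "\<And>a s. W3 a s t1 = 0"
  shows "integral (cbox (a0, s0) (a1, s1)) (\<lambda>(a, s). W3 a s t0) =
         - integral (cbox (a0, s0) (a1, s1)) (\<lambda>(a, s). integral {t0..t1} (\<lambda>t. W1' a s t + W2' a s t + W3' a s t))"
proof -
  define R where "R = cbox (s0, t0) (s1, t1)"
  have BR: "B = {a0..a1} \<times> R" "R = {s0..s1} \<times> {t0..t1}"
    by (auto simp: B_def R_def cbox_Pair_eq)
  have contR: "continuous_on R (\<lambda>(s, t). f a s t)"
    if "a \<in> {a0..a1}" "continuous_on B (\<lambda>(a, s, t). f a s t)" for a and f :: "real \<Rightarrow> real \<Rightarrow> real \<Rightarrow> real"
  proof -
    have c: "continuous_on R (Pair a)" by (simp add: continuous_on_Pair)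
    have sub: "Pair a ` R \<subseteq> B" using that(1) by (auto simp: BR)
    show ?thesis using continuous_on_compose2[OF that(2) c sub] by (simp add: split_beta')
  qed
  have it: "integral B (\<lambda>(a, s, t). f a s t) = integral {a0..a1} (\<lambda>a. integral R (\<lambda>(s, t). f a s t))"
    if "continuous_on B (\<lambda>(a, s, t). f a s t)" for f :: "real \<Rightarrow> real \<Rightarrow> real \<Rightarrow> real"
    using integral_prod_continuous[of a0 "(s0,t0)" a1 "(s1,t1)" "\<lambda>(a, s, t). f a s t"] that
    by (simp add: B_def R_def split_beta')
  have I1: "integral B (\<lambda>(a, s, t). W1' a s t) = 0"
  proof -
    have "integral B (\<lambda>(a, s, t). W1' a s t) = integral R (\<lambda>x. integral {a0..a1} (\<lambda>a. W1' a (fst x) (snd x)))"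
      unfolding it[OF c1]
      using integral_swap_continuous[of a0 "(s0,t0)" a1 "(s1,t1)" "\<lambda>a x. W1' a (fst x) (snd x)"] c1
      by (simp add: B_def R_def split_beta')
    also have "\<dots> = integral R (\<lambda>x. 0)"
    proof (rule integral_cong)
      fix x assume x: "x \<in> R"
      show "integral {a0..a1} (\<lambda>a. W1' a (fst x) (snd x)) = 0"
        using integral_derivative[of a0 a1 "\<lambda>a. W1 a (fst x) (snd x)" "\<lambda>a. W1' a (fst x) (snd x)"]
          d1[of _ "fst x" "snd x"] x le z1 by (simp add: BR)
    qed
    finally show ?thesis by simp
  qed
  have I2: "integral B (\<lambda>(a, s, t). W2' a s t) = 0"
  proof -
    have "integral R (\<lambda>(s, t). W2' a s t) = 0" if a: "a \<in> {a0..a1}" for a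
    proof -
      have cR: "continuous_on R (\<lambda>(s, t). W2' a s t)" by (rule contR[OF a c2])
      have "integral R (\<lambda>(s, t). W2' a s t) = integral {t0..t1} (\<lambda>t. integral {s0..s1} (\<lambda>s. W2' a s t))"
        using integral_prod_continuous[of s0 t0 s1 t1 "\<lambda>(s, t). W2' a s t"]
          integral_swap_continuous[of s0 t0 s1 t1 "\<lambda>s t. W2' a s t"] cR by (simp add: R_def)
      also have "\<dots> = integral {t0..t1} (\<lambda>t. 0)"
      proof (rule integral_cong)
        fix t assume "t \<in> {t0..t1}"
        then show "integral {s0..s1} (\<lambda>s. W2' a s t) = 0"
          using integral_derivative[of s0 s1 "\<lambda>s. W2 a s t" "\<lambda>s. W2' a s t"] d2[of a _ t] a le z2
          by (simp add: BR)
      qed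
      finally show ?thesis by simp
    qed
    then have "integral {a0..a1} (\<lambda>a. integral R (\<lambda>(s, t). W2' a s t)) = integral {a0..a1} (\<lambda>_. 0)"
      by (intro integral_cong)
    then show ?thesis unfolding it[OF c2] by simp
  qed
  have csum: "continuous_on B (\<lambda>(a, s, t). W1' a s t + W2' a s t + W3' a s t)"
    using continuous_on_add[OF continuous_on_add[OF c1 c2] c3] by (simp add: split_beta')
  have sum: "integral B (\<lambda>(a, s, t). W1' a s t + W2' a s t + W3' a s t) = integral B (\<lambda>(a, s, t). W3' a s t)"
  proof -
    have int: "(\<lambda>(a, s, t). W1' a s t) integrable_on B" "(\<lambda>(a, s, t). W2' a s t) integrable_on B"
      "(\<lambda>(a, s, t). W3' a s t) integrable_on B"
      using c1 c2 c3 unfolding B_def by (auto intro: integrable_continuous)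
    have "integral B (\<lambda>x. (\<lambda>(a, s, t). W1' a s t) x + (\<lambda>(a, s, t). W2' a s t) x) = 0"
      using integral_add[OF int(1,2)] I1 I2 by simp
    then have "integral B (\<lambda>x. ((\<lambda>(a, s, t). W1' a s t) x + (\<lambda>(a, s, t). W2' a s t) x) + (\<lambda>(a, s, t). W3' a s t) x)
      = integral B (\<lambda>(a, s, t). W3' a s t)"
      using integral_add[OF integrable_add[OF int(1,2)] int(3)] by simp
    then show ?thesis by (simp only: split_beta')
  qed
  have plane: "integral B (\<lambda>(a, s, t). f a s t) = integral (cbox (a0, s0) (a1, s1)) (\<lambda>(a, s). integral {t0..t1} (f a s))"
    if f: "continuous_on B (\<lambda>(a, s, t). f a s t)" for f :: "real \<Rightarrow> real \<Rightarrow> real \<Rightarrow> real"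
  proof -
    have "continuous_on (cbox ((a0, s0), t0) ((a1, s1), t1))
        (\<lambda>x. (\<lambda>(a, s, t). f a s t) (fst (fst x), snd (fst x), snd x))"
      by (rule continuous_on_compose2[OF f]) (auto simp: BR cbox_Pair_eq intro!: continuous_intros)
    then have "continuous_on (cbox ((a0, s0), t0) ((a1, s1), t1)) (\<lambda>((a, s), t). f a s t)"
      by (simp add: split_beta')
    then have c: "continuous_on (cbox (a0, s0) (a1, s1)) (\<lambda>x. integral (cbox t0 t1) (\<lambda>t. (\<lambda>((a, s), t). f a s t) (x, t)))"
      by (intro integral_continuous_on_param) (auto simp: split_beta' cbox_Pair_eq)
    have "integral (cbox (a0, s0) (a1, s1)) (\<lambda>(a, s). integral {t0..t1} (f a s))
      = integral {a0..a1} (\<lambda>a. integral {s0..s1} (\<lambda>s. integral {t0..t1} (f a s)))"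
      using integral_prod_continuous[OF c] by (simp add: split_beta')
    also have "\<dots> = integral {a0..a1} (\<lambda>a. integral R (\<lambda>(s, t). f a s t))"
    proof (rule integral_cong)
      fix a assume "a \<in> {a0..a1}"
      then show "integral {s0..s1} (\<lambda>s. integral {t0..t1} (f a s)) = integral R (\<lambda>(s, t). f a s t)"
        using integral_prod_continuous[of s0 t0 s1 t1 "\<lambda>(s, t). f a s t"] contR[OF _ f, of a]
        by (simp add: R_def)
    qed
    finally show ?thesis using it[OF f] by simp
  qed
  have "integral (cbox (a0, s0) (a1, s1)) (\<lambda>(a, s). integral {t0..t1} (W3' a s))
      = integral (cbox (a0, s0) (a1, s1)) (\<lambda>(a, s). - W3 a s t0)"
  proof (rule integral_cong)
    fix x assume "x \<in> cbox (a0, s0) (a1, s1)"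
    then show "(\<lambda>(a, s). integral {t0..t1} (W3' a s)) x = (\<lambda>(a, s). - W3 a s t0) x"
      using integral_derivative[of t0 t1 "W3 (fst x) (snd x)" "W3' (fst x) (snd x)"]
        d3[of "fst x" "snd x"] le z3 by (auto simp: BR cbox_Pair_eq split_beta')
  qed
  also have "\<dots> = - integral (cbox (a0, s0) (a1, s1)) (\<lambda>(a, s). W3 a s t0)"
    by (simp add: split_beta' integral_neg)
  finally show ?thesis using plane[OF c3] plane[OF csum] sum by simp
qed

section \<open>The reciprocal square root in the upper half plane\<close>

text \<open>The reciprocal square root of z = s + i h. On the real axis its square 1 / z is real, so that it is
  real for s > 0 and imaginary for s < 0: its two components live on opposite sides of the
  singularity. Among the powers of z with this property it is the one whose square has a
  logarithmically divergent integral.\<close>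

definition kern :: "real \<Rightarrow> real \<Rightarrow> complex" where
  "kern s h = inverse (csqrt (Complex s h))"

definition kern' :: "real \<Rightarrow> real \<Rightarrow> complex" where
  "kern' s h = - inverse (2 * Complex s h * csqrt (Complex s h))"

lemma kern_field_derivative:
  assumes "h > 0"
  shows "((\<lambda>z. inverse (csqrt z)) has_field_derivative kern' s h) (at (Complex s h))"
proof -
  have nz: "Complex s h \<notin> \<real>\<^sub>\<le>\<^sub>0" "Complex s h \<noteq> 0"
    using assms by (auto simp: complex_nonpos_Reals_iff complex_eq_iff)
  have "csqrt (Complex s h) * csqrt (Complex s h) = Complex s h"
    by (metis power2_csqrt power2_eq_square)
  then have "- (inverse (csqrt (Complex s h)) * (inverse (2 * csqrt (Complex s h))) * inverse (csqrt (Complex s h))) = kern' s h"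
    unfolding kern'_def by (simp add: divide_simps nz)
  moreover have "(csqrt has_field_derivative inverse (2 * csqrt (Complex s h))) (at (Complex s h))"
    using has_field_derivative_csqrt[OF nz(1)] .
  ultimately show ?thesis
    using DERIV_inverse_fun[of csqrt "inverse (2 * csqrt (Complex s h))" "Complex s h" UNIV] nz
    by (simp add: mult_ac)
qed

text \<open>The factor between the derivatives in s and in h is the Cauchy-Riemann equations, written with
  the complex derivative of the kernel.\<close>

lemma kern_deriv_s:
  assumes "h > 0"
  shows "((\<lambda>s. kern s h) has_vector_derivative kern' s h) (at s within S)"
proof -
  have 1: "((\<lambda>s. Complex s h) has_vector_derivative 1) (at s)"
    by (auto simp: has_vector_derivative_complex_iff intro!: derivative_eq_intros)
  show ?thesis
    using field_vector_diff_chain_at[OF 1 kern_field_derivative[OF assms]]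
    unfolding kern_def o_def by (simp add: has_vector_derivative_at_within)
qed

lemma kern_deriv_h:
  assumes "h > 0"
  shows "((\<lambda>h. kern s h) has_vector_derivative \<i> * kern' s h) (at h within S)"
proof -
  have 1: "((\<lambda>h. Complex s h) has_vector_derivative \<i>) (at h)"
    by (auto simp: has_vector_derivative_complex_iff intro!: derivative_eq_intros)
  show ?thesis
    using field_vector_diff_chain_at[OF 1 kern_field_derivative[OF assms]]
    unfolding kern_def o_def by (simp add: has_vector_derivative_at_within)
qed

lemma Re_Im_kern_deriv:
  assumes "h > 0"
  shows "((\<lambda>s. Re (kern s h)) has_real_derivative Re (kern' s h)) (at s within S)"
    and "((\<lambda>s. Im (kern s h)) has_real_derivative Im (kern' s h)) (at s within S)"
    and "((\<lambda>h. Re (kern s h)) has_real_derivative - Im (kern' s h)) (at h within S)"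
    and "((\<lambda>h. Im (kern s h)) has_real_derivative Re (kern' s h)) (at h within S)"
  using kern_deriv_s[OF assms, of s S] kern_deriv_h[OF assms, of s S]
  by (auto simp: has_vector_derivative_complex_iff)

lemma continuous_on_kern:
  assumes "continuous_on S f" "continuous_on S g" "\<And>x. x \<in> S \<Longrightarrow> g x > 0"
  shows "continuous_on S (\<lambda>x. kern (f x) (g x))" "continuous_on S (\<lambda>x. kern' (f x) (g x))"
proof -
  have C: "continuous_on S (\<lambda>x. Complex (f x) (g x))"
    unfolding Complex_eq by (intro continuous_intros assms)
  have nz: "Complex (f x) (g x) \<noteq> 0" if "x \<in> S" for x
    using assms(3)[OF that] by (auto simp: complex_eq_iff)
  have nr: "Complex (f x) (g x) \<notin> \<real>\<^sub>\<le>\<^sub>0" if "x \<in> S" for x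
    using assms(3)[OF that] by (auto simp: complex_nonpos_Reals_iff)
  have D: "continuous_on S (\<lambda>x. csqrt (Complex (f x) (g x)))"
    by (rule continuous_on_compose2[of "- \<real>\<^sub>\<le>\<^sub>0" csqrt, OF _ C])
       (use nr in \<open>auto intro!: continuous_at_imp_continuous_on continuous_at_csqrt\<close>)
  show "continuous_on S (\<lambda>x. kern (f x) (g x))" "continuous_on S (\<lambda>x. kern' (f x) (g x))"
    unfolding kern_def kern'_def by (auto intro!: continuous_intros C D simp: nz)
qed

lemma norm_kern_sq: "(cmod (kern s h))\<^sup>2 = 1 / sqrt (s\<^sup>2 + h\<^sup>2)"
proof -
  have "(cmod (kern s h))\<^sup>2 = inverse (cmod (Complex s h))"
    by (simp add: kern_def norm_inverse power_inverse del: complex_norm)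
  then show ?thesis by (simp add: inverse_eq_divide complex_norm)
qed

lemma Re_kern_sq_add_Im_kern_sq: "(Re (kern s h))\<^sup>2 + (Im (kern s h))\<^sup>2 = 1 / sqrt (s\<^sup>2 + h\<^sup>2)"
  using norm_kern_sq[of s h] by (simp add: cmod_power2)

lemma Re_kern_sq_diff_Im_kern_sq: "(Re (kern s h))\<^sup>2 - (Im (kern s h))\<^sup>2 = s / (s\<^sup>2 + h\<^sup>2)"
proof -
  have "(kern s h)\<^sup>2 = inverse (Complex s h)"
    by (simp add: kern_def power_inverse)
  then have "Re ((kern s h)\<^sup>2) = s / (s\<^sup>2 + h\<^sup>2)" by simp
  then show ?thesis by (simp add: power2_eq_square)
qed

lemma Re_kern_nonneg: "0 \<le> Re (kern s h)"
  using Re_csqrt[of "Complex s h"] by (simp add: kern_def)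

lemma kern_sq_le_inverse:
  assumes "0 < b" "b \<le> h"
  shows "(Re (kern s h))\<^sup>2 \<le> 1 / b" "(Im (kern s h))\<^sup>2 \<le> 1 / b"
proof -
  have "b \<le> sqrt (s\<^sup>2 + h\<^sup>2)"
    using assms power_mono[of b h 2] by (intro real_le_rsqrt) (auto simp: add_increasing)
  then have "1 / sqrt (s\<^sup>2 + h\<^sup>2) \<le> 1 / b" using assms by (intro frac_le) auto
  then show "(Re (kern s h))\<^sup>2 \<le> 1 / b" "(Im (kern s h))\<^sup>2 \<le> 1 / b"
    using Re_kern_sq_add_Im_kern_sq[of s h] zero_le_power2[of "Re (kern s h)"]
      zero_le_power2[of "Im (kern s h)"] by linarith+
qed

text \<open>Up to the factor 2 this is the square of the component that would vanish if h were 0; it is of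
  the order of the Poisson kernel for the upper half plane at height \<open>\<epsilon>\<close>, whose integral does not
  depend on \<open>\<epsilon>\<close>.\<close>

lemma inverse_norm_diff_le:
  assumes "\<epsilon> > 0" "\<epsilon> \<le> h" "h \<le> 2 * \<epsilon>" "0 \<le> s"
  shows "1 / sqrt (s\<^sup>2 + h\<^sup>2) - s / (s\<^sup>2 + h\<^sup>2) \<le> 4 * \<epsilon> / (s\<^sup>2 + \<epsilon>\<^sup>2)"
proof -
  define z where "z = sqrt (s\<^sup>2 + h\<^sup>2)"
  have z2: "z\<^sup>2 = s\<^sup>2 + h\<^sup>2" by (simp add: z_def)
  have zp: "z > 0" "z \<ge> \<epsilon>" "z \<ge> s"
    using assms by (auto simp: z_def real_le_rsqrt sum_power2_gt_zero_iff add_increasing power_mono intro!: real_le_rsqrt)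
  have "(z - s) * (z + s) = h\<^sup>2" using z2 by (simp add: algebra_simps power2_eq_square)
  then have eq: "z - s = h\<^sup>2 / (z + s)" using zp assms by (simp add: field_simps)
  have "h\<^sup>2 \<le> (2*\<epsilon>)\<^sup>2" using assms by (intro power_mono) auto
  then have "z - s \<le> 4 * \<epsilon>\<^sup>2 / \<epsilon>"
    unfolding eq using zp assms by (intro frac_le) (auto simp: power2_eq_square)
  then have zs: "z - s \<le> 4 * \<epsilon>" using assms by (simp add: power2_eq_square)
  have "1 / z - s / z\<^sup>2 = (z - s) / z\<^sup>2" using zp by (simp add: field_simps power2_eq_square)
  also have "\<dots> \<le> 4 * \<epsilon> / (s\<^sup>2 + \<epsilon>\<^sup>2)"
    using zs zp assms power_mono[of \<epsilon> h 2] by (intro frac_le) (auto simp: z2 sum_power2_gt_zero_iff)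
  finally show ?thesis unfolding z2[symmetric] using z_def z2 by simp
qed

lemma inverse_norm_le_near:
  assumes "\<epsilon> > 0" "\<epsilon> \<le> h" "\<bar>s\<bar> \<le> \<epsilon>"
  shows "1 / sqrt (s\<^sup>2 + h\<^sup>2) \<le> 4 * \<epsilon> / (s\<^sup>2 + \<epsilon>\<^sup>2)"
proof -
  have "s\<^sup>2 \<le> \<epsilon>\<^sup>2" using assms by (simp add: abs_le_square_iff[symmetric])
  then have le: "s\<^sup>2 + \<epsilon>\<^sup>2 \<le> 4 * \<epsilon>\<^sup>2" using zero_le_power2[of \<epsilon>] by linarith
  have pos: "s\<^sup>2 + \<epsilon>\<^sup>2 > 0" using assms by (simp add: sum_power2_gt_zero_iff)
  have "1 / sqrt (s\<^sup>2 + h\<^sup>2) \<le> 1 / \<epsilon>"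
    using assms power_mono[of \<epsilon> h 2] by (intro frac_le real_le_rsqrt) (auto simp: add_increasing)
  also have "\<dots> = 4 * \<epsilon> / (4 * \<epsilon>\<^sup>2)" using assms by (simp add: power2_eq_square)
  also have "\<dots> \<le> 4 * \<epsilon> / (s\<^sup>2 + \<epsilon>\<^sup>2)"
    using le pos assms by (intro divide_left_mono) auto
  finally show ?thesis .
qed

lemma Re_kern_sq_le:
  assumes "\<epsilon> > 0" "\<epsilon> \<le> h" "h \<le> 2 * \<epsilon>" "s \<le> \<epsilon>"
  shows "(Re (kern s h))\<^sup>2 \<le> 4 * \<epsilon> / (s\<^sup>2 + \<epsilon>\<^sup>2)"
proof (cases "s \<le> 0")
  case True
  have "(Re (kern s h))\<^sup>2 \<le> 1 / sqrt (s\<^sup>2 + h\<^sup>2) + s / (s\<^sup>2 + h\<^sup>2)"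
    using Re_kern_sq_add_Im_kern_sq[of s h] Re_kern_sq_diff_Im_kern_sq[of s h]
      zero_le_power2[of "Re (kern s h)"] by linarith
  then show ?thesis using inverse_norm_diff_le[OF assms(1-3), of "-s"] True by simp
next
  case False
  then show ?thesis
    using Re_kern_sq_add_Im_kern_sq[of s h] inverse_norm_le_near[OF assms(1,2), of s] assms
      zero_le_power2[of "Im (kern s h)"] by linarith
qed

lemma Im_kern_sq_le:
  assumes "\<epsilon> > 0" "\<epsilon> \<le> h" "h \<le> 2 * \<epsilon>" "-\<epsilon> \<le> s"
  shows "(Im (kern s h))\<^sup>2 \<le> 4 * \<epsilon> / (s\<^sup>2 + \<epsilon>\<^sup>2)"
proof (cases "s \<ge> 0")
  case True
  have "(Im (kern s h))\<^sup>2 \<le> 1 / sqrt (s\<^sup>2 + h\<^sup>2) - s / (s\<^sup>2 + h\<^sup>2)"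
    using Re_kern_sq_add_Im_kern_sq[of s h] Re_kern_sq_diff_Im_kern_sq[of s h]
      zero_le_power2[of "Im (kern s h)"] by linarith
  then show ?thesis using inverse_norm_diff_le[OF assms(1-3), of "s"] True by simp
next
  case False
  then show ?thesis
    using Re_kern_sq_add_Im_kern_sq[of s h] inverse_norm_le_near[OF assms(1,2), of s] assms
      zero_le_power2[of "Re (kern s h)"] by linarith
qed

text \<open>On the side s < 0 the imaginary part is not small. But it can be multiplied by \<open>1 + \<epsilon> / s\<close>, which
  vanishes at \<open>s = -\<epsilon>\<close>, at the price of a remainder that is as small as the other errors.\<close>

lemma Im_kern_remainder_sq_le:
  assumes "\<epsilon> > 0" "s \<le> -\<epsilon>"
  shows "(Im (kern s h) * (\<epsilon> / s))\<^sup>2 \<le> 4 * \<epsilon> / (s\<^sup>2 + \<epsilon>\<^sup>2)"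
proof -
  have s: "s < 0" "\<epsilon> \<le> \<bar>s\<bar>" using assms by auto
  have "(Im (kern s h))\<^sup>2 \<le> 1 / sqrt (s\<^sup>2 + h\<^sup>2)"
    using Re_kern_sq_add_Im_kern_sq[of s h] zero_le_power2[of "Re (kern s h)"] by linarith
  also have "\<dots> \<le> 1 / \<epsilon>"
    using assms s by (intro frac_le real_le_rsqrt) (auto simp: abs_le_square_iff[symmetric] add_increasing2)
  finally have "(Im (kern s h) * (\<epsilon> / s))\<^sup>2 \<le> 1 / \<epsilon> * (\<epsilon> / s)\<^sup>2"
    unfolding power_mult_distrib by (intro mult_right_mono) auto
  also have "\<dots> = \<epsilon> / s\<^sup>2" using assms by (simp add: power2_eq_square)
  also have "\<dots> = 4 * \<epsilon> / (4 * s\<^sup>2)" by simp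
  also have "\<dots> \<le> 4 * \<epsilon> / (s\<^sup>2 + \<epsilon>\<^sup>2)"
  proof (rule divide_left_mono)
    have "\<epsilon>\<^sup>2 \<le> s\<^sup>2" using s assms by (simp add: abs_le_square_iff[symmetric])
    then show "s\<^sup>2 + \<epsilon>\<^sup>2 \<le> 4 * s\<^sup>2" using zero_le_power2[of s] by linarith
  qed (use assms s in \<open>auto simp: zero_less_mult_iff sum_power2_gt_zero_iff\<close>)
  finally show ?thesis .
qed

lemma Re_kern_sq_ge:
  assumes "0 < \<epsilon>" "\<epsilon> \<le> s"
  shows "(Re (kern s \<epsilon>))\<^sup>2 \<ge> 1 / (4 * s)"
proof -
  have "s / (s\<^sup>2 + \<epsilon>\<^sup>2) \<ge> 0" using assms by simp
  then have "2 * (Re (kern s \<epsilon>))\<^sup>2 \<ge> 1 / sqrt (s\<^sup>2 + \<epsilon>\<^sup>2)"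
    using Re_kern_sq_add_Im_kern_sq[of s \<epsilon>] Re_kern_sq_diff_Im_kern_sq[of s \<epsilon>] by linarith
  moreover have "1 / sqrt (s\<^sup>2 + \<epsilon>\<^sup>2) \<ge> 1 / (2 * s)"
  proof (rule divide_left_mono)
    have "\<epsilon>\<^sup>2 \<le> s\<^sup>2" using power_mono[of \<epsilon> s 2] assms by simp
    then have "s\<^sup>2 + \<epsilon>\<^sup>2 \<le> (2 * s)\<^sup>2"
      using zero_le_power2[of s] unfolding power_mult_distrib power2_eq_square by linarith
    then show "sqrt (s\<^sup>2 + \<epsilon>\<^sup>2) \<le> 2 * s" using assms by (intro real_le_lsqrt) auto
  qed (use assms in \<open>auto simp: zero_less_mult_iff sum_power2_gt_zero_iff\<close>)
  ultimately show ?thesis by simp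
qed

section \<open>Harmonic functions near a nearly straight interface\<close>

text \<open>A piece of the interface of size \<open>\<rho>\<close> that is straight up to \<open>\<epsilon>\<close>, in the coordinates a, s, t of the
  introduction: the Neumann part N0 of the square Q contains all points with \<open>s > \<epsilon>\<close>, and the zero
  Dirichlet condition holds at least for \<open>s \<le> -\<epsilon>\<close>. The functions G and H stand for the first and the
  pure second derivatives of U, K for the mixed one in s and t, and \<open>\<gamma>\<close> is the limit of the derivative of U
  in the direction t. In the application Z is the nontangential maximal function of the gradient.\<close>

locale flat_mixed_piece =
  fixes \<rho> \<epsilon> :: real and U G1 G2 G3 H1 H2 H3 K :: "real \<Rightarrow> real \<Rightarrow> real \<Rightarrow> real"
    and Z \<gamma> :: "real \<times> real \<Rightarrow> real" and N0 :: "(real \<times> real) set"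
  fixes Q :: "(real \<times> real) set" and B :: "(real \<times> real \<times> real) set"
    and M :: "(real \<times> real) measure"
  defines "Q \<equiv> {-\<rho>..\<rho>} \<times> {-\<rho>..\<rho>}" and "B \<equiv> {-\<rho>..\<rho>} \<times> {-\<rho>..\<rho>} \<times> {0<..\<rho>}"
    and "M \<equiv> restrict_space lborel Q"
  assumes eps: "0 < \<epsilon>" "\<epsilon> < \<rho>"
    and dU2: "\<And>a s t. (a, s, t) \<in> B \<Longrightarrow> ((\<lambda>x. U a x t) has_real_derivative G2 a s t) (at s)"
    and dU3: "\<And>a s t. (a, s, t) \<in> B \<Longrightarrow> ((\<lambda>x. U a s x) has_real_derivative G3 a s t) (at t)"
    and dG1: "\<And>a s t. (a, s, t) \<in> B \<Longrightarrow> ((\<lambda>x. G1 x s t) has_real_derivative H1 a s t) (at a)"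
    and dG2: "\<And>a s t. (a, s, t) \<in> B \<Longrightarrow> ((\<lambda>x. G2 a x t) has_real_derivative H2 a s t) (at s)"
    and dG3: "\<And>a s t. (a, s, t) \<in> B \<Longrightarrow> ((\<lambda>x. G3 a s x) has_real_derivative H3 a s t) (at t)"
    and dG23: "\<And>a s t. (a, s, t) \<in> B \<Longrightarrow> ((\<lambda>x. G2 a s x) has_real_derivative K a s t) (at t)"
    and dG32: "\<And>a s t. (a, s, t) \<in> B \<Longrightarrow> ((\<lambda>x. G3 a x t) has_real_derivative K a s t) (at s)"
    and lap: "\<And>a s t. (a, s, t) \<in> B \<Longrightarrow> H1 a s t + H2 a s t + H3 a s t = 0"
    and cU: "continuous_on B (\<lambda>(a, s, t). U a s t)"
    and cG1: "continuous_on B (\<lambda>(a, s, t). G1 a s t)"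
    and cG2: "continuous_on B (\<lambda>(a, s, t). G2 a s t)"
    and cG3: "continuous_on B (\<lambda>(a, s, t). G3 a s t)"
    and cH1: "continuous_on B (\<lambda>(a, s, t). H1 a s t)"
    and cH2: "continuous_on B (\<lambda>(a, s, t). H2 a s t)"
    and cH3: "continuous_on B (\<lambda>(a, s, t). H3 a s t)"
    and cK: "continuous_on B (\<lambda>(a, s, t). K a s t)"
    and Z_meas: "Z \<in> borel_measurable M" and g_meas: "\<gamma> \<in> borel_measurable M"
    and Z_int: "integrable M (\<lambda>x. (Z x)\<^sup>2)"
    and Z_bound: "AE x in M. \<forall>t\<in>{0<..\<rho>}. \<bar>G1 (fst x) (snd x) t\<bar> \<le> Z x \<and>
        \<bar>G2 (fst x) (snd x) t\<bar> \<le> Z x \<and> \<bar>G3 (fst x) (snd x) t\<bar> \<le> Z x"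
    and N0: "N0 \<in> sets borel" "\<And>x. x \<in> Q - N0 \<Longrightarrow> snd x \<le> \<epsilon>"
    and dirichlet: "AE x in M. snd x \<le> -\<epsilon> \<longrightarrow> (U (fst x) (snd x) \<longlongrightarrow> 0) (at_right 0)"
    and neumann: "AE x in M. x \<in> N0 \<longrightarrow> (G3 (fst x) (snd x) \<longlongrightarrow> \<gamma> x) (at_right 0)"
begin

text \<open>The singularity of the kernel lies at height \<open>-\<epsilon>\<close>, so that v and w are smooth up to the face.\<close>

abbreviation "v s t \<equiv> Re (kern s (t + \<epsilon>))"
abbreviation "w s t \<equiv> Im (kern s (t + \<epsilon>))"

definition "bump x = 1 - (x / \<rho>)\<^sup>2"

definition "cutoff a s t = bump a * bump s * (1 - t / \<rho>)"

lemma rho: "0 < \<rho>" using eps by simp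

lemma Q_cbox: "Q = cbox (-\<rho>, -\<rho>) (\<rho>, \<rho>)" by (auto simp: Q_def cbox_Pair_eq)

lemma Q_sets: "Q \<inter> space lborel \<in> sets lborel" by (simp add: Q_cbox)

lemma space_M: "space M = Q" by (simp add: M_def space_restrict_space)

lemma emeasure_M: "emeasure M Q = ennreal (4 * \<rho>\<^sup>2)"
  using rho unfolding M_def
  by (subst emeasure_restrict_space[OF Q_sets])
     (auto simp: Q_cbox emeasure_lborel_cbox_eq Basis_prod_def power2_eq_square prod.union_disjoint ennreal_mult[symmetric])

lemma finite_M: "finite_measure M"
  by (rule finite_measureI) (simp add: space_M emeasure_M)

lemma measure_M: "measure M Q = 4 * \<rho>\<^sup>2"
  by (simp add: measure_def emeasure_M)

lemma const_integrable: "integrable M (\<lambda>x. c :: real)"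
  using finite_measure.integrable_const[OF finite_M] .

lemma cont_meas: "continuous_on Q f \<Longrightarrow> f \<in> borel_measurable M"
  using borel_measurable_continuous_on_restrict[of Q f]
  by (simp add: M_def measurable_def space_restrict_space sets_restrict_space)

lemma cont_integrable:
  fixes f :: "real \<times> real \<Rightarrow> real"
  assumes "continuous_on Q f"
  shows "integrable M f" "(LINT x|M. f x) = integral Q f"
proof -
  have i: "set_integrable lborel Q f"
    using borel_integrable_compact[OF _ assms] by (simp add: set_integrable_def Q_cbox)
  then show "integrable M f"
    using integrable_restrict_space[OF Q_sets, of f] by (simp add: M_def set_integrable_def)
  show "(LINT x|M. f x) = integral Q f"
    using set_borel_integral_eq_integral(2)[OF i] integral_restrict_space[OF Q_sets, of f]
    by (simp add: M_def set_lebesgue_integral_def)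
qed

lemma AE_Q: "AE x in M. x \<in> Q"
  using AE_space[of M] by (simp add: space_M)

lemma slice_cont:
  assumes "continuous_on B (\<lambda>(a, s, t). f a s t)" "0 < t" "t \<le> \<rho>"
  shows "continuous_on Q (\<lambda>x. f (fst x) (snd x) t)"
proof -
  have "continuous_on Q (\<lambda>x. (\<lambda>(a, s, t). f a s t) (fst x, snd x, t))"
    by (rule continuous_on_compose2[OF assms(1)])
       (use assms(2,3) in \<open>auto simp: Q_def B_def intro!: continuous_intros\<close>)
  then show ?thesis by simp
qed

lemma v_w_le:
  assumes "0 < t"
  shows "\<bar>v s t\<bar> \<le> 1 / sqrt t" "\<bar>w s t\<bar> \<le> 1 / sqrt t"
proof -
  have "(v s t)\<^sup>2 \<le> (1 / sqrt t)\<^sup>2" "(w s t)\<^sup>2 \<le> (1 / sqrt t)\<^sup>2"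
    using kern_sq_le_inverse[of t "t + \<epsilon>" s] assms eps by (simp_all add: power_divide)
  then show "\<bar>v s t\<bar> \<le> 1 / sqrt t" "\<bar>w s t\<bar> \<le> 1 / sqrt t"
    using assms power2_le_iff_abs_le[of "1 / sqrt t"] by auto
qed

lemma bump_bounds:
  assumes "\<bar>x\<bar> \<le> \<rho>" shows "0 \<le> bump x" "bump x \<le> 1"
proof -
  have "\<bar>x / \<rho>\<bar> \<le> 1" using assms rho by (simp add: abs_divide)
  then have "(x / \<rho>)\<^sup>2 \<le> 1" by (simp add: abs_square_le_1)
  then show "0 \<le> bump x" "bump x \<le> 1" by (auto simp: bump_def)
qed

text \<open>The third component of the divergence free field, multiplied by the cut-off, and the divergence of
  the product: as the field is divergence free, only the derivatives of the cut-off remain.\<close>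

definition "flux a s t = cutoff a s t * (v s t * G3 a s t - w s t * G2 a s t)"

definition "bulk a s t =
  (- 2 * a / \<rho>\<^sup>2) * bump s * (1 - t / \<rho>) * (v s t * G1 a s t)
  + bump a * (- 2 * s / \<rho>\<^sup>2) * (1 - t / \<rho>) * (v s t * G2 a s t + w s t * G3 a s t)
  + bump a * bump s * (- 1 / \<rho>) * (v s t * G3 a s t - w s t * G2 a s t)"

lemma bulk_bound:
  assumes "(a, s, t) \<in> B" "\<bar>G1 a s t\<bar> \<le> z" "\<bar>G2 a s t\<bar> \<le> z" "\<bar>G3 a s t\<bar> \<le> z"
  shows "\<bar>bulk a s t\<bar> \<le> 10 / \<rho> * z * (1 / sqrt t)"
proof -
  have t: "0 < t" "t \<le> \<rho>" and as: "\<bar>a\<bar> \<le> \<rho>" "\<bar>s\<bar> \<le> \<rho>" using assms(1) by (auto simp: B_def)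
  define y where "y = z * (1 / sqrt t)"
  have z: "0 \<le> z" "0 \<le> y" using assms(2) t by (auto simp: y_def)
  have m: "\<bar>x * g\<bar> \<le> y" if "\<bar>x\<bar> \<le> 1 / sqrt t" "\<bar>g\<bar> \<le> z" for x g
    using mult_mono[OF that] t unfolding y_def abs_mult by (simp add: mult.commute)
  have k: "\<bar>p * q * r * f\<bar> \<le> 2 / \<rho> * c"
    if "\<bar>p * q * r\<bar> \<le> 2 / \<rho>" "\<bar>f\<bar> \<le> c" for p q r f c :: real
    using mult_mono[OF that] rho by (simp add: abs_mult)
  have lin: "\<bar>- 2 * x / \<rho>\<^sup>2\<bar> \<le> 2 / \<rho>" if "\<bar>x\<bar> \<le> \<rho>" for x
    using that rho by (simp add: abs_mult power2_eq_square field_simps)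
  have t1: "\<bar>1 - t / \<rho>\<bar> \<le> 1" using t rho by (simp add: abs_le_iff field_simps)
  have b: "\<bar>bump a\<bar> \<le> 1" "\<bar>bump s\<bar> \<le> 1" using bump_bounds as by auto
  have p1: "\<bar>(- 2 * a / \<rho>\<^sup>2) * bump s * (1 - t / \<rho>)\<bar> \<le> 2 / \<rho> * 1 * 1"
    unfolding abs_mult[of _ "1 - t / \<rho>"] abs_mult[of _ "bump s"]
    by (intro mult_mono lin as b t1) (use rho in auto)
  have p2: "\<bar>bump a * (- 2 * s / \<rho>\<^sup>2) * (1 - t / \<rho>)\<bar> \<le> 1 * (2 / \<rho>) * 1"
    unfolding abs_mult[of _ "1 - t / \<rho>"] abs_mult[of "bump a"]
    by (intro mult_mono lin as b t1) (use rho in auto)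
  have p3: "\<bar>bump a * bump s * (- 1 / \<rho>)\<bar> \<le> 1 * 1 * (2 / \<rho>)"
    unfolding abs_mult by (intro mult_mono b) (use rho in \<open>auto simp: divide_right_mono\<close>)
  note vw = v_w_le[OF t(1), of s]
  have f1: "\<bar>v s t * G1 a s t\<bar> \<le> y" by (intro m vw assms)
  have f2: "\<bar>v s t * G2 a s t + w s t * G3 a s t\<bar> \<le> 2 * y"
    using m[OF vw(1) assms(3)] m[OF vw(2) assms(4)] by linarith
  have f3: "\<bar>v s t * G3 a s t - w s t * G2 a s t\<bar> \<le> 2 * y"
    using m[OF vw(1) assms(4)] m[OF vw(2) assms(3)] by linarith
  have "\<bar>bulk a s t\<bar> \<le> 2 / \<rho> * y + 2 / \<rho> * (2 * y) + 2 / \<rho> * (2 * y)"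
    unfolding bulk_def
    by (intro order_trans[OF abs_triangle_ineq] add_mono k f1 f2 f3) (use p1 p2 p3 in auto)
  also have "\<dots> = 10 / \<rho> * y" by simp
  finally show ?thesis by (simp add: y_def)
qed

text \<open>The second derivatives of U enter only through the Laplacian and through the difference of the two
  mixed derivatives in s and t, and both vanish; the derivatives of v and w cancel by the
  Cauchy-Riemann equations.\<close>

lemma flux_divergence:
  assumes t0: "0 < t0" "t0 \<le> \<rho>"
  shows "(LINT x|M. flux (fst x) (snd x) t0) = - (LINT x|M. integral {t0..\<rho>} (bulk (fst x) (snd x)))"
    and "continuous_on Q (\<lambda>x. integral {t0..\<rho>} (bulk (fst x) (snd x)))"
    and "continuous_on Q (\<lambda>x. flux (fst x) (snd x) t0)"
    and "\<And>x. x \<in> Q \<Longrightarrow> continuous_on {t0..\<rho>} (bulk (fst x) (snd x))"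
proof -
  define C where "C = cbox (-\<rho>, -\<rho>, t0) (\<rho>, \<rho>, \<rho>)"
  have C: "C = {-\<rho>..\<rho>} \<times> {-\<rho>..\<rho>} \<times> {t0..\<rho>}" "C \<subseteq> B"
    using t0 by (auto simp: C_def B_def cbox_Pair_eq)
  define v' where "v' s t = Re (kern' s (t + \<epsilon>))" for s t
  define w' where "w' s t = Im (kern' s (t + \<epsilon>))" for s t
  have pos: "t + \<epsilon> > 0" if "(a, s, t) \<in> B" for a s t using that eps by (auto simp: B_def)
  define W1 where "W1 a s t = cutoff a s t * (v s t * G1 a s t)" for a s t
  define W2 where "W2 a s t = cutoff a s t * (v s t * G2 a s t + w s t * G3 a s t)" for a s t
  define W1' where "W1' a s t = (- 2 * a / \<rho>\<^sup>2) * bump s * (1 - t / \<rho>) * (v s t * G1 a s t)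
      + cutoff a s t * (v s t * H1 a s t)" for a s t
  define W2' where "W2' a s t = bump a * (- 2 * s / \<rho>\<^sup>2) * (1 - t / \<rho>) * (v s t * G2 a s t + w s t * G3 a s t)
      + cutoff a s t * (v' s t * G2 a s t + v s t * H2 a s t + w' s t * G3 a s t + w s t * K a s t)" for a s t
  define W3' where "W3' a s t = bump a * bump s * (- 1 / \<rho>) * (v s t * G3 a s t - w s t * G2 a s t)
      + cutoff a s t * (- w' s t * G3 a s t + v s t * H3 a s t - v' s t * G2 a s t - w s t * K a s t)" for a s t
  have dv: "((\<lambda>x. v x t) has_real_derivative v' s t) (at s)" "((\<lambda>x. w x t) has_real_derivative w' s t) (at s)"
    "((\<lambda>x. v s x) has_real_derivative - w' s t) (at t)" "((\<lambda>x. w s x) has_real_derivative v' s t) (at t)"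
    if "(a, s, t) \<in> B" for a s t
    unfolding v'_def w'_def
    using Re_Im_kern_deriv(1,2)[OF pos[OF that], of s UNIV]
      Re_Im_kern_deriv(3,4)[OF pos[OF that], of s UNIV, THEN DERIV_shift[THEN iffD1]] by simp_all
  have dbump: "(bump has_real_derivative - 2 * x / \<rho>\<^sup>2) (at x)" for x
    unfolding bump_def using rho by (auto intro!: derivative_eq_intros simp: power2_eq_square)
  have dl: "((\<lambda>t. 1 - t / \<rho>) has_real_derivative - 1 / \<rho>) (at x)" for x
    using rho by (auto intro!: derivative_eq_intros)
  have ck: "continuous_on B (\<lambda>x. kern (fst (snd x)) (snd (snd x) + \<epsilon>))"
    "continuous_on B (\<lambda>x. kern' (fst (snd x)) (snd (snd x) + \<epsilon>))"
    using pos by (auto intro!: continuous_on_kern continuous_intros)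
  have cb1: "continuous_on B (\<lambda>x. bump (fst x))"
    unfolding bump_def by (intro continuous_intros) (use rho in auto)
  have cb2: "continuous_on B (\<lambda>x. bump (fst (snd x)))"
    unfolding bump_def by (intro continuous_intros) (use rho in auto)
  have cl: "continuous_on B (\<lambda>x. 1 - snd (snd x) / \<rho>)"
    by (intro continuous_intros) (use rho in auto)
  have ca: "continuous_on B (\<lambda>x. - 2 * fst x / \<rho>\<^sup>2)" "continuous_on B (\<lambda>x. - 2 * fst (snd x) / \<rho>\<^sup>2)"
    by (intro continuous_intros; use rho in auto)+
  note cc = cl ca cb1 cb2 continuous_on_Re[OF ck(1)] continuous_on_Im[OF ck(1)]
    continuous_on_Re[OF ck(2), folded v'_def] continuous_on_Im[OF ck(2), folded w'_def]
    cG1[unfolded split_beta'] cG2[unfolded split_beta'] cG3[unfolded split_beta'] cH1[unfolded split_beta']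
    cH2[unfolded split_beta'] cH3[unfolded split_beta'] cK[unfolded split_beta']
  have cW1: "continuous_on B (\<lambda>(a, s, t). W1' a s t)"
    unfolding W1'_def cutoff_def split_beta' by (intro cc continuous_on_add continuous_on_mult continuous_on_diff continuous_on_minus continuous_on_const)
  have cW2: "continuous_on B (\<lambda>(a, s, t). W2' a s t)"
    unfolding W2'_def cutoff_def split_beta' by (intro cc continuous_on_add continuous_on_mult continuous_on_diff continuous_on_minus continuous_on_const)
  have cW3: "continuous_on B (\<lambda>(a, s, t). W3' a s t)"
    unfolding W3'_def cutoff_def split_beta' by (intro cc continuous_on_add continuous_on_mult continuous_on_diff continuous_on_minus continuous_on_const)
  note cW = cW1[THEN continuous_on_subset, OF C(2)] cW2[THEN continuous_on_subset, OF C(2)]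
    cW3[THEN continuous_on_subset, OF C(2)]
  have cb: "continuous_on B (\<lambda>(a, s, t). bulk a s t)"
    unfolding bulk_def split_beta' by (intro cc continuous_on_add continuous_on_mult continuous_on_diff continuous_on_minus continuous_on_const)
  have cf: "continuous_on B (\<lambda>(a, s, t). flux a s t)"
    unfolding flux_def cutoff_def split_beta' by (intro cc continuous_on_add continuous_on_mult continuous_on_diff continuous_on_minus continuous_on_const)
  have sum: "W1' a s t + W2' a s t + W3' a s t = bulk a s t" if "(a, s, t) \<in> B" for a s t
  proof -
    have "W1' a s t + W2' a s t + W3' a s t = bulk a s t + cutoff a s t * v s t * (H1 a s t + H2 a s t + H3 a s t)"
      unfolding W1'_def W2'_def W3'_def bulk_def by (simp add: algebra_simps)
    then show ?thesis using lap[OF that] by simp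
  qed
  have z: "bump \<rho> = 0" "bump (-\<rho>) = 0" using rho by (auto simp: bump_def)
  have dc1: "((\<lambda>x. cutoff x s t) has_real_derivative (- 2 * a / \<rho>\<^sup>2) * bump s * (1 - t / \<rho>)) (at a)" for a s t
    unfolding cutoff_def by (intro DERIV_cmult_right dbump)
  have dc2: "((\<lambda>x. cutoff a x t) has_real_derivative bump a * (- 2 * s / \<rho>\<^sup>2) * (1 - t / \<rho>)) (at s)" for a s t
    unfolding cutoff_def by (intro DERIV_cmult_right DERIV_cmult dbump)
  have dc3: "((\<lambda>x. cutoff a s x) has_real_derivative bump a * bump s * (- 1 / \<rho>)) (at t)" for a s t
    unfolding cutoff_def by (intro DERIV_cmult dl)
  have dW1: "((\<lambda>x. W1 x s t) has_real_derivative W1' a s t) (at a within {-\<rho>..\<rho>})" if "(a,s,t) \<in> C" for a s t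
  proof -
    have b: "(a,s,t) \<in> B" using that C by auto
    have "((\<lambda>x. W1 x s t) has_real_derivative W1' a s t) (at a)"
      unfolding W1_def W1'_def
      by (rule DERIV_cong[OF DERIV_mult[OF dc1 DERIV_cmult[OF dG1[OF b]]]]) (simp add: mult.commute)
    then show ?thesis by (rule has_field_derivative_at_within)
  qed
  have dW2: "((\<lambda>x. W2 a x t) has_real_derivative W2' a s t) (at s within {-\<rho>..\<rho>})" if "(a,s,t) \<in> C" for a s t
  proof -
    have b: "(a,s,t) \<in> B" using that C by auto
    have "((\<lambda>x. W2 a x t) has_real_derivative W2' a s t) (at s)"
      unfolding W2_def W2'_def
      by (rule DERIV_cong[OF DERIV_mult[OF dc2 DERIV_add[OF DERIV_mult[OF dv(1)[OF b] dG2[OF b]]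
              DERIV_mult[OF dv(2)[OF b] dG32[OF b]]]]]) (simp add: algebra_simps)
    then show ?thesis by (rule has_field_derivative_at_within)
  qed
  have dW3: "((\<lambda>x. flux a s x) has_real_derivative W3' a s t) (at t within {t0..\<rho>})" if "(a,s,t) \<in> C" for a s t
  proof -
    have b: "(a,s,t) \<in> B" using that C by auto
    have "((\<lambda>x. flux a s x) has_real_derivative W3' a s t) (at t)"
      unfolding flux_def W3'_def
      by (rule DERIV_cong[OF DERIV_mult[OF dc3 DERIV_diff[OF DERIV_mult[OF dv(3)[OF b] dG3[OF b]]
              DERIV_mult[OF dv(4)[OF b] dG23[OF b]]]]]) (simp add: algebra_simps)
    then show ?thesis by (rule has_field_derivative_at_within)
  qed
  have "integral Q (\<lambda>(a, s). flux a s t0) = - integral Q (\<lambda>(a, s). integral {t0..\<rho>} (\<lambda>t. W1' a s t + W2' a s t + W3' a s t))"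
    unfolding Q_cbox
    by (rule divergence_theorem_box[where ?W1.0=W1 and ?W2.0=W2 and ?W3.0=flux and W1'=W1' and W2'=W2' and W3'=W3'])
       (use t0 rho z dW1 dW2 dW3 cW in \<open>auto simp: C_def W1_def W2_def flux_def cutoff_def\<close>)
  also have "integral Q (\<lambda>(a, s). integral {t0..\<rho>} (\<lambda>t. W1' a s t + W2' a s t + W3' a s t))
     = integral Q (\<lambda>x. integral {t0..\<rho>} (bulk (fst x) (snd x)))"
    by (rule integral_cong) (use sum t0 in \<open>auto simp: Q_def B_def intro!: integral_cong\<close>)
  finally have eq: "integral Q (\<lambda>x. flux (fst x) (snd x) t0) = - integral Q (\<lambda>x. integral {t0..\<rho>} (bulk (fst x) (snd x)))"
    by (simp add: split_beta')
  have "continuous_on (cbox ((-\<rho>, -\<rho>), t0) ((\<rho>, \<rho>), \<rho>))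
      (\<lambda>x. (\<lambda>(a, s, t). bulk a s t) (fst (fst x), snd (fst x), snd x))"
    by (rule continuous_on_compose2[OF cb])
       (use t0 in \<open>auto simp: B_def cbox_Pair_eq intro!: continuous_intros\<close>)
  then have "continuous_on (cbox ((-\<rho>, -\<rho>), t0) ((\<rho>, \<rho>), \<rho>)) (\<lambda>(x, t). bulk (fst x) (snd x) t)"
    by (simp add: split_beta')
  then show c1: "continuous_on Q (\<lambda>x. integral {t0..\<rho>} (bulk (fst x) (snd x)))"
    unfolding Q_cbox interval_cbox using integral_continuous_on_param[where f="\<lambda>x. bulk (fst x) (snd x)"]
    by (simp add: cbox_Pair_eq)
  show c2: "continuous_on Q (\<lambda>x. flux (fst x) (snd x) t0)" by (rule slice_cont[OF cf t0])
  show "(LINT x|M. flux (fst x) (snd x) t0) = - (LINT x|M. integral {t0..\<rho>} (bulk (fst x) (snd x)))"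
    using cont_integrable(2)[OF c1] cont_integrable(2)[OF c2] eq by simp
  show "continuous_on {t0..\<rho>} (bulk (fst x) (snd x))" if "x \<in> Q" for x
  proof -
    have "continuous_on {t0..\<rho>} (\<lambda>t. (\<lambda>(a, s, t). bulk a s t) (fst x, snd x, t))"
      by (rule continuous_on_compose2[OF cb])
         (use that t0 in \<open>auto simp: B_def Q_def intro!: continuous_intros\<close>)
    then show ?thesis by simp
  qed
qed

lemma inverse_sqrt_integral:
  assumes "0 < t0" "t0 \<le> \<rho>"
  shows "((\<lambda>t. 1 / sqrt t) has_integral 2 * sqrt \<rho> - 2 * sqrt t0) {t0..\<rho>}"
  by (rule fundamental_theorem_of_calculus)
     (use assms in \<open>auto intro!: derivative_eq_intros simp: has_real_derivative_iff_has_vector_derivative[symmetric] divide_simps\<close>)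

text \<open>The factor 1 / sqrt t from the kernel is integrable in t, which gives \<open>Z / \<rho>\<close> times the
  square root of \<open>\<rho>\<close>; the arithmetic-geometric mean inequality turns the product into a constant on a
  square of area \<open>4 \<rho>\<^sup>2\<close> and the square of Z. The bound does not depend on \<open>\<epsilon>\<close>.\<close>

lemma flux_bound:
  assumes t0: "0 < t0" "t0 \<le> \<rho>"
  shows "\<bar>LINT x|M. flux (fst x) (snd x) t0\<bar> \<le> sqrt \<rho> * (40 + 10 * (LINT x|M. (Z x)\<^sup>2))"
proof -
  have bd: "AE x in M. norm (integral {t0..\<rho>} (bulk (fst x) (snd x))) \<le> sqrt \<rho> * (10 / \<rho>\<^sup>2 + 10 * (Z x)\<^sup>2)"
    using Z_bound AE_Q
  proof eventually_elim
    case (elim x)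
    have z: "0 \<le> Z x" using elim(1) rho by force
    have "norm (integral {t0..\<rho>} (bulk (fst x) (snd x))) \<le> integral {t0..\<rho>} (\<lambda>t. 10 / \<rho> * Z x * (1 / sqrt t))"
    proof (rule integral_norm_bound_integral)
      show "bulk (fst x) (snd x) integrable_on {t0..\<rho>}"
        using flux_divergence(4)[OF t0 elim(2)] by (rule integrable_continuous_interval)
      show "(\<lambda>t. 10 / \<rho> * Z x * (1 / sqrt t)) integrable_on {t0..\<rho>}"
        using has_integral_mult_right[OF inverse_sqrt_integral[OF t0]] by blast
      show "norm (bulk (fst x) (snd x) t) \<le> 10 / \<rho> * Z x * (1 / sqrt t)" if "t \<in> {t0..\<rho>}" for t
        unfolding real_norm_def by (rule bulk_bound) (use elim that t0 in \<open>auto simp: Q_def B_def\<close>)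
    qed
    also have "\<dots> = 10 / \<rho> * Z x * (2 * sqrt \<rho> - 2 * sqrt t0)"
      using has_integral_mult_right[OF inverse_sqrt_integral[OF t0], of "10 / \<rho> * Z x"] by (rule integral_unique)
    also have "\<dots> \<le> 10 / \<rho> * Z x * (2 * sqrt \<rho>)" using z rho t0 by (intro mult_left_mono) auto
    also have "\<dots> = sqrt \<rho> * (10 * (2 * (1 / \<rho>) * Z x))" by (simp add: field_simps)
    also have "\<dots> \<le> sqrt \<rho> * (10 * ((1 / \<rho>)\<^sup>2 + (Z x)\<^sup>2))"
      using sum_squares_bound[of "1 / \<rho>" "Z x"] rho by (intro mult_left_mono) auto
    finally show ?case by (simp add: power_divide algebra_simps)
  qed
  have ib: "integrable M (\<lambda>x. sqrt \<rho> * (10 / \<rho>\<^sup>2 + 10 * (Z x)\<^sup>2))"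
    using Z_int const_integrable by auto
  have "\<bar>LINT x|M. flux (fst x) (snd x) t0\<bar> = norm (LINT x|M. integral {t0..\<rho>} (bulk (fst x) (snd x)))"
    using flux_divergence(1)[OF t0] by simp
  also have "\<dots> \<le> (LINT x|M. sqrt \<rho> * (10 / \<rho>\<^sup>2 + 10 * (Z x)\<^sup>2))"
  proof (rule order_trans[OF integral_norm_bound])
    show "(LINT x|M. norm (integral {t0..\<rho>} (bulk (fst x) (snd x)))) \<le> (LINT x|M. sqrt \<rho> * (10 / \<rho>\<^sup>2 + 10 * (Z x)\<^sup>2))"
      by (intro integral_mono_AE bd ib integrable_norm cont_integrable(1)[OF flux_divergence(2)[OF t0]])
  qed
  also have "\<dots> = sqrt \<rho> * (10 / \<rho>\<^sup>2 * (4 * \<rho>\<^sup>2) + 10 * (LINT x|M. (Z x)\<^sup>2))"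
    using Z_int const_integrable by (simp add: space_M measure_M)
  also have "\<dots> = sqrt \<rho> * (40 + 10 * (LINT x|M. (Z x)\<^sup>2))" using rho by simp
  finally show ?thesis .
qed

text \<open>The part of the square that surely belongs to D.\<close>

definition "Q' = {-\<rho>..\<rho>} \<times> {-\<rho>..-\<epsilon>}"

text \<open>This majorises the squares of the factors v and w in all error terms. Its integral over the line is \<open>4 \<pi>\<close> for every \<open>\<epsilon>\<close>.\<close>

definition "weight s = 4 * \<epsilon> / (s\<^sup>2 + \<epsilon>\<^sup>2)"

lemma Q'_cbox: "Q' = cbox (-\<rho>, -\<rho>) (\<rho>, -\<epsilon>)" by (auto simp: Q'_def cbox_Pair_eq)

lemma Q'_subset: "Q' \<subseteq> Q" using eps by (auto simp: Q'_def Q_def)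

lemma Q'_integral:
  fixes f :: "real \<times> real \<Rightarrow> real"
  assumes "continuous_on Q' f"
  shows "integrable M (\<lambda>x. indicator Q' x * f x)" "(LINT x|M. indicator Q' x * f x) = integral Q' f"
proof -
  have i: "set_integrable lborel Q' f"
    using borel_integrable_compact[OF _ assms] by (simp add: set_integrable_def Q'_cbox)
  have eq: "indicator Q x *\<^sub>R (indicator Q' x * f x) = indicator Q' x *\<^sub>R f x" for x
    using Q'_subset by (auto simp: indicator_def)
  show "integrable M (\<lambda>x. indicator Q' x * f x)"
    using integrable_restrict_space[OF Q_sets, of "\<lambda>x. indicator Q' x * f x"] i
    unfolding M_def set_integrable_def eq by simp
  show "(LINT x|M. indicator Q' x * f x) = integral Q' f"
    using set_borel_integral_eq_integral(2)[OF i] integral_restrict_space[OF Q_sets, of "\<lambda>x. indicator Q' x * f x"]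
    unfolding M_def set_lebesgue_integral_def eq by simp
qed

lemma weight_integral:
  "integrable M (\<lambda>x. weight (snd x))" "(LINT x|M. weight (snd x)) \<le> 40 * \<rho>"
proof -
  have c: "continuous_on Q (\<lambda>x. weight (snd x))"
    unfolding weight_def by (intro continuous_intros) (use eps in \<open>auto simp: add_nonneg_eq_0_iff\<close>)
  then show "integrable M (\<lambda>x. weight (snd x))" by (rule cont_integrable)
  have ftc: "(weight has_integral 4 * arctan (\<rho> / \<epsilon>) - 4 * arctan (- \<rho> / \<epsilon>)) {-\<rho>..\<rho>}"
  proof (rule fundamental_theorem_of_calculus)
    fix s
    have "((\<lambda>s. 4 * arctan (s / \<epsilon>)) has_real_derivative 4 * (inverse (1 + (s / \<epsilon>)\<^sup>2) * (1 / \<epsilon>))) (at s within {-\<rho>..\<rho>})"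
      using eps by (auto intro!: derivative_eq_intros)
    moreover have "4 * (inverse (1 + (s / \<epsilon>)\<^sup>2) * (1 / \<epsilon>)) = weight s"
    proof -
      have "1 + (s / \<epsilon>)\<^sup>2 = (s\<^sup>2 + \<epsilon>\<^sup>2) / \<epsilon>\<^sup>2" using eps by (simp add: field_simps)
      then show ?thesis using eps by (simp add: weight_def power2_eq_square)
    qed
    ultimately show "((\<lambda>s. 4 * arctan (s / \<epsilon>)) has_vector_derivative weight s) (at s within {-\<rho>..\<rho>})"
      by (simp add: has_real_derivative_iff_has_vector_derivative)
  qed (use rho in simp)
  have "(LINT x|M. weight (snd x)) = integral {-\<rho>..\<rho>} (\<lambda>a. integral {-\<rho>..\<rho>} weight)"
    using cont_integrable(2)[OF c] integral_prod_continuous[of "-\<rho>" "-\<rho>" \<rho> \<rho> "\<lambda>x. weight (snd x)"] c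
    unfolding Q_cbox by simp
  also have "\<dots> = 2 * \<rho> * (4 * arctan (\<rho> / \<epsilon>) - 4 * arctan (- \<rho> / \<epsilon>))"
    using ftc rho by (simp add: integral_unique)
  also have "\<dots> \<le> 2 * \<rho> * 20"
    using arctan_ubound[of "\<rho> / \<epsilon>"] arctan_lbound[of "- \<rho> / \<epsilon>"] pi_less_4 rho
    by (intro mult_left_mono) auto
  finally show "(LINT x|M. weight (snd x)) \<le> 40 * \<rho>" by simp
qed

lemma cutoff_bounds:
  assumes "(a, s) \<in> Q" "0 \<le> t" "t \<le> \<rho>"
  shows "\<bar>cutoff a s t\<bar> \<le> 1"
proof -
  have "\<bar>a\<bar> \<le> \<rho>" "\<bar>s\<bar> \<le> \<rho>" using assms(1) by (auto simp: Q_def)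
  then have b: "\<bar>bump a\<bar> \<le> 1" "\<bar>bump s\<bar> \<le> 1" using bump_bounds by auto
  have t1: "\<bar>1 - t / \<rho>\<bar> \<le> 1" using assms rho by (simp add: abs_le_iff field_simps)
  have "\<bar>cutoff a s t\<bar> \<le> 1 * 1 * 1"
    unfolding cutoff_def abs_mult by (intro mult_mono b t1) auto
  then show ?thesis by simp
qed

lemma Z_integrable: "integrable M Z"
proof (rule Bochner_Integration.integrable_bound[of M "\<lambda>x. 1 + (Z x)\<^sup>2"])
  show "integrable M (\<lambda>x. 1 + (Z x)\<^sup>2)" using Z_int const_integrable by auto
  have "\<bar>y\<bar> \<le> 1 + y\<^sup>2" for y :: real
    using sum_squares_bound[of 1 "\<bar>y\<bar>"] by simp
  then show "AE x in M. norm (Z x) \<le> norm (1 + (Z x)\<^sup>2)"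
    by (auto intro!: AE_I2 simp: order_trans[OF _ abs_ge_self])
qed (rule Z_meas)

text \<open>As Z bounds the derivative in t along the whole normal segment, zero boundary values give a bound
  that is linear in the height, so that U tends to 0 at a known rate.\<close>

lemma potential_le_height:
  "AE x in M. snd x \<le> -\<epsilon> \<longrightarrow> (\<forall>t\<in>{0<..\<rho>}. \<bar>U (fst x) (snd x) t\<bar> \<le> t * Z x)"
  using dirichlet Z_bound AE_Q
proof eventually_elim
  case (elim x)
  show ?case
  proof (intro impI ballI)
    fix t assume s: "snd x \<le> -\<epsilon>" and t: "t \<in> {0<..\<rho>}"
    have lip: "\<bar>U (fst x) (snd x) t - U (fst x) (snd x) t'\<bar> \<le> t * Z x" if t': "0 < t'" "t' < t" for t'
    proof -
      have "\<bar>U (fst x) (snd x) t - U (fst x) (snd x) t'\<bar> \<le> Z x * \<bar>t - t'\<bar>"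
      proof (rule field_differentiable_bound[of "{t'..t}" "U (fst x) (snd x)" "G3 (fst x) (snd x)", unfolded real_norm_def])
        show "(U (fst x) (snd x) has_real_derivative G3 (fst x) (snd x) y) (at y within {t'..t})" if "y \<in> {t'..t}" for y
          by (rule has_field_derivative_at_within[OF dU3]) (use elim(3) that t t' in \<open>auto simp: B_def Q_def\<close>)
        show "\<bar>G3 (fst x) (snd x) y\<bar> \<le> Z x" if "y \<in> {t'..t}" for y using elim(2) that t t' by auto
      qed (use t' in auto)
      also have "\<dots> \<le> Z x * t"
        using t t' elim(2) by (intro mult_left_mono) force+
      finally show ?thesis by (simp add: mult.commute)
    qed
    have lim: "((\<lambda>t'. \<bar>U (fst x) (snd x) t - U (fst x) (snd x) t'\<bar>) \<longlongrightarrow> \<bar>U (fst x) (snd x) t - 0\<bar>) (at_right 0)"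
      using elim(1) s by (intro tendsto_intros) auto
    have ev: "\<forall>\<^sub>F t' in at_right 0. \<bar>U (fst x) (snd x) t - U (fst x) (snd x) t'\<bar> \<le> t * Z x"
      unfolding eventually_at_right_field using lip t by (intro exI[of _ t]) auto
    show "\<bar>U (fst x) (snd x) t\<bar> \<le> t * Z x"
      using tendsto_upperbound[OF lim ev] by simp
  qed
qed

text \<open>The main part of the term with w on D. The last factor vanishes at \<open>s = -\<epsilon>\<close> and the cut-off
  vanishes at \<open>s = -\<rho>\<close>, so that integration by parts in s produces no boundary terms.\<close>

definition "tail a s t = cutoff a s t * w s t * (1 + \<epsilon> / s)"

text \<open>The tangential derivative G2 is traded for U itself, which tends to 0 on D. The bound C depends on
  \<open>\<epsilon>\<close> and \<open>\<rho>\<close>; this is harmless, since it is only used for t tending to 0.\<close>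

lemma tail_parts:
  obtains tail' C where
    "\<And>t. 0 < t \<Longrightarrow> t \<le> \<rho> \<Longrightarrow> continuous_on Q' (\<lambda>x. tail' (fst x) (snd x) t)"
    "\<And>a s t. (a, s) \<in> Q' \<Longrightarrow> 0 < t \<Longrightarrow> t \<le> \<rho> \<Longrightarrow> \<bar>tail' a s t\<bar> \<le> C"
    "\<And>t. 0 < t \<Longrightarrow> t \<le> \<rho> \<Longrightarrow>
       integral Q' (\<lambda>x. tail (fst x) (snd x) t * G2 (fst x) (snd x) t) =
       - integral Q' (\<lambda>x. tail' (fst x) (snd x) t * U (fst x) (snd x) t)"
    "\<And>t. 0 < t \<Longrightarrow> t \<le> \<rho> \<Longrightarrow> continuous_on Q' (\<lambda>x. tail (fst x) (snd x) t * G2 (fst x) (snd x) t)"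
proof -
  define c2 where "c2 a s t = bump a * (- 2 * s / \<rho>\<^sup>2) * (1 - t / \<rho>)" for a s t
  define tail' where "tail' a s t = (c2 a s t * w s t + cutoff a s t * Im (kern' s (t + \<epsilon>))) * (1 + \<epsilon> / s)
      + (cutoff a s t * w s t) * (- \<epsilon> / s\<^sup>2)" for a s t
  define T where "T = cbox (-\<rho>, -\<rho>, 0) (\<rho>, -\<epsilon>, \<rho>)"
  have T: "T = {-\<rho>..\<rho>} \<times> {-\<rho>..-\<epsilon>} \<times> {0..\<rho>}" by (auto simp: T_def cbox_Pair_eq)
  have c: "continuous_on T (\<lambda>x. kern (fst (snd x)) (snd (snd x) + \<epsilon>))"
    "continuous_on T (\<lambda>x. kern' (fst (snd x)) (snd (snd x) + \<epsilon>))"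
    using eps by (auto simp: T intro!: continuous_on_kern continuous_intros)
  have "continuous_on T (\<lambda>x. 1 - snd (snd x) / \<rho>)"
    by (intro continuous_intros) (use rho in auto)
  moreover have "continuous_on T (\<lambda>x. bump (fst x))" "continuous_on T (\<lambda>x. bump (fst (snd x)))"
    unfolding bump_def using rho by (auto intro!: continuous_intros)
  moreover have "continuous_on T (\<lambda>x. - 2 * fst (snd x) / \<rho>\<^sup>2)"
    by (intro continuous_intros) (use rho in auto)
  moreover have "continuous_on T (\<lambda>x. - \<epsilon> / (fst (snd x))\<^sup>2)" "continuous_on T (\<lambda>x. 1 + \<epsilon> / fst (snd x))"
    using eps by (auto simp: T intro!: continuous_intros)
  ultimately have c2: "continuous_on T (\<lambda>x. 1 - snd (snd x) / \<rho>)" "continuous_on T (\<lambda>x. bump (fst x))"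
    "continuous_on T (\<lambda>x. bump (fst (snd x)))" "continuous_on T (\<lambda>x. - 2 * fst (snd x) / \<rho>\<^sup>2)"
    "continuous_on T (\<lambda>x. - \<epsilon> / (fst (snd x))\<^sup>2)" "continuous_on T (\<lambda>x. 1 + \<epsilon> / fst (snd x))"
    by auto
  note cc = c2 continuous_on_Re[OF c(1)] continuous_on_Im[OF c(1)] continuous_on_Re[OF c(2)] continuous_on_Im[OF c(2)]
  have ct': "continuous_on T (\<lambda>x. tail' (fst x) (fst (snd x)) (snd (snd x)))"
    unfolding tail'_def c2_def cutoff_def
    by (intro cc continuous_on_add continuous_on_mult)
  have ct: "continuous_on T (\<lambda>x. tail (fst x) (fst (snd x)) (snd (snd x)))"
    unfolding tail_def cutoff_def by (intro cc continuous_on_add continuous_on_mult)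
  have slice: "continuous_on Q' (\<lambda>x. f (fst x) (snd x) t)"
    if f: "continuous_on T (\<lambda>x. f (fst x) (fst (snd x)) (snd (snd x)))" and t: "0 < t" "t \<le> \<rho>"
    for f :: "real \<Rightarrow> real \<Rightarrow> real \<Rightarrow> real" and t
  proof -
    have "continuous_on Q' (\<lambda>x. (\<lambda>x. f (fst x) (fst (snd x)) (snd (snd x))) (fst x, snd x, t))"
      by (rule continuous_on_compose2[OF f]) (use t in \<open>auto simp: T Q'_def intro!: continuous_intros\<close>)
    then show ?thesis by simp
  qed
  have "bounded ((\<lambda>x. tail' (fst x) (fst (snd x)) (snd (snd x))) ` T)"
    by (intro compact_imp_bounded compact_continuous_image ct') (simp add: T_def)
  then obtain C where C: "\<And>x. x \<in> T \<Longrightarrow> \<bar>tail' (fst x) (fst (snd x)) (snd (snd x))\<bar> \<le> C"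
    unfolding bounded_iff by auto
  note cU' = slice_cont[OF cU, THEN continuous_on_subset, OF _ _ Q'_subset]
  note cG' = slice_cont[OF cG2, THEN continuous_on_subset, OF _ _ Q'_subset]
  show thesis
  proof (rule that[of tail' C])
    show 1: "continuous_on Q' (\<lambda>x. tail' (fst x) (snd x) t)" if "0 < t" "t \<le> \<rho>" for t by (rule slice[OF ct' that])
    show 4: "continuous_on Q' (\<lambda>x. tail (fst x) (snd x) t * G2 (fst x) (snd x) t)" if "0 < t" "t \<le> \<rho>" for t
      by (intro continuous_on_mult slice[OF ct that] cG' that)
    show "\<bar>tail' a s t\<bar> \<le> C" if "(a, s) \<in> Q'" "0 < t" "t \<le> \<rho>" for a s t
      using C[of "(a, s, t)"] that by (auto simp: T Q'_def)
    show "integral Q' (\<lambda>x. tail (fst x) (snd x) t * G2 (fst x) (snd x) t) =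
       - integral Q' (\<lambda>x. tail' (fst x) (snd x) t * U (fst x) (snd x) t)" if t: "0 < t" "t \<le> \<rho>" for t
    proof -
      have 2: "continuous_on Q' (\<lambda>x. tail' (fst x) (snd x) t * U (fst x) (snd x) t)"
        by (intro continuous_on_mult 1 cU' t)
      have 3: "continuous_on Q' (\<lambda>x. tail (fst x) (snd x) t * G2 (fst x) (snd x) t + tail' (fst x) (snd x) t * U (fst x) (snd x) t)"
        by (rule continuous_on_add[OF 4[OF t] 2])
      have inner: "integral {-\<rho>..-\<epsilon>} (\<lambda>s. tail a s t * G2 a s t + tail' a s t * U a s t) = 0" if a: "a \<in> {-\<rho>..\<rho>}" for a
      proof -
        have d: "((\<lambda>x. tail a x t * U a x t) has_real_derivative tail a s t * G2 a s t + tail' a s t * U a s t) (at s within {-\<rho>..-\<epsilon>})"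
          if s: "s \<in> {-\<rho>..-\<epsilon>}" for s
        proof -
          have b: "(a, s, t) \<in> B" using a s t eps by (auto simp: B_def)
          have dbump: "(bump has_real_derivative - 2 * s / \<rho>\<^sup>2) (at s)"
            unfolding bump_def using rho by (auto intro!: derivative_eq_intros simp: power2_eq_square)
          have dc: "((\<lambda>x. cutoff a x t) has_real_derivative c2 a s t) (at s)"
            unfolding cutoff_def c2_def by (intro DERIV_cmult_right DERIV_cmult dbump)
          have dw: "((\<lambda>x. w x t) has_real_derivative Im (kern' s (t + \<epsilon>))) (at s)"
            by (rule Re_Im_kern_deriv(2)) (use t eps in auto)
          have dr: "((\<lambda>x. 1 + \<epsilon> / x) has_real_derivative - \<epsilon> / s\<^sup>2) (at s)"
            using s eps by (auto intro!: derivative_eq_intros simp: power2_eq_square)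
          have dt: "((\<lambda>x. tail a x t) has_real_derivative tail' a s t) (at s)"
            unfolding tail_def tail'_def
            by (rule DERIV_cong[OF DERIV_mult[OF DERIV_mult[OF dc dw] dr]]) (simp add: algebra_simps)
          have "((\<lambda>x. tail a x t * U a x t) has_real_derivative tail' a s t * U a s t + G2 a s t * tail a s t) (at s)"
            by (rule DERIV_mult[OF dt dU2[OF b]])
          then show ?thesis by (simp add: has_field_derivative_at_within mult.commute add.commute)
        qed
        have e: "tail a (-\<rho>) t = 0" "tail a (-\<epsilon>) t = 0"
          using rho eps by (auto simp: tail_def cutoff_def bump_def)
        show ?thesis using integral_derivative[OF _ d] e eps by simp
      qed
      have "integral Q' (\<lambda>x. tail (fst x) (snd x) t * G2 (fst x) (snd x) t + tail' (fst x) (snd x) t * U (fst x) (snd x) t) = 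
        integral {-\<rho>..\<rho>} (\<lambda>a. integral {-\<rho>..-\<epsilon>} (\<lambda>s. tail a s t * G2 a s t + tail' a s t * U a s t))"
        using integral_prod_continuous[OF 3[unfolded Q'_cbox]] by (simp add: Q'_cbox)
      also have "\<dots> = integral {-\<rho>..\<rho>} (\<lambda>a. 0)" by (intro integral_cong inner)
      finally have "integral Q' (\<lambda>x. tail (fst x) (snd x) t * G2 (fst x) (snd x) t)
          + integral Q' (\<lambda>x. tail' (fst x) (snd x) t * U (fst x) (snd x) t) = 0"
        using integral_add[of "\<lambda>x. tail (fst x) (snd x) t * G2 (fst x) (snd x) t" Q'
            "\<lambda>x. tail' (fst x) (snd x) t * U (fst x) (snd x) t"] 2 4[OF t]
        by (simp add: Q'_cbox integrable_continuous)
      then show ?thesis by simp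
    qed
  qed
qed

lemma tail_vanishes:
  assumes "\<tau> \<longlonglongrightarrow> 0" "\<And>n. 0 < \<tau> n" "\<And>n. \<tau> n \<le> \<rho>"
  shows "(\<lambda>n. LINT x|M. indicator Q' x * (tail (fst x) (snd x) (\<tau> n) * G2 (fst x) (snd x) (\<tau> n))) \<longlonglongrightarrow> 0"
proof -
  obtain tail' C where
    c: "\<And>t. 0 < t \<Longrightarrow> t \<le> \<rho> \<Longrightarrow> continuous_on Q' (\<lambda>x. tail' (fst x) (snd x) t)" and
    bd: "\<And>a s t. (a, s) \<in> Q' \<Longrightarrow> 0 < t \<Longrightarrow> t \<le> \<rho> \<Longrightarrow> \<bar>tail' a s t\<bar> \<le> C" and
    eq: "\<And>t. 0 < t \<Longrightarrow> t \<le> \<rho> \<Longrightarrow>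
       integral Q' (\<lambda>x. tail (fst x) (snd x) t * G2 (fst x) (snd x) t) =
       - integral Q' (\<lambda>x. tail' (fst x) (snd x) t * U (fst x) (snd x) t)" and
    c2: "\<And>t. 0 < t \<Longrightarrow> t \<le> \<rho> \<Longrightarrow> continuous_on Q' (\<lambda>x. tail (fst x) (snd x) t * G2 (fst x) (snd x) t)"
    by (rule tail_parts) blast
  have *: "\<bar>LINT x|M. indicator Q' x * (tail (fst x) (snd x) t * G2 (fst x) (snd x) t)\<bar> \<le> t * (C * (LINT x|M. Z x))"
    if t: "0 < t" "t \<le> \<rho>" for t
  proof -
    have cu: "continuous_on Q' (\<lambda>x. tail' (fst x) (snd x) t * U (fst x) (snd x) t)"
      by (intro continuous_on_mult c t continuous_on_subset[OF slice_cont[OF cU t] Q'_subset])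
    have "\<bar>LINT x|M. indicator Q' x * (tail (fst x) (snd x) t * G2 (fst x) (snd x) t)\<bar>
      = norm (LINT x|M. indicator Q' x * (tail' (fst x) (snd x) t * U (fst x) (snd x) t))"
      using Q'_integral(2)[OF c2[OF t]] Q'_integral(2)[OF cu] eq[OF t] by simp
    also have "\<dots> \<le> (LINT x|M. norm (indicator Q' x * (tail' (fst x) (snd x) t * U (fst x) (snd x) t)))"
      by (rule integral_norm_bound)
    also have "\<dots> \<le> (LINT x|M. t * (C * Z x))"
    proof (rule integral_mono_AE)
      show "integrable M (\<lambda>x. norm (indicator Q' x * (tail' (fst x) (snd x) t * U (fst x) (snd x) t)))"
        by (intro integrable_norm Q'_integral(1) cu)
      show "integrable M (\<lambda>x. t * (C * Z x))" using Z_integrable by simp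
      have C: "0 \<le> C" using bd[of 0 "-\<rho>" \<rho>] rho eps by (force simp: Q'_def)
      show "AE x in M. norm (indicator Q' x * (tail' (fst x) (snd x) t * U (fst x) (snd x) t)) \<le> t * (C * Z x)"
        using potential_le_height Z_bound
      proof eventually_elim
        case (elim x)
        have z: "0 \<le> Z x" using elim(2) rho by force
        show ?case
        proof (cases "x \<in> Q'")
          case True
          have "\<bar>tail' (fst x) (snd x) t * U (fst x) (snd x) t\<bar> \<le> C * (t * Z x)"
            unfolding abs_mult using True elim(1) t C by (intro mult_mono bd) (auto simp: Q'_def)
          then show ?thesis using True by (simp add: mult_ac)
        next
          case False
          then show ?thesis using z C t by simp
        qed
      qed
    qed
    also have "\<dots> = t * (C * (LINT x|M. Z x))" by simp
    finally show ?thesis .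
  qed
  have "(\<lambda>n. \<tau> n * (C * (LINT x|M. Z x))) \<longlonglongrightarrow> 0 * (C * (LINT x|M. Z x))"
    by (intro tendsto_intros assms)
  then have lim: "(\<lambda>n. \<tau> n * (C * (LINT x|M. Z x))) \<longlonglongrightarrow> 0" by simp
  show ?thesis
    by (rule Lim_null_comparison[OF always_eventually lim]) (use *[OF assms(2,3)] in simp)
qed

text \<open>The flux splits into the pairing on N0, which has a limit for t tending to 0, the tail, which
  tends to 0, and this rest, which stays bounded.\<close>

definition "rest a s t = flux a s t - indicator N0 (a, s) * (cutoff a s t * v s t * G3 a s t)
   + indicator Q' (a, s) * (tail a s t * G2 a s t)"

text \<open>On the complement of N0 the factor v is small since \<open>s \<le> \<epsilon>\<close> there, for \<open>s > -\<epsilon>\<close> the factor w is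
  small, and for \<open>s \<le> -\<epsilon>\<close> there remains the difference between w and the tail.\<close>

lemma rest_bound:
  assumes "(a, s) \<in> Q" "0 < t" "t \<le> \<epsilon>" "\<bar>G2 a s t\<bar> \<le> z" "\<bar>G3 a s t\<bar> \<le> z"
  shows "\<bar>rest a s t\<bar> \<le> sqrt \<rho> * (weight s / \<rho> + z\<^sup>2)"
proof -
  have h: "\<epsilon> \<le> t + \<epsilon>" "t + \<epsilon> \<le> 2 * \<epsilon>" "t \<le> \<rho>" using assms eps by auto
  have z: "0 \<le> z" using assms(4) by linarith
  have wp: "0 \<le> weight s" using eps by (simp add: weight_def)
  define k where "k = indicator (- N0) (a, s) * v s t"
  define l where "l = (if s \<le> -\<epsilon> then w s t * (\<epsilon> / s) else - w s t)"
  have k: "\<bar>k\<bar> \<le> sqrt (weight s)"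
  proof (cases "(a, s) \<in> N0")
    case False
    then have "s \<le> \<epsilon>" using N0(2)[of "(a, s)"] assms(1) by auto
    then show ?thesis using Re_kern_sq_le[OF eps(1) h(1,2)] False
      by (simp add: k_def weight_def real_le_rsqrt)
  qed (use wp in \<open>simp add: k_def\<close>)
  have "l\<^sup>2 \<le> weight s"
    using Im_kern_sq_le[OF eps(1) h(1,2), of s] Im_kern_remainder_sq_le[OF eps(1), of s "t + \<epsilon>"]
    unfolding l_def weight_def by auto
  then have l: "\<bar>l\<bar> \<le> sqrt (weight s)" by (intro real_le_rsqrt) simp
  have "rest a s t = cutoff a s t * (k * G3 a s t + l * G2 a s t)"
    using assms(1) by (auto simp: rest_def flux_def tail_def k_def l_def Q'_def Q_def indicator_def algebra_simps)
  then have "\<bar>rest a s t\<bar> \<le> 1 * \<bar>k * G3 a s t + l * G2 a s t\<bar>"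
    using cutoff_bounds[OF assms(1) less_imp_le[OF assms(2)] h(3)] unfolding abs_mult[symmetric]
    by (simp add: abs_mult mult_left_le_one_le)
  also have "\<dots> \<le> \<bar>k\<bar> * \<bar>G3 a s t\<bar> + \<bar>l\<bar> * \<bar>G2 a s t\<bar>"
    using abs_triangle_ineq[of "k * G3 a s t" "l * G2 a s t"] by (simp add: abs_mult)
  also have "\<dots> \<le> sqrt (weight s) * z + sqrt (weight s) * z"
    by (intro add_mono mult_mono k l assms) (use wp in auto)
  also have "\<dots> = sqrt \<rho> * (2 * sqrt (weight s / \<rho>) * z)"
    using rho by (simp add: real_sqrt_divide)
  also have "\<dots> \<le> sqrt \<rho> * ((sqrt (weight s / \<rho>))\<^sup>2 + z\<^sup>2)"
    using sum_squares_bound[of "sqrt (weight s / \<rho>)" z] rho by (intro mult_left_mono) auto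
  also have "\<dots> = sqrt \<rho> * (weight s / \<rho> + z\<^sup>2)" using wp rho by simp
  finally show ?thesis .
qed

text \<open>The constants 80 and 11 are independent of \<open>\<epsilon>\<close>, \<open>\<rho>\<close> and U. This is the point of the construction,
  as the square integral of v over the Neumann part, divided by \<open>\<rho>\<close>, is unbounded as \<open>\<epsilon> / \<rho>\<close>
  tends to 0.\<close>

lemma mixed_pairing_bound:
  "\<bar>LINT x|M. indicator N0 x * (cutoff (fst x) (snd x) 0 * v (snd x) 0 * \<gamma> x)\<bar>
    \<le> sqrt \<rho> * (80 + 11 * (LINT x|M. (Z x)\<^sup>2))"
proof -
  \<comment> \<open>Heights at most \<open>\<epsilon>\<close>, because the estimates of the kernel need \<open>t + \<epsilon>\<close> between \<open>\<epsilon>\<close> and \<open>2 \<epsilon>\<close>.\<close>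
  define \<tau> where "\<tau> n = \<epsilon> / real (Suc n)" for n
  have \<tau>: "0 < \<tau> n" "\<tau> n \<le> \<epsilon>" "\<tau> n \<le> \<rho>" for n
    using eps divide_left_mono[of 1 "real (Suc n)" \<epsilon>] by (auto simp: \<tau>_def)
  have \<tau>0: "\<tau> \<longlonglongrightarrow> 0"
    unfolding \<tau>_def using LIMSEQ_Suc[OF lim_const_over_n[of \<epsilon>]] by simp
  define P where "P n x = indicator N0 x * (cutoff (fst x) (snd x) (\<tau> n) * v (snd x) (\<tau> n) * G3 (fst x) (snd x) (\<tau> n))"
    for n and x :: "real \<times> real"
  define T where "T n x = indicator Q' x * (tail (fst x) (snd x) (\<tau> n) * G2 (fst x) (snd x) (\<tau> n))"
    for n and x :: "real \<times> real"
  have cv: "continuous_on Q (\<lambda>x. v (snd x) t)" if "0 \<le> t" for t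
    using that eps by (intro continuous_on_Re continuous_on_kern continuous_intros) auto
  have ccut: "continuous_on Q (\<lambda>x. cutoff (fst x) (snd x) t)" for t
    unfolding cutoff_def bump_def by (intro continuous_intros) (use rho in auto)
  have N0m: "indicator N0 \<in> borel_measurable M"
    unfolding M_def by (rule measurable_restrict_space1) (use N0 in simp)
  have Pm: "P n \<in> borel_measurable M" for n
    unfolding P_def
    by (intro borel_measurable_times N0m cont_meas ccut cv slice_cont[OF cG3] \<tau> less_imp_le[OF \<tau>(1)])
  have vb: "\<bar>v s t\<bar> \<le> 1 / sqrt \<epsilon>" if "0 \<le> t" for s t
  proof -
    have "(v s t)\<^sup>2 \<le> (1 / sqrt \<epsilon>)\<^sup>2"
      using kern_sq_le_inverse(1)[of \<epsilon> "t + \<epsilon>" s] that eps by (simp add: power_divide)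
    then show ?thesis using eps power2_le_iff_abs_le[of "1 / sqrt \<epsilon>"] by auto
  qed
  have Pb: "AE x in M. norm (P n x) \<le> 1 / sqrt \<epsilon> * Z x" for n
    using Z_bound AE_Q
  proof eventually_elim
    case (elim x)
    have z: "0 \<le> Z x" using elim(1) rho by force
    have "\<bar>cutoff (fst x) (snd x) (\<tau> n)\<bar> * \<bar>v (snd x) (\<tau> n)\<bar> * \<bar>G3 (fst x) (snd x) (\<tau> n)\<bar> \<le> 1 * (1 / sqrt \<epsilon>) * Z x"
      using elim \<tau>[of n] eps less_imp_le[OF \<tau>(1)] by (intro mult_mono cutoff_bounds vb) simp_all
    then show ?case using z eps by (auto simp: P_def abs_mult indicator_def)
  qed
  have Zi: "integrable M (\<lambda>x. 1 / sqrt \<epsilon> * Z x)" using Z_integrable by simp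
  have lim0: "AE x in M. (\<lambda>n. P n x) \<longlonglongrightarrow> indicator N0 x * (cutoff (fst x) (snd x) 0 * v (snd x) 0 * \<gamma> x)"
    using neumann
  proof eventually_elim
    case (elim x)
    show ?case
    proof (cases "x \<in> N0")
      case True
      have f: "filterlim \<tau> (at_right 0) sequentially"
        by (rule tendsto_imp_filterlim_at_right[OF \<tau>0 always_eventually]) (simp add: \<tau>)
      have "(\<lambda>n. G3 (fst x) (snd x) (\<tau> n)) \<longlonglongrightarrow> \<gamma> x"
        by (rule filterlim_compose[OF mp[OF elim True] f])
      moreover have "(\<lambda>n. cutoff (fst x) (snd x) (\<tau> n)) \<longlonglongrightarrow> cutoff (fst x) (snd x) 0"
        unfolding cutoff_def using rho by (intro tendsto_intros \<tau>0) auto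
      moreover have "(\<lambda>n. v (snd x) (\<tau> n)) \<longlonglongrightarrow> v (snd x) 0"
      proof -
        have "isCont (\<lambda>h. Re (kern (snd x) h)) \<epsilon>"
          by (rule DERIV_isCont[OF Re_Im_kern_deriv(3)[OF eps(1)]])
        moreover have "(\<lambda>n. \<tau> n + \<epsilon>) \<longlonglongrightarrow> 0 + \<epsilon>" by (intro tendsto_intros \<tau>0)
        ultimately show ?thesis
          using isCont_tendsto_compose[of \<epsilon> "\<lambda>h. Re (kern (snd x) h)" "\<lambda>n. \<tau> n + \<epsilon>" sequentially] by simp
      qed
      ultimately show ?thesis
        unfolding P_def by (intro tendsto_mult[OF tendsto_const] tendsto_mult[OF tendsto_mult])
    next
      case False
      then have "P n x = 0" for n by (simp add: P_def)
      then show ?thesis using False by simp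
    qed
  qed
  have limm: "(\<lambda>x. indicator N0 x * (cutoff (fst x) (snd x) 0 * v (snd x) 0 * \<gamma> x)) \<in> borel_measurable M"
    by (rule borel_measurable_times[OF N0m borel_measurable_times[OF
            borel_measurable_times[OF cont_meas[OF ccut] cont_meas[OF cv]] g_meas]]) simp
  have limP: "(\<lambda>n. LINT x|M. P n x) \<longlonglongrightarrow> (LINT x|M. indicator N0 x * (cutoff (fst x) (snd x) 0 * v (snd x) 0 * \<gamma> x))"
    by (rule integral_dominated_convergence[OF limm Pm Zi lim0 Pb])
  have limT: "(\<lambda>n. LINT x|M. T n x) \<longlonglongrightarrow> 0"
    unfolding T_def by (rule tail_vanishes[OF \<tau>0 \<tau>(1) \<tau>(3)])
  have iP: "integrable M (P n)" for n
  proof (rule Bochner_Integration.integrable_bound[OF Zi Pm])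
    show "AE x in M. norm (P n x) \<le> norm (1 / sqrt \<epsilon> * Z x)"
      using Pb[of n] by eventually_elim (unfold real_norm_def, linarith)
  qed
  have iT: "integrable M (T n)" for n
  proof -
    have "continuous_on Q' (\<lambda>x. tail (fst x) (snd x) (\<tau> n) * G2 (fst x) (snd x) (\<tau> n))"
      by (rule tail_parts) (simp add: \<tau>)
    then show ?thesis unfolding T_def by (rule Q'_integral(1))
  qed
  have bound: "\<bar>(LINT x|M. P n x) - (LINT x|M. T n x)\<bar> \<le> sqrt \<rho> * (80 + 11 * (LINT x|M. (Z x)\<^sup>2))" for n
  proof -
    have iF: "integrable M (\<lambda>x. flux (fst x) (snd x) (\<tau> n))"
      by (rule cont_integrable(1)[OF flux_divergence(3)[OF \<tau>(1,3)]])
    have rest: "rest (fst x) (snd x) (\<tau> n) = flux (fst x) (snd x) (\<tau> n) - P n x + T n x" for x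
      by (simp add: rest_def P_def T_def)
    have iR: "integrable M (\<lambda>x. rest (fst x) (snd x) (\<tau> n))"
      unfolding rest using iF iP iT by auto
    have eR: "(LINT x|M. rest (fst x) (snd x) (\<tau> n)) = (LINT x|M. flux (fst x) (snd x) (\<tau> n)) - (LINT x|M. P n x) + (LINT x|M. T n x)"
      unfolding rest using iF iP iT by simp
    have iB: "integrable M (\<lambda>x. sqrt \<rho> * (weight (snd x) / \<rho> + (Z x)\<^sup>2))"
      using Z_int weight_integral(1) by auto
    have "\<bar>LINT x|M. rest (fst x) (snd x) (\<tau> n)\<bar> \<le> (LINT x|M. norm (rest (fst x) (snd x) (\<tau> n)))"
      using integral_norm_bound[of M "\<lambda>x. rest (fst x) (snd x) (\<tau> n)"] by simp
    also have "\<dots> \<le> (LINT x|M. sqrt \<rho> * (weight (snd x) / \<rho> + (Z x)\<^sup>2))"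
    proof (rule integral_mono_AE[OF integrable_norm[OF iR] iB])
      show "AE x in M. norm (rest (fst x) (snd x) (\<tau> n)) \<le> sqrt \<rho> * (weight (snd x) / \<rho> + (Z x)\<^sup>2)"
        using Z_bound AE_Q
        by eventually_elim (use \<tau>[of n] in \<open>auto intro!: rest_bound\<close>)
    qed
    also have "\<dots> = sqrt \<rho> * ((LINT x|M. weight (snd x)) / \<rho> + (LINT x|M. (Z x)\<^sup>2))"
      using Z_int weight_integral(1) by simp
    also have "\<dots> \<le> sqrt \<rho> * (40 + (LINT x|M. (Z x)\<^sup>2))"
      using weight_integral(2) rho by (intro mult_left_mono add_right_mono) (auto simp: divide_le_eq)
    finally have "\<bar>LINT x|M. rest (fst x) (snd x) (\<tau> n)\<bar> \<le> sqrt \<rho> * (40 + (LINT x|M. (Z x)\<^sup>2))" .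
    then have "\<bar>(LINT x|M. P n x) - (LINT x|M. T n x)\<bar>
      \<le> sqrt \<rho> * (40 + 10 * (LINT x|M. (Z x)\<^sup>2)) + sqrt \<rho> * (40 + (LINT x|M. (Z x)\<^sup>2))"
      using flux_bound[OF \<tau>(1,3), of n] eR by linarith
    also have "\<dots> = sqrt \<rho> * (80 + 11 * (LINT x|M. (Z x)\<^sup>2))" by (simp add: algebra_simps)
    finally show ?thesis .
  qed
  have "(\<lambda>n. \<bar>(LINT x|M. P n x) - (LINT x|M. T n x)\<bar>) \<longlonglongrightarrow>
     \<bar>(LINT x|M. indicator N0 x * (cutoff (fst x) (snd x) 0 * v (snd x) 0 * \<gamma> x)) - 0\<bar>"
    by (intro tendsto_intros limP limT)
  then show ?thesis
    using LIMSEQ_le_const2[OF _ exI[of _ 0]] bound by auto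
qed

end

section \<open>Faces of polyhedral domains\<close>

text \<open>A hyperplane through P passes through Q as well, and then only the linear part matters; all other
  hyperplanes are avoided by small displacements.\<close>

lemma sgn_eventually_const:
  fixes a P :: "real^3"
  assumes "sgn (a \<bullet> P - b) = sgn (a \<bullet> Q - b)"
  shows "\<forall>\<^sub>F h in nhds 0. sgn (a \<bullet> (P + h) - b) = sgn (a \<bullet> (Q + h) - b)"
proof -
  have lim: "((\<lambda>h. a \<bullet> (R + h) - b) \<longlongrightarrow> a \<bullet> (R + 0) - b) (nhds 0)" for R
    by (intro tendsto_intros filterlim_ident)
  consider "a \<bullet> P - b = 0" | "a \<bullet> P - b > 0" | "a \<bullet> P - b < 0" by linarith
  then show ?thesis
  proof cases
    case 1
    then have "a \<bullet> P = b" "a \<bullet> Q = b" using assms by (auto simp: sgn_if split: if_splits)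
    then show ?thesis by (simp add: inner_add_right)
  next
    case 2
    then have "a \<bullet> Q - b > 0" using assms by (auto simp: sgn_if split: if_splits)
    then have "\<forall>\<^sub>F h in nhds 0. a \<bullet> (Q + h) - b > 0" "\<forall>\<^sub>F h in nhds 0. a \<bullet> (P + h) - b > 0"
      using order_tendstoD(1)[OF lim[of Q], of 0] order_tendstoD(1)[OF lim[of P], of 0] 2 by simp_all
    then show ?thesis by eventually_elim simp
  next
    case 3
    then have "a \<bullet> Q - b < 0" using assms by (auto simp: sgn_if split: if_splits)
    then have "\<forall>\<^sub>F h in nhds 0. a \<bullet> (Q + h) - b < 0" "\<forall>\<^sub>F h in nhds 0. a \<bullet> (P + h) - b < 0"
      using order_tendstoD(2)[OF lim[of Q], of 0] order_tendstoD(2)[OF lim[of P], of 0] 3 by simp_all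
    then show ?thesis by eventually_elim simp
  qed
qed

text \<open>Flatness of the boundary at a point only depends on the germ of K there, and interiors commute
  with translations.\<close>

lemma is_outer_normal_translate:
  assumes n: "is_outer_normal (interior K) P n" and "\<delta> > 0"
    and eq: "\<And>h. norm h < \<delta> \<Longrightarrow> P + h \<in> K \<longleftrightarrow> Q + h \<in> K"
  shows "is_outer_normal (interior K) Q n"
proof -
  obtain r where r: "norm n = 1" "r > 0" "interior K \<inter> ball P r = {X \<in> ball P r. (X - P) \<bullet> n < 0}"
    using n unfolding is_outer_normal_def by blast
  have "K \<inter> ball Q \<delta> = (+) (Q - P) ` (K \<inter> ball P \<delta>)"
  proof
    show "K \<inter> ball Q \<delta> \<subseteq> (+) (Q - P) ` (K \<inter> ball P \<delta>)"
    proof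
      fix X assume X: "X \<in> K \<inter> ball Q \<delta>"
      then have "P + (X - Q) \<in> K \<inter> ball P \<delta>"
        using eq[of "X - Q"] by (auto simp: dist_norm norm_minus_commute)
      moreover have "X = (Q - P) + (P + (X - Q))" by simp
      ultimately show "X \<in> (+) (Q - P) ` (K \<inter> ball P \<delta>)" by (metis imageI)
    qed
    show "(+) (Q - P) ` (K \<inter> ball P \<delta>) \<subseteq> K \<inter> ball Q \<delta>"
    proof
      fix X assume "X \<in> (+) (Q - P) ` (K \<inter> ball P \<delta>)"
      then obtain Y where Y: "Y \<in> K" "Y \<in> ball P \<delta>" "X = (Q - P) + Y" by blast
      then have X: "X = Q + (Y - P)" and "norm (Y - P) < \<delta>" by (auto simp: dist_norm norm_minus_commute)
      moreover have "P + (Y - P) \<in> K" using Y(1) by simp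
      ultimately have "Q + (Y - P) \<in> K" "dist Q X < \<delta>"
        using eq[of "Y - P"] X by (simp_all add: dist_norm norm_minus_commute del: add_diff_eq)
      then show "X \<in> K \<inter> ball Q \<delta>" using X by simp
    qed
  qed
  then have "interior (K \<inter> ball Q \<delta>) = (+) (Q - P) ` interior (K \<inter> ball P \<delta>)"
    by (simp add: interior_translation)
  then have int: "interior K \<inter> ball Q \<delta> = (+) (Q - P) ` (interior K \<inter> ball P \<delta>)" by simp
  have "interior K \<inter> ball Q (min r \<delta>) = {X \<in> ball Q (min r \<delta>). (X - Q) \<bullet> n < 0}"
  proof -
    have "X \<in> interior K \<longleftrightarrow> (X - Q) \<bullet> n < 0" if X: "X \<in> ball Q (min r \<delta>)" for X
    proof -
      define Y where "Y = P + (X - Q)"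
      have Y: "Y \<in> ball P r" "Y \<in> ball P \<delta>" "X = (Q - P) + Y" "Y - P = X - Q" "X \<in> ball Q \<delta>"
        using X by (auto simp: Y_def dist_norm norm_minus_commute)
      have "X \<in> interior K \<longleftrightarrow> Y \<in> interior K"
        using inj_image_mem_iff[of "(+) (Q - P)" Y "interior K \<inter> ball P \<delta>"] int Y(2,3,5)
        by (metis IntD1 IntI inj_on_add)
      also have "\<dots> \<longleftrightarrow> (Y - P) \<bullet> n < 0" using r(3) Y(1) by blast
      finally show ?thesis by (simp only: Y(4))
    qed
    then show ?thesis by blast
  qed
  then show ?thesis
    unfolding is_outer_normal_def using r(1,2) \<open>\<delta> > 0\<close> by (intro conjI exI[of _ "min r \<delta>"]) simp_all
qed

lemma polyhedra_hyperplanes: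
  fixes \<C> :: "(real^3) set set"
  assumes "finite \<C>" "\<And>T. T \<in> \<C> \<Longrightarrow> polyhedron T"
  obtains A :: "((real^3) \<times> real) set" where "finite A"
    "\<And>X Y. (\<And>a b. (a, b) \<in> A \<Longrightarrow> sgn (a \<bullet> X - b) = sgn (a \<bullet> Y - b)) \<Longrightarrow> X \<in> \<Union>\<C> \<longleftrightarrow> Y \<in> \<Union>\<C>"
proof -
  have "\<exists>A :: ((real^3) \<times> real) set. finite A \<and> T = {X. \<forall>(a, b)\<in>A. a \<bullet> X \<le> b}" if "T \<in> \<C>" for T
  proof -
    have "polyhedron T" using assms(2) that by blast
    then obtain F where F: "finite F" "T = \<Inter>F" "\<forall>h\<in>F. \<exists>a b. a \<noteq> 0 \<and> h = {x. a \<bullet> x \<le> b}"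
      unfolding polyhedron_def by blast
    then have "\<forall>h\<in>F. \<exists>p. h = {x. fst p \<bullet> x \<le> snd p}" by (metis fst_conv snd_conv)
    then obtain p where p: "\<And>h. h \<in> F \<Longrightarrow> h = {x. fst (p h) \<bullet> x \<le> snd (p h)}" by metis
    have "X \<in> T \<longleftrightarrow> (\<forall>h\<in>F. fst (p h) \<bullet> X \<le> snd (p h))" for X
      using p unfolding F(2) by (metis (mono_tags, lifting) Inter_iff mem_Collect_eq)
    then have "T = {X. \<forall>(a, b)\<in>p ` F. a \<bullet> X \<le> b}" by (auto simp: split_beta')
    then show ?thesis using F(1) by (intro exI[of _ "p ` F"]) auto
  qed
  then have "\<forall>T\<in>\<C>. \<exists>A :: ((real^3) \<times> real) set. finite A \<and> T = {X. \<forall>(a, b)\<in>A. a \<bullet> X \<le> b}" by blast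
  from bchoice[OF this] obtain A :: "(real^3) set \<Rightarrow> ((real^3) \<times> real) set"
    where A0: "\<forall>T\<in>\<C>. finite (A T) \<and> T = {X. \<forall>(a, b)\<in>A T. a \<bullet> X \<le> b}" ..
  have A: "finite (A T)" "T = {X. \<forall>(a, b)\<in>A T. a \<bullet> X \<le> b}" if "T \<in> \<C>" for T
    using bspec[OF A0 that] by simp_all
  show thesis
  proof (rule that[of "\<Union>(A ` \<C>)"])
    show "finite (\<Union>(A ` \<C>))" using A(1) assms(1) by blast
    show "X \<in> \<Union>\<C> \<longleftrightarrow> Y \<in> \<Union>\<C>"
      if s: "\<And>a b. (a, b) \<in> \<Union>(A ` \<C>) \<Longrightarrow> sgn (a \<bullet> X - b) = sgn (a \<bullet> Y - b)" for X Y
    proof -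
      have "X \<in> T \<longleftrightarrow> Y \<in> T" if T: "T \<in> \<C>" for T
      proof -
        have "a \<bullet> X \<le> b \<longleftrightarrow> a \<bullet> Y \<le> b" if ab: "(a, b) \<in> A T" for a b
        proof -
          have "sgn (a \<bullet> X - b) = sgn (a \<bullet> Y - b)" using s ab T by blast
          then show ?thesis by (simp add: sgn_if split: if_splits)
        qed
        then have "X \<in> {X. \<forall>(a, b)\<in>A T. a \<bullet> X \<le> b} \<longleftrightarrow> Y \<in> {X. \<forall>(a, b)\<in>A T. a \<bullet> X \<le> b}"
          unfolding mem_Collect_eq split_beta' by (metis prod.collapse)
        then show ?thesis unfolding A(2)[OF T, symmetric] .
      qed
      then show ?thesis by blast
    qed
  qed
qed

text \<open>The finitely many hyperplanes that bound the simplices divide space into finitely many classes of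
  points with the same signs. Two points of a class have the same germ of K, up to translation, so
  that the flat part of the boundary is a union of classes. A class is convex, hence connected, and
  so lies in a single face.\<close>

lemma finite_open_faces:
  assumes "compact_polyhedral_domain \<Omega>"
  shows "finite (open_faces \<Omega>)"
proof -
  obtain \<C> where C: "simplicial_complex \<C>" "\<Omega> = interior (\<Union>\<C>)"
    using assms unfolding compact_polyhedral_domain_def compact_polyhedron_def by blast
  have "finite \<C>" "\<And>T. T \<in> \<C> \<Longrightarrow> polyhedron T"
    using C(1) simplex_imp_polyhedron unfolding simplicial_complex_def by blast+
  then obtain A :: "((real^3) \<times> real) set" where A: "finite A"
    and AK: "\<And>X Y. (\<And>a b. (a, b) \<in> A \<Longrightarrow> sgn (a \<bullet> X - b) = sgn (a \<bullet> Y - b)) \<Longrightarrow> X \<in> \<Union>\<C> \<longleftrightarrow> Y \<in> \<Union>\<C>"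
    using polyhedra_hyperplanes by metis
  define \<sigma> where "\<sigma> X = restrict (\<lambda>(a, b). sgn (a \<bullet> X - b)) A" for X
  have \<sigma>_iff: "\<sigma> X = \<sigma> Y \<longleftrightarrow> (\<forall>a b. (a, b) \<in> A \<longrightarrow> sgn (a \<bullet> X - b) = sgn (a \<bullet> Y - b))" for X Y
    unfolding \<sigma>_def by (auto simp: restrict_def fun_eq_iff)
  have flat: "Q \<in> flat_boundary \<Omega>" if P: "P \<in> flat_boundary \<Omega>" and eq: "\<sigma> P = \<sigma> Q" for P Q
  proof -
    obtain n where n: "is_outer_normal (interior (\<Union>\<C>)) P n"
      using P unfolding flat_boundary_def C(2) by blast
    have "\<forall>\<^sub>F h in nhds 0. \<forall>p\<in>A. sgn (fst p \<bullet> (P + h) - snd p) = sgn (fst p \<bullet> (Q + h) - snd p)"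
      using A eq by (intro eventually_ball_finite ballI sgn_eventually_const) (auto simp: \<sigma>_iff)
    then obtain d where d: "d > 0"
      "\<And>h. dist h 0 < d \<Longrightarrow> \<forall>p\<in>A. sgn (fst p \<bullet> (P + h) - snd p) = sgn (fst p \<bullet> (Q + h) - snd p)"
      unfolding eventually_nhds_metric by blast
    have "P + h \<in> \<Union>\<C> \<longleftrightarrow> Q + h \<in> \<Union>\<C>" if h: "norm h < d" for h
      using AK[of "P + h" "Q + h"] d(2)[of h] h by force
    then have "is_outer_normal (interior (\<Union>\<C>)) Q n"
      using is_outer_normal_translate[OF n d(1)] by blast
    then show ?thesis unfolding flat_boundary_def C(2) by blast
  qed
  have conv: "convex {Z. \<sigma> Z = \<sigma> P}" for P
  proof (rule convexI)
    fix X Y :: "real^3" and u v :: real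
    assume X: "X \<in> {Z. \<sigma> Z = \<sigma> P}" and Y: "Y \<in> {Z. \<sigma> Z = \<sigma> P}" and uv: "0 \<le> u" "0 \<le> v" "u + v = 1"
    have "sgn (a \<bullet> (u *\<^sub>R X + v *\<^sub>R Y) - b) = sgn (a \<bullet> P - b)" if ab: "(a, b) \<in> A" for a b
    proof -
      have e: "a \<bullet> (u *\<^sub>R X + v *\<^sub>R Y) - b = u * (a \<bullet> X - b) + v * (a \<bullet> Y - b)"
      proof -
        have "b = u * b + v * b" using uv(3) by (metis distrib_right mult_1)
        then show ?thesis by (simp add: inner_add_right algebra_simps)
      qed
      have s: "sgn (a \<bullet> X - b) = sgn (a \<bullet> P - b)" "sgn (a \<bullet> Y - b) = sgn (a \<bullet> P - b)"
        using X Y ab by (auto simp: \<sigma>_iff)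
      have uv': "u > 0 \<or> v > 0" using uv by linarith
      consider "a \<bullet> P - b = 0" | "a \<bullet> P - b > 0" | "a \<bullet> P - b < 0" by linarith
      then show ?thesis
      proof cases
        case 1
        then have "a \<bullet> X - b = 0" "a \<bullet> Y - b = 0" using s by (auto simp: sgn_if split: if_splits)
        then show ?thesis using 1 e by simp
      next
        case 2
        then have "a \<bullet> X - b > 0" "a \<bullet> Y - b > 0" using s by (auto simp: sgn_if split: if_splits)
        then have "u * (a \<bullet> X - b) + v * (a \<bullet> Y - b) > 0"
          using uv uv' by (auto intro: add_pos_nonneg add_nonneg_pos)
        then show ?thesis using 2 e by simp
      next
        case 3
        then have "a \<bullet> X - b < 0" "a \<bullet> Y - b < 0" using s by (auto simp: sgn_if split: if_splits)
        then have "u * (b - a \<bullet> X) + v * (b - a \<bullet> Y) > 0"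
          using uv uv' by (auto intro: add_pos_nonneg add_nonneg_pos)
        then have "a \<bullet> (u *\<^sub>R X + v *\<^sub>R Y) - b < 0" unfolding e by (simp add: algebra_simps)
        then show ?thesis using 3 by simp
      qed
    qed
    then show "u *\<^sub>R X + v *\<^sub>R Y \<in> {Z. \<sigma> Z = \<sigma> P}" by (auto simp: \<sigma>_iff)
  qed
  define p where "p F = (SOME P. P \<in> F)" for F :: "(real^3) set"
  have p: "p F \<in> F" "F \<subseteq> flat_boundary \<Omega>" if "F \<in> open_faces \<Omega>" for F
    using that in_components_nonempty[of F] in_components_subset[of F]
    unfolding open_faces_def p_def by (auto simp: some_in_eq)
  have "inj_on (\<sigma> \<circ> p) (open_faces \<Omega>)"
  proof (rule inj_onI)
    fix F F' assume F: "F \<in> open_faces \<Omega>" "F' \<in> open_faces \<Omega>" and eq: "(\<sigma> \<circ> p) F = (\<sigma> \<circ> p) F'"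
    let ?S = "{Z. \<sigma> Z = \<sigma> (p F)}"
    have "?S \<subseteq> flat_boundary \<Omega>"
      using flat[of "p F"] p[OF F(1)] by auto
    then show "F = F'"
      using joinable_components_eq[of ?S "flat_boundary \<Omega>" F F'] convex_connected[OF conv[of "p F"]]
        F p[OF F(1)] p[OF F(2)] eq unfolding open_faces_def by auto
  qed
  moreover have "(\<sigma> \<circ> p) ` open_faces \<Omega> \<subseteq> PiE A (\<lambda>_. {-1, 0, 1})"
    by (auto simp: \<sigma>_def sgn_if split: if_splits)
  moreover have "finite (PiE A (\<lambda>_. {-1, 0, 1 :: real}))"
    using A by (intro finite_PiE) auto
  ultimately show ?thesis using finite_imageD finite_subset by blast
qed

lemma outer_normal_unique:
  assumes "is_outer_normal \<Omega> P n" "is_outer_normal \<Omega> P m"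
  shows "n = m"
proof (rule ccontr)
  assume ne: "n \<noteq> m"
  obtain r where r: "norm n = 1" "r > 0" "\<Omega> \<inter> ball P r = {X \<in> ball P r. (X - P) \<bullet> n < 0}"
    using assms(1) unfolding is_outer_normal_def by blast
  obtain s where s: "norm m = 1" "s > 0" "\<Omega> \<inter> ball P s = {X \<in> ball P s. (X - P) \<bullet> m < 0}"
    using assms(2) unfolding is_outer_normal_def by blast
  have nm: "n \<bullet> n = 1" "m \<bullet> m = 1" using r s by (simp_all add: norm_eq_1)
  have "n \<bullet> m < 1"
  proof -
    have "(n - m) \<bullet> (n - m) > 0" using ne by simp
    then show ?thesis using nm by (simp add: inner_diff_left inner_diff_right inner_commute)
  qed
  define t where "t = min r s / (2 * (norm (m - n) + 1))"
  have t: "t > 0" using r s by (simp add: t_def add_nonneg_pos)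
  have "t * norm (m - n) < min r s"
  proof -
    have "t * norm (m - n) \<le> t * (norm (m - n) + 1)" using t by simp
    also have "\<dots> = min r s / 2" unfolding t_def by (simp add: field_simps add_nonneg_eq_0_iff)
    finally show ?thesis using r s by linarith
  qed
  then have X: "P + t *\<^sub>R (m - n) \<in> ball P r" "P + t *\<^sub>R (m - n) \<in> ball P s"
    using t by (auto simp: dist_norm)
  have e: "(P + t *\<^sub>R (m - n) - P) \<bullet> n = t * (n \<bullet> m - 1)" "(P + t *\<^sub>R (m - n) - P) \<bullet> m = t * (1 - n \<bullet> m)"
    using nm by (simp_all add: inner_diff_left inner_commute[of m n])
  then have "(P + t *\<^sub>R (m - n) - P) \<bullet> n < 0"
    using t \<open>n \<bullet> m < 1\<close> by (simp add: mult_less_0_iff)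
  then have "P + t *\<^sub>R (m - n) \<in> \<Omega>" using r(3) X(1) by blast
  then have "(P + t *\<^sub>R (m - n) - P) \<bullet> m < 0" using s(3) X(2) by blast
  then show False using t \<open>n \<bullet> m < 1\<close> unfolding e by (simp add: mult_less_0_iff)
qed

lemma outer_normal_eq: "is_outer_normal \<Omega> P n \<Longrightarrow> outer_normal \<Omega> P = n"
  unfolding outer_normal_def by (rule the_equality, assumption) (rule outer_normal_unique)

lemma is_outer_normal_near:
  assumes "norm n = 1" and eq: "\<Omega> \<inter> ball P r = {X \<in> ball P r. (X - P) \<bullet> n < 0}"
    and Q: "Q \<in> ball P r" "(Q - P) \<bullet> n = 0"
  shows "is_outer_normal \<Omega> Q n"
proof -
  have dot: "(X - Q) \<bullet> n = (X - P) \<bullet> n" for X using Q(2) by (simp add: inner_diff_left)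
  obtain s where s: "s > 0" "ball Q s \<subseteq> ball P r"
    using Q(1) by (meson open_ball open_contains_ball)
  have "\<Omega> \<inter> ball Q s = {X \<in> ball Q s. (X - Q) \<bullet> n < 0}"
    using s(2) eq unfolding dot by blast
  then show ?thesis using assms(1) s(1) unfolding is_outer_normal_def by blast
qed

text \<open>Near a flat boundary point both the normal and the offset of the tangent plane are constant; a face
  is connected, so that they are constant on it.\<close>

lemma open_face_plane:
  assumes F: "F \<in> open_faces \<Omega>"
  obtains n where "norm n = 1" "\<And>P. P \<in> F \<Longrightarrow> is_outer_normal \<Omega> P n"
    "\<And>P Q. P \<in> F \<Longrightarrow> Q \<in> F \<Longrightarrow> (P - Q) \<bullet> n = 0"
proof -
  have conn: "connected F" and ne: "F \<noteq> {}" and sub: "F \<subseteq> flat_boundary \<Omega>"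
    using F in_components_connected in_components_nonempty in_components_subset unfolding open_faces_def by blast+
  have on: "is_outer_normal \<Omega> P (outer_normal \<Omega> P)" if "P \<in> F" for P
    using sub that outer_normal_eq unfolding flat_boundary_def by blast
  define f where "f P = (outer_normal \<Omega> P, P \<bullet> outer_normal \<Omega> P)" for P
  have "\<forall>P\<in>F. \<forall>\<^sub>F Q in at P within F. f P = f Q"
  proof
    fix P assume P: "P \<in> F"
    let ?n = "outer_normal \<Omega> P"
    obtain r where r: "norm ?n = 1" "r > 0" "\<Omega> \<inter> ball P r = {X \<in> ball P r. (X - P) \<bullet> ?n < 0}"
      using on[OF P] unfolding is_outer_normal_def by blast
    have "f P = f Q" if "Q \<in> F" "dist Q P < r" for Q
    proof -
      have Q: "Q \<in> ball P r" using that by (simp add: dist_commute)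
      have "(Q - P) \<bullet> ?n = 0" using flat_boundary_near[OF r Q] sub that by blast
      moreover from this have "outer_normal \<Omega> Q = ?n"
        by (intro outer_normal_eq is_outer_normal_near[OF r(1,3) Q])
      ultimately show ?thesis by (simp add: f_def inner_diff_left)
    qed
    then show "\<forall>\<^sub>F Q in at P within F. f P = f Q"
      unfolding eventually_at using r(2) by blast
  qed
  then have const: "f P = f Q" if "P \<in> F" "Q \<in> F" for P Q
    by (rule connected_local_const[OF conn that])
  obtain P0 where P0: "P0 \<in> F" using ne by blast
  show thesis
  proof (rule that[of "outer_normal \<Omega> P0"])
    show "norm (outer_normal \<Omega> P0) = 1" using on[OF P0] by (simp add: is_outer_normal_def)
    show "is_outer_normal \<Omega> P (outer_normal \<Omega> P0)" if "P \<in> F" for P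
      using on[OF that] const[OF that P0] by (simp add: f_def)
    have "R \<bullet> outer_normal \<Omega> P0 = P0 \<bullet> outer_normal \<Omega> P0" if "R \<in> F" for R
      using const[OF that P0] unfolding f_def by (metis prod.inject)
    then show "(P - Q) \<bullet> outer_normal \<Omega> P0 = 0" if "P \<in> F" "Q \<in> F" for P Q
      using that by (simp add: inner_diff_left)
  qed
qed

lemma open_face_contains_disc:
  assumes F: "F \<in> open_faces \<Omega>" and P: "P \<in> F" and "norm n = 1" "r > 0"
    and eq: "\<Omega> \<inter> ball P r = {X \<in> ball P r. (X - P) \<bullet> n < 0}"
  shows "{X \<in> ball P r. (X - P) \<bullet> n = 0} \<subseteq> F"
proof -
  let ?S = "{X \<in> ball P r. (X - P) \<bullet> n = 0}"
  have "convex {X. (X - P) \<bullet> n = 0}"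
  proof -
    have "{X. (X - P) \<bullet> n = 0} = {X. n \<bullet> X = n \<bullet> P}" by (auto simp: inner_diff_left inner_diff_right inner_commute)
    then show ?thesis by (simp add: convex_hyperplane)
  qed
  then have "connected (ball P r \<inter> {X. (X - P) \<bullet> n = 0})"
    by (intro convex_connected convex_Int convex_ball)
  moreover have "ball P r \<inter> {X. (X - P) \<bullet> n = 0} = ?S" by blast
  moreover have "?S \<subseteq> flat_boundary \<Omega>" using flat_boundary_near[OF assms(3,4) eq] by blast
  moreover have "P \<in> ?S" using \<open>r > 0\<close> by simp
  ultimately show ?thesis
    using F P unfolding open_faces_def by (intro components_maximal[of F "flat_boundary \<Omega>"]) auto
qed

section \<open>Surface measure in the coordinates of a face\<close>

lemma orthonormal_triple_expansion:
  fixes e1 e2 e3 X :: "real^3"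
  assumes "e1 \<bullet> e1 = 1" "e2 \<bullet> e2 = 1" "e3 \<bullet> e3 = 1" "e1 \<bullet> e2 = 0" "e1 \<bullet> e3 = 0" "e2 \<bullet> e3 = 0"
  shows "X = (X \<bullet> e1) *\<^sub>R e1 + (X \<bullet> e2) *\<^sub>R e2 + (X \<bullet> e3) *\<^sub>R e3"
proof -
  define T where "T x = x $ 1 *\<^sub>R e1 + x $ 2 *\<^sub>R e2 + x $ 3 *\<^sub>R e3" for x :: "real^3"
  have lin: "linear T" unfolding T_def
    by (rule linearI) (simp_all add: algebra_simps scaleR_add_left)
  have "T x \<bullet> T y = x \<bullet> y" for x y
  proof -
    have "x \<bullet> y = x $ 1 * y $ 1 + x $ 2 * y $ 2 + x $ 3 * y $ 3"
      by (simp add: inner_vec_def sum_3)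
    then show ?thesis
      using assms by (simp add: T_def inner_add_left inner_add_right inner_commute[of e2 e1] inner_commute[of e3 e1] inner_commute[of e3 e2])
  qed
  then have "orthogonal_transformation T"
    unfolding orthogonal_transformation_def using lin by blast
  then have "surj T" by (rule orthogonal_transformation_surj)
  then obtain x where x: "X = T x" by blast
  show ?thesis
    using assms unfolding x T_def
    by (simp add: inner_add_left inner_commute[of e2 e1] inner_commute[of e3 e1] inner_commute[of e3 e2])
qed

lemma orthonormal_complement:
  fixes n :: "real^3"
  assumes "norm n = 1"
  obtains e1 e2 where "e1 \<bullet> e1 = 1" "e2 \<bullet> e2 = 1" "e1 \<bullet> e2 = 0" "e1 \<bullet> n = 0" "e2 \<bullet> n = 0"
proof -
  have "norm (axis 3 1 :: real^3) = 1" by simp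
  then obtain T where T: "orthogonal_transformation T" "T (axis 3 1 :: real^3) = n"
    using orthogonal_transformation_exists_1 assms by metis
  have i: "T x \<bullet> T y = x \<bullet> y" for x y using T(1) by (simp add: orthogonal_transformation_def)
  show thesis
    by (rule that[of "T (axis 1 1)" "T (axis 2 1)"]; (unfold i T(2)[symmetric])?; simp add: inner_axis_axis)
qed

definition plane_chart :: "real^3 \<Rightarrow> real^3 \<Rightarrow> real^3 \<Rightarrow> real \<times> real \<Rightarrow> real^3" where
  "plane_chart c e1 e2 x = c + fst x *\<^sub>R e1 + snd x *\<^sub>R e2"

text \<open>An isometry that fixes the origin preserves inner products by polarisation, and a vector is
  determined by its inner products with the images of the unit vectors because the remaining part
  has norm 0.\<close>

lemma isometric_plane_affine:
  fixes \<phi> :: "real^2 \<Rightarrow> real^3"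
  assumes iso: "\<And>x y. dist (\<phi> x) (\<phi> y) = dist x y"
  obtains f1 f2 where "f1 \<bullet> f1 = 1" "f2 \<bullet> f2 = 1" "f1 \<bullet> f2 = 0"
    "\<And>x. \<phi> x = \<phi> 0 + x $ 1 *\<^sub>R f1 + x $ 2 *\<^sub>R f2"
proof -
  define g where "g x = \<phi> x - \<phi> 0" for x
  have ng: "norm (g x) = norm x" for x using iso[of x 0] by (simp add: g_def dist_norm)
  have nd: "norm (g x - g y) = norm (x - y)" for x y using iso[of x y] by (simp add: g_def dist_norm)
  have ip: "g x \<bullet> g y = x \<bullet> y" for x y
    using ng[of x] ng[of y] nd[of x y] by (simp add: dot_norm_neg)
  define f1 where "f1 = g (axis 1 1)"
  define f2 where "f2 = g (axis 2 1)"
  have f: "f1 \<bullet> f1 = 1" "f2 \<bullet> f2 = 1" "f1 \<bullet> f2 = 0"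
    unfolding f1_def f2_def ip by (auto simp: inner_axis_axis)
  have xf: "g x \<bullet> f1 = x $ 1" "g x \<bullet> f2 = x $ 2" for x
    unfolding f1_def f2_def ip by (auto simp: inner_axis)
  have gx: "g x = x $ 1 *\<^sub>R f1 + x $ 2 *\<^sub>R f2" for x
  proof -
    define d where "d = g x - (x $ 1 *\<^sub>R f1 + x $ 2 *\<^sub>R f2)"
    have gg: "g x \<bullet> g x = x $ 1 * x $ 1 + x $ 2 * x $ 2" unfolding ip by (simp add: inner_vec_def sum_2)
    have "d \<bullet> d = 0"
      unfolding d_def using f xf[of x] gg
      by (simp add: inner_diff_left inner_diff_right inner_add_left inner_add_right inner_commute algebra_simps)
    then show ?thesis by (simp add: d_def)
  qed
  have "\<phi> x = \<phi> 0 + x $ 1 *\<^sub>R f1 + x $ 2 *\<^sub>R f2" for x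
    unfolding add.assoc gx[of x, symmetric] by (simp add: g_def)
  then show thesis by (rule that[OF f])
qed

lemma isometry_distr_lborel:
  fixes A :: "(real, 'n :: {finite, wellorder}) vec \<Rightarrow> (real, 'n) vec"
  assumes iso: "\<And>x y. dist (A x) (A y) = dist x y"
  shows "surj A" "distr lborel borel A = lborel"
proof -
  define c where "c = A 0"
  define T where "T x = A x - c" for x
  have T: "orthogonal_transformation T"
    unfolding orthogonal_transformation_isometry using iso by (simp add: T_def c_def dist_norm)
  have AT: "A x = c + T x" for x by (simp add: T_def)
  have bT: "bij T" using T by (rule orthogonal_transformation_bij)
  show "surj A"
  proof (rule surjI)
    show "A (inv T (y - c)) = y" for y
      using bT by (simp add: AT bij_is_surj surj_f_inv_f)
  qed
  have iT: "orthogonal_transformation (inv T)" using T by (rule orthogonal_transformation_inv)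
  have contA: "continuous_on UNIV A"
    unfolding continuous_on_iff using iso by metis
  then have mA: "A \<in> borel_measurable borel" by (rule borel_measurable_continuous_onI)
  show "distr lborel borel A = lborel"
  proof (rule sym, rule lborel_eqI)
    fix l u :: "(real, 'n) vec" assume lu: "\<And>b. b \<in> Basis \<Longrightarrow> l \<bullet> b \<le> u \<bullet> b"
    have im: "A -` box l u = (+) (- inv T c) ` (inv T ` box l u)"
    proof -
      have l: "linear (inv T)" using iT by (rule orthogonal_transformation_linear)
      have "x = - inv T c + inv T (A x)" for x
      proof -
        have "inv T (A x) = inv T c + inv T (T x)" by (subst AT) (rule linear_add[OF l])
        then show ?thesis using bT by (simp add: bij_is_inj)
      qed
      moreover have "A (- inv T c + inv T y) = y" for y
        using bT linear_diff[OF orthogonal_transformation_linear[OF T], of "inv T y" "inv T c"]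
        by (simp add: AT bij_is_surj surj_f_inv_f)
      ultimately show ?thesis
        unfolding image_image by (auto simp: image_iff intro!: bexI[of _ "A _"])
    qed
    have b: "inv T ` box l u \<in> lmeasurable" by (rule measurable_orthogonal_image[OF iT]) simp
    have pre: "A -` box l u \<in> sets borel" using measurable_sets[OF mA, of "box l u"] by simp
    have lm: "A -` box l u \<in> lmeasurable" unfolding im by (rule measurable_translation[OF b])
    have "measure lebesgue (A -` box l u) = measure lebesgue (box l u)"
      unfolding im by (simp only: measure_translation measure_orthogonal_image[OF iT lmeasurable_box])
    then have "emeasure lborel (A -` box l u) = emeasure lborel (box l u)"
      using lm pre emeasure_eq_measure2[OF lm] emeasure_eq_measure2[of "box l u" lebesgue]
      by (simp add: emeasure_completion main_part_sets)
    then show "emeasure (distr lborel borel A) (box l u) = (\<Prod>b\<in>Basis. (u - l) \<bullet> b)"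
      using lu by (simp add: emeasure_distr mA emeasure_lborel_box)
  qed simp
qed

lemma pair_to_vec_measurable:
  "(\<lambda>x :: real \<times> real. (\<chi> i. if i = 1 then fst x else snd x) :: real^2) \<in> borel_measurable borel"
proof (intro borel_measurable_continuous_onI continuous_on_vec_lambda)
  fix i :: 2
  show "continuous_on UNIV (\<lambda>x :: real \<times> real. if i = 1 then fst x else snd x)"
    by (cases "i = 1") (auto intro: continuous_intros)
qed

lemma pair_to_vec_distr_lborel:
  "distr (lborel :: (real \<times> real) measure) borel (\<lambda>x. (\<chi> i. if i = 1 then fst x else snd x) :: real^2) = lborel"
proof (rule sym, rule lborel_eqI)
  note m = pair_to_vec_measurable
  fix l u :: "real^2" assume lu: "\<And>b. b \<in> Basis \<Longrightarrow> l \<bullet> b \<le> u \<bullet> b"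
  have B: "(Basis :: (real^2) set) = {axis 1 1, axis 2 1}"
    by (auto simp: Basis_vec_def UNIV_2)
  have ne: "axis 1 1 \<noteq> (axis 2 1 :: real^2)" by (simp add: axis_eq_axis)
  have le: "l $ 1 \<le> u $ 1" "l $ 2 \<le> u $ 2"
    using lu[of "axis 1 1"] lu[of "axis 2 1"] by (auto simp: B inner_axis)
  have pre: "(\<lambda>x. (\<chi> i. if i = 1 then fst x else snd x) :: real^2) -` box l u = box (l $ 1, l $ 2) (u $ 1, u $ 2)"
    by (auto simp: mem_box_cart forall_2 mem_box Basis_prod_def)
  show "emeasure (distr (lborel :: (real \<times> real) measure) borel (\<lambda>x. (\<chi> i. if i = 1 then fst x else snd x) :: real^2)) (box l u)
      = (\<Prod>b\<in>Basis. (u - l) \<bullet> b)"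
    using le ne by (simp add: emeasure_distr m pre emeasure_lborel_box_eq Basis_prod_def prod.union_disjoint B inner_axis)
qed simp


lemma plane_chart_dist:
  assumes "e1 \<bullet> e1 = 1" "e2 \<bullet> e2 = 1" "e1 \<bullet> e2 = 0"
  shows "dist (plane_chart c e1 e2 x) (plane_chart c e1 e2 y) = dist x y"
proof -
  have "plane_chart c e1 e2 x - plane_chart c e1 e2 y = (fst x - fst y) *\<^sub>R e1 + (snd x - snd y) *\<^sub>R e2"
    by (simp add: plane_chart_def algebra_simps)
  moreover have "norm (a *\<^sub>R e1 + b *\<^sub>R e2) = sqrt (a\<^sup>2 + b\<^sup>2)" for a b
    using assms by (simp add: norm_eq_sqrt_inner inner_add_left inner_add_right inner_commute[of e2 e1] power2_eq_square)
  moreover have "dist x y = sqrt ((fst x - fst y)\<^sup>2 + (snd x - snd y)\<^sup>2)"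
    by (simp add: dist_prod_def dist_real_def)
  ultimately show ?thesis
    by (simp only: dist_norm[of "plane_chart c e1 e2 x"])
qed

lemma dist_components: "dist (x $ 1, x $ 2) (y $ 1, y $ 2) = dist x (y :: real^2)"
  by (simp add: dist_prod_def dist_vec_def L2_set_def sum_2)

lemma plane_chart_coords:
  assumes n: "norm n = 1" and e: "e1 \<bullet> e1 = 1" "e2 \<bullet> e2 = 1" "e1 \<bullet> e2 = 0" "e1 \<bullet> n = 0" "e2 \<bullet> n = 0"
    and X: "(X - c) \<bullet> n = 0"
  shows "plane_chart c e1 e2 ((X - c) \<bullet> e1, (X - c) \<bullet> e2) = X"
  using orthonormal_triple_expansion[of e1 e2 n "X - c"] assms
  by (simp add: plane_chart_def norm_eq_1 algebra_simps)

text \<open>Every system of rectangular coordinates of a face differs from a chart by an isometry of the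
  coordinate plane, so that all of them measure area alike. To compare the ranges it suffices that
  the face contains a small disc, since both maps are affine.\<close>

lemma rectangular_coords_vimage:
  assumes F: "F \<in> open_faces \<Omega>" and c: "c \<in> F" and nrm: "is_outer_normal \<Omega> c n"
    and e: "e1 \<bullet> e1 = 1" "e2 \<bullet> e2 = 1" "e1 \<bullet> e2 = 0" "e1 \<bullet> n = 0" "e2 \<bullet> n = 0"
    and \<phi>: "rectangular_coords F \<phi>" and B: "B \<in> sets borel"
  shows "emeasure lborel (\<phi> -` B) = emeasure lborel (plane_chart c e1 e2 -` B)"
    and "range \<phi> = range (plane_chart c e1 e2)"
proof -
  define p where "p x = (x $ 1, x $ 2)" for x :: "real^2"
  define k where "k = (\<lambda>x. plane_chart c e1 e2 (p x))"
  have iso: "dist (\<phi> x) (\<phi> y) = dist x y" for x y using \<phi> by (simp add: rectangular_coords_def)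
  have isok: "dist (k x) (k y) = dist x y" for x y
  proof -
    show ?thesis by (simp only: k_def p_def plane_chart_dist[OF e(1-3)] dist_components)
  qed
  obtain r where r: "norm n = 1" "r > 0" "\<Omega> \<inter> ball c r = {X \<in> ball c r. (X - c) \<bullet> n < 0}"
    using nrm unfolding is_outer_normal_def by blast
  obtain f1 f2 where f: "f1 \<bullet> f1 = 1" "f2 \<bullet> f2 = 1" "f1 \<bullet> f2 = 0"
    and aff: "\<And>x. \<phi> x = \<phi> 0 + x $ 1 *\<^sub>R f1 + x $ 2 *\<^sub>R f2"
    using isometric_plane_affine[OF iso] by metis
  have small: "k x \<in> range \<phi>" if "norm x < r" for x
  proof -
    have k0: "k 0 = c" by (simp add: k_def p_def plane_chart_def)
    have "k x \<in> ball c r" using isok[of 0 x] that k0 by simp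
    moreover have "(k x - c) \<bullet> n = 0"
      using e by (simp add: k_def p_def plane_chart_def inner_add_left)
    ultimately have "k x \<in> F" using open_face_contains_disc[OF F c r] by blast
    then show ?thesis using \<phi> by (auto simp: rectangular_coords_def)
  qed
  have all: "k x \<in> range \<phi>" for x
  proof -
    \<comment> \<open>Shrink towards the centre c until the point lies in the disc, and expand again in the coordinates.\<close>
    define l where "l = r / (2 * (norm x + 1))"
    have l: "l > 0" using r by (simp add: l_def add_nonneg_pos)
    have "norm (l *\<^sub>R x) < r"
    proof -
      have "norm (l *\<^sub>R x) \<le> l * (norm x + 1)" using l by simp
      also have "\<dots> = r / 2" unfolding l_def by (simp add: field_simps add_nonneg_eq_0_iff)
      finally show ?thesis using r by linarith
    qed
    then obtain z where z: "k (l *\<^sub>R x) = \<phi> z" using small by blast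
    obtain q where q: "c = \<phi> q" using c \<phi> by (auto simp: rectangular_coords_def)
    have kx: "k x = c + (1 / l) *\<^sub>R (k (l *\<^sub>R x) - c)"
      using l by (simp add: k_def p_def plane_chart_def scaleR_add_right)
    also have "\<dots> = \<phi> (q + (1 / l) *\<^sub>R (z - q))"
    proof -
      have "\<phi> z - \<phi> q = (z $ 1 - q $ 1) *\<^sub>R f1 + (z $ 2 - q $ 2) *\<^sub>R f2"
        using aff[of z] aff[of q] by (simp add: algebra_simps)
      then show ?thesis
        unfolding z q using aff[of q] aff[of "q + (1 / l) *\<^sub>R (z - q)"]
        by (simp add: scaleR_add_right scaleR_add_left add.assoc)
    qed
    finally show ?thesis by blast
  qed
  have "inj \<phi>"
  proof (rule injI)
    fix x y assume "\<phi> x = \<phi> y"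
    then show "x = y" using iso[of x y] by simp
  qed
  define A where "A x = inv \<phi> (k x)" for x
  have A: "\<phi> (A x) = k x" for x unfolding A_def using all by (rule f_inv_into_f)
  have isoA: "dist (A x) (A y) = dist x y" for x y
    using iso[of "A x" "A y"] isok[of x y] unfolding A by simp
  have contA: "continuous_on UNIV A"
    unfolding continuous_on_iff using isoA by metis
  then have mA: "A \<in> borel_measurable borel" by (rule borel_measurable_continuous_onI)
  have contf: "continuous_on UNIV \<phi>"
    unfolding continuous_on_iff using iso by metis
  then have mf: "\<phi> -` B \<in> sets borel"
    using measurable_sets[OF borel_measurable_continuous_onI[OF contf] B] by simp
  have pk: "plane_chart c e1 e2 x = k (\<chi> i. if i = 1 then fst x else snd x)" for x
    by (simp add: k_def p_def)
  have "range k = range (plane_chart c e1 e2)" using pk by (auto simp: k_def)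
  moreover have "range \<phi> = range k"
  proof -
    have "\<phi> y \<in> range k" for y
      using isometry_distr_lborel(1)[OF isoA] A by (metis rangeI surjD)
    then show ?thesis using all by blast
  qed
  ultimately show "range \<phi> = range (plane_chart c e1 e2)" by simp
  have "emeasure lborel (\<phi> -` B) = emeasure (distr lborel borel A) (\<phi> -` B)"
    using isometry_distr_lborel(2)[OF isoA] by simp
  also have "\<dots> = emeasure lborel (k -` B)"
    using mA mf A by (simp add: emeasure_distr vimage_def)
  also have "\<dots> = emeasure (distr (lborel :: (real \<times> real) measure) borel (\<lambda>x. (\<chi> i. if i = 1 then fst x else snd x) :: real^2)) (k -` B)"
    by (simp add: pair_to_vec_distr_lborel)
  also have "\<dots> = emeasure lborel (plane_chart c e1 e2 -` B)"
  proof -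
    have "continuous_on UNIV k"
      unfolding continuous_on_iff using isok by metis
    then have mk: "k -` B \<in> sets borel"
      using measurable_sets[OF borel_measurable_continuous_onI B] by simp
    have "(\<lambda>x :: real \<times> real. (\<chi> i. if i = 1 then fst x else snd x) :: real^2) \<in> borel_measurable borel"
      by (rule pair_to_vec_measurable)
    then show ?thesis using mk by (simp add: emeasure_distr pk vimage_def)
  qed
  finally show "emeasure lborel (\<phi> -` B) = emeasure lborel (plane_chart c e1 e2 -` B)" .
qed

lemma rectangular_coords_exist:
  assumes F: "F \<in> open_faces \<Omega>"
  shows "\<exists>\<phi>. rectangular_coords F \<phi>"
proof -
  obtain n where n: "norm n = 1" "\<And>P. P \<in> F \<Longrightarrow> is_outer_normal \<Omega> P n"
    "\<And>P Q. P \<in> F \<Longrightarrow> Q \<in> F \<Longrightarrow> (P - Q) \<bullet> n = 0"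
    using open_face_plane[OF F] by blast
  obtain e1 e2 where e: "e1 \<bullet> e1 = 1" "e2 \<bullet> e2 = 1" "e1 \<bullet> e2 = 0" "e1 \<bullet> n = 0" "e2 \<bullet> n = 0"
    using orthonormal_complement[OF n(1)] by metis
  obtain c where c: "c \<in> F" using F in_components_nonempty unfolding open_faces_def by blast
  have "F \<subseteq> range (\<lambda>x :: real^2. plane_chart c e1 e2 (x $ 1, x $ 2))"
  proof
    fix X assume "X \<in> F"
    then have "X = plane_chart c e1 e2 ((X - c) \<bullet> e1, (X - c) \<bullet> e2)"
      using plane_chart_coords[OF n(1) e n(3)[OF _ c]] by simp
    then show "X \<in> range (\<lambda>x :: real^2. plane_chart c e1 e2 (x $ 1, x $ 2))"
      by (intro range_eqI[of _ _ "\<chi> i. if i = 1 then (X - c) \<bullet> e1 else (X - c) \<bullet> e2"]) simp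
  qed
  then have "rectangular_coords F (\<lambda>x :: real^2. plane_chart c e1 e2 (x $ 1, x $ 2))"
    unfolding rectangular_coords_def
    by (simp only: plane_chart_dist[OF e(1-3)] dist_components) simp
  then show ?thesis by blast
qed

lemma sets_surface_measure [simp]: "sets (surface_measure \<Omega>) = sets borel"
  unfolding surface_measure_def by (metis sets.sets_measure_of_eq space_borel)

lemma space_surface_measure [simp]: "space (surface_measure \<Omega>) = UNIV"
  using sets_eq_imp_space_eq[of "surface_measure \<Omega>" borel] by simp

lemma borel_measurable_surface_measure [simp]:
  "borel_measurable (surface_measure \<Omega>) = borel_measurable borel"
  by (rule measurable_cong_sets) simp_all

text \<open>Distinct faces are disjoint, so that a single summand of the surface measure survives.\<close>

lemma surface_measure_on_face:
  assumes \<Omega>: "compact_polyhedral_domain \<Omega>" and F: "F \<in> open_faces \<Omega>" and c: "c \<in> F" and nrm: "is_outer_normal \<Omega> c n"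
    and e: "e1 \<bullet> e1 = 1" "e2 \<bullet> e2 = 1" "e1 \<bullet> e2 = 0" "e1 \<bullet> n = 0" "e2 \<bullet> n = 0"
    and A: "A \<in> sets borel"
  shows "emeasure (surface_measure \<Omega>) (A \<inter> F) = emeasure lborel (plane_chart c e1 e2 -` (A \<inter> F))"
proof -
  have AF: "A \<inter> F \<in> sets borel" using A open_faces_borel[OF F] by simp
  have "emeasure (surface_measure \<Omega>) (A \<inter> F) = (\<Sum>F'\<in>open_faces \<Omega>. face_area F' (A \<inter> F))"
    by (rule emeasure_surface_measure[OF AF rectangular_coords_exist])
  also have "\<dots> = (\<Sum>F'\<in>{F}. face_area F' (A \<inter> F))"
  proof (rule sum.mono_neutral_right)
    show "finite (open_faces \<Omega>)" by (rule finite_open_faces[OF \<Omega>])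
    show "\<forall>F'\<in>open_faces \<Omega> - {F}. face_area F' (A \<inter> F) = 0"
    proof
      fix F' assume "F' \<in> open_faces \<Omega> - {F}"
      then have "A \<inter> F \<inter> F' = {}" using components_nonoverlap[of F "flat_boundary \<Omega>" F'] F
        unfolding open_faces_def by auto
      then show "face_area F' (A \<inter> F) = 0" by (simp add: face_area_def)
    qed
  qed (use F in auto)
  also have "\<dots> = emeasure lborel (plane_chart c e1 e2 -` (A \<inter> F))"
    using rectangular_coords_vimage(1)[OF F c nrm e someI_ex[OF rectangular_coords_exist[OF F]] AF]
    by (simp add: face_area_def Int_assoc)
  finally show ?thesis .
qed

lemma plane_chart_measurable [measurable]: "plane_chart c e1 e2 \<in> borel_measurable borel"
  unfolding plane_chart_def[abs_def]
  by (intro borel_measurable_continuous_onI continuous_intros)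

lemma AE_surface_measure_on_face:
  assumes \<Omega>: "compact_polyhedral_domain \<Omega>" and F: "F \<in> open_faces \<Omega>" and c: "c \<in> F" and nrm: "is_outer_normal \<Omega> c n"
    and e: "e1 \<bullet> e1 = 1" "e2 \<bullet> e2 = 1" "e1 \<bullet> e2 = 0" "e1 \<bullet> n = 0" "e2 \<bullet> n = 0"
    and AE: "AE P in surface_measure \<Omega>. R P"
  shows "AE x in lborel. plane_chart c e1 e2 x \<in> F \<longrightarrow> R (plane_chart c e1 e2 x)"
proof -
  obtain A where A: "{P. \<not> R P} \<subseteq> A" "A \<in> sets borel" "emeasure (surface_measure \<Omega>) A = 0"
    using AE by (auto elim!: AE_E)
  have "emeasure (surface_measure \<Omega>) (A \<inter> F) = 0"
    using emeasure_mono[of "A \<inter> F" A "surface_measure \<Omega>"] A by simp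
  then have "emeasure lborel (plane_chart c e1 e2 -` (A \<inter> F)) = 0"
    using surface_measure_on_face[OF \<Omega> F c nrm e A(2)] by simp
  moreover have "plane_chart c e1 e2 -` (A \<inter> F) \<in> sets lborel"
    using measurable_sets[OF plane_chart_measurable, of "A \<inter> F"] A(2) open_faces_borel[OF F] by simp
  ultimately show ?thesis
    using A(1) by (intro AE_I[of _ _ "plane_chart c e1 e2 -` (A \<inter> F)"]) auto
qed

lemma emeasure_density_indicator:
  assumes "sets M = sets borel" "A \<in> sets borel" "F \<in> sets borel"
  shows "emeasure (density M (indicator F)) A = emeasure M (A \<inter> F)"
proof -
  have "emeasure (density M (indicator F)) A = (\<integral>\<^sup>+x. indicator F x * indicator A x \<partial>M)"
    using assms by (intro emeasure_density) simp_all
  also have "\<dots> = (\<integral>\<^sup>+x. indicator (A \<inter> F) x \<partial>M)"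
    by (intro nn_integral_cong) (auto simp: indicator_def)
  also have "\<dots> = emeasure M (A \<inter> F)" using assms by (intro nn_integral_indicator) simp
  finally show ?thesis .
qed

lemma nn_integral_surface_measure_on_face:
  assumes \<Omega>: "compact_polyhedral_domain \<Omega>" and F: "F \<in> open_faces \<Omega>" and c: "c \<in> F" and nrm: "is_outer_normal \<Omega> c n"
    and e: "e1 \<bullet> e1 = 1" "e2 \<bullet> e2 = 1" "e1 \<bullet> e2 = 0" "e1 \<bullet> n = 0" "e2 \<bullet> n = 0"
    and h: "h \<in> borel_measurable borel"
  shows "(\<integral>\<^sup>+P. h P * indicator F P \<partial>surface_measure \<Omega>) =
         (\<integral>\<^sup>+x. h (plane_chart c e1 e2 x) * indicator F (plane_chart c e1 e2 x) \<partial>lborel)"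
proof -
  let ?k = "plane_chart c e1 e2"
  have Fb: "F \<in> sets borel" by (rule open_faces_borel[OF F])
  have Fs: "F \<in> sets (surface_measure \<Omega>)" using Fb by simp
  have m: "?k \<in> measurable lborel borel" by simp
  have eq: "density (surface_measure \<Omega>) (indicator F) = density (distr lborel borel ?k) (indicator F)"
  proof (rule measure_eqI)
    fix A assume "A \<in> sets (density (surface_measure \<Omega>) (indicator F))"
    then have A: "A \<in> sets borel" by simp
    have "emeasure (density (surface_measure \<Omega>) (indicator F)) A = emeasure (surface_measure \<Omega>) (A \<inter> F)"
      using A Fb by (intro emeasure_density_indicator) simp_all
    also have "\<dots> = emeasure lborel (?k -` (A \<inter> F))" by (rule surface_measure_on_face[OF \<Omega> F c nrm e A])
    also have "\<dots> = emeasure (distr lborel borel ?k) (A \<inter> F)"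
      using A Fb by (simp add: emeasure_distr)
    also have "\<dots> = emeasure (density (distr lborel borel ?k) (indicator F)) A"
      using A Fb by (intro emeasure_density_indicator[symmetric]) simp_all
    finally show "emeasure (density (surface_measure \<Omega>) (indicator F)) A = emeasure (density (distr lborel borel ?k) (indicator F)) A" .
  qed simp
  have "(\<integral>\<^sup>+P. h P * indicator F P \<partial>surface_measure \<Omega>) = (\<integral>\<^sup>+P. h P \<partial>density (surface_measure \<Omega>) (indicator F))"
    using h Fb by (subst nn_integral_density) (simp_all add: mult.commute)
  also have "\<dots> = (\<integral>\<^sup>+P. h P * indicator F P \<partial>distr lborel borel ?k)"
    unfolding eq using h Fb by (subst nn_integral_density) (simp_all add: mult.commute)
  also have "\<dots> = (\<integral>\<^sup>+x. h (?k x) * indicator F (?k x) \<partial>lborel)"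
    using h Fb by (subst nn_integral_distr) simp_all
  finally show ?thesis .
qed

section \<open>Derivatives of harmonic functions in an orthonormal frame\<close>

lemma has_derivative_inner_grad:
  fixes u :: "real^'n \<Rightarrow> real"
  assumes "u differentiable (at X)"
  shows "(u has_derivative (\<lambda>h. grad u X \<bullet> h)) (at X)"
proof -
  have d: "(u has_derivative frechet_derivative u (at X)) (at X)"
    using assms by (simp add: frechet_derivative_works)
  then have l: "linear (frechet_derivative u (at X))" by (rule has_derivative_linear)
  have "frechet_derivative u (at X) h = grad u X \<bullet> h" for h
  proof -
    have "frechet_derivative u (at X) h = frechet_derivative u (at X) (\<Sum>i\<in>UNIV. h $ i *\<^sub>R axis i 1)"
      by (simp add: basis_expansion scalar_mult_eq_scaleR[symmetric])
    also have "\<dots> = (\<Sum>i\<in>UNIV. h $ i * frechet_derivative u (at X) (axis i 1))"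
      by (simp add: linear_sum[OF l] linear_scale[OF l])
    also have "\<dots> = grad u X \<bullet> h"
      by (simp add: grad_def inner_vec_def mult.commute)
    finally show ?thesis .
  qed
  then have "frechet_derivative u (at X) = (\<lambda>h. grad u X \<bullet> h)" by (rule ext)
  then show ?thesis using d by simp
qed

lemma grad_has_derivative_hessian:
  fixes u :: "real^'n \<Rightarrow> real"
  assumes "grad u differentiable (at X)"
  shows "(grad u has_derivative (\<lambda>h. hessian u X *v h)) (at X)"
proof -
  have d: "(grad u has_derivative frechet_derivative (grad u) (at X)) (at X)"
    using assms by (simp add: frechet_derivative_works)
  then have "linear (frechet_derivative (grad u) (at X))" by (rule has_derivative_linear)
  then have "frechet_derivative (grad u) (at X) = (\<lambda>h. hessian u X *v h)"
    unfolding hessian_def by (simp add: matrix_works ext)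
  then show ?thesis using d by simp
qed

lemma directional_derivative:
  fixes u :: "real^'n \<Rightarrow> real"
  assumes "u differentiable (at (X + t *\<^sub>R e))"
  shows "((\<lambda>t. u (X + t *\<^sub>R e)) has_real_derivative e \<bullet> grad u (X + t *\<^sub>R e)) (at t)"
proof -
  have "((\<lambda>t. X + t *\<^sub>R e) has_derivative (\<lambda>h. h *\<^sub>R e)) (at t)"
    by (auto intro!: derivative_eq_intros)
  from has_derivative_compose[OF this has_derivative_inner_grad[OF assms]]
  show ?thesis by (simp add: has_field_derivative_def inner_commute[of e] mult_commute_abs)
qed

lemma directional_derivative_grad:
  fixes u :: "real^'n \<Rightarrow> real"
  assumes "grad u differentiable (at (X + t *\<^sub>R e))"
  shows "((\<lambda>t. f \<bullet> grad u (X + t *\<^sub>R e)) has_real_derivative f \<bullet> (hessian u (X + t *\<^sub>R e) *v e)) (at t)"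
proof -
  have "((\<lambda>t. X + t *\<^sub>R e) has_derivative (\<lambda>h. h *\<^sub>R e)) (at t)"
    by (auto intro!: derivative_eq_intros)
  from has_derivative_inner_right[OF has_derivative_compose[OF this grad_has_derivative_hessian[OF assms]], of f]
  show ?thesis
    by (simp add: has_field_derivative_def matrix_vector_mult_scaleR inner_scaleR_right mult_commute_abs)
qed

text \<open>The mean value theorem is applied first in the direction e and then in the direction f. The
  double difference on the left is symmetric in e and f, and this gives the symmetry of the Hessian.\<close>

lemma mixed_difference:
  fixes u :: "real^'n \<Rightarrow> real"
  assumes d: "\<And>Y. dist X Y < r \<Longrightarrow> u differentiable (at Y) \<and> grad u differentiable (at Y)"
    and n: "norm e \<le> 1" "norm f \<le> 1" and h: "0 < h" "2 * h < r"
  obtains Y where "dist X Y < r" "dist X Y \<le> 2 * h"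
    "u (X + h *\<^sub>R e + h *\<^sub>R f) - u (X + h *\<^sub>R e) - u (X + h *\<^sub>R f) + u X = h * h * (e \<bullet> (hessian u Y *v f))"
proof -
  have near: "dist X (X + s *\<^sub>R e + t *\<^sub>R f) \<le> 2 * h" if "0 \<le> s" "s \<le> h" "0 \<le> t" "t \<le> h" for s t
  proof -
    have "dist X (X + s *\<^sub>R e + t *\<^sub>R f) = norm (s *\<^sub>R e + t *\<^sub>R f)"
      by (simp add: dist_norm algebra_simps norm_minus_commute)
    also have "\<dots> \<le> s * norm e + t * norm f" using norm_triangle_ineq[of "s *\<^sub>R e" "t *\<^sub>R f"] that by simp
    also have "\<dots> \<le> h * 1 + h * 1" using that n by (intro add_mono mult_mono) auto
    finally show ?thesis by simp
  qed
  define g where "g s = u (X + h *\<^sub>R f + s *\<^sub>R e) - u (X + s *\<^sub>R e)" for s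
  have "\<exists>s. 0 < s \<and> s < h \<and> g h - g 0 = (h - 0) * (e \<bullet> grad u (X + h *\<^sub>R f + s *\<^sub>R e) - e \<bullet> grad u (X + s *\<^sub>R e))"
  proof (rule MVT2[OF h(1)])
    fix s assume s: "0 \<le> s" "s \<le> h"
    have eq: "X + h *\<^sub>R f + s *\<^sub>R e = X + s *\<^sub>R e + h *\<^sub>R f" by simp
    have "dist X (X + h *\<^sub>R f + s *\<^sub>R e) < r" "dist X (X + s *\<^sub>R e) < r"
      unfolding eq using near[of s h] near[of s 0] s h by auto
    then show "(g has_real_derivative e \<bullet> grad u (X + h *\<^sub>R f + s *\<^sub>R e) - e \<bullet> grad u (X + s *\<^sub>R e)) (at s)"
      unfolding g_def by (intro DERIV_diff directional_derivative) (use d in auto)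
  qed
  then obtain s where s: "0 < s" "s < h"
    and 1: "g h - g 0 = h * (e \<bullet> grad u (X + h *\<^sub>R f + s *\<^sub>R e) - e \<bullet> grad u (X + s *\<^sub>R e))" by auto
  have "\<exists>t. 0 < t \<and> t < h \<and> e \<bullet> grad u (X + s *\<^sub>R e + h *\<^sub>R f) - e \<bullet> grad u (X + s *\<^sub>R e + 0 *\<^sub>R f)
       = (h - 0) * (e \<bullet> (hessian u (X + s *\<^sub>R e + t *\<^sub>R f) *v f))"
  proof (rule MVT2[OF h(1)])
    fix t assume t: "0 \<le> t" "t \<le> h"
    have "dist X (X + s *\<^sub>R e + t *\<^sub>R f) < r" using near[of s t] s t h by auto
    then show "((\<lambda>t. e \<bullet> grad u (X + s *\<^sub>R e + t *\<^sub>R f)) has_real_derivative e \<bullet> (hessian u (X + s *\<^sub>R e + t *\<^sub>R f) *v f)) (at t)"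
      by (intro directional_derivative_grad) (use d in auto)
  qed
  then obtain t where t: "0 < t" "t < h"
    and 2: "e \<bullet> grad u (X + s *\<^sub>R e + h *\<^sub>R f) - e \<bullet> grad u (X + s *\<^sub>R e) = h * (e \<bullet> (hessian u (X + s *\<^sub>R e + t *\<^sub>R f) *v f))"
    by auto
  have eq: "X + h *\<^sub>R f + s *\<^sub>R e = X + s *\<^sub>R e + h *\<^sub>R f" by simp
  have "g h - g 0 = h * h * (e \<bullet> (hessian u (X + s *\<^sub>R e + t *\<^sub>R f) *v f))"
    using 1 unfolding eq 2 by simp
  moreover have "g h - g 0 = u (X + h *\<^sub>R e + h *\<^sub>R f) - u (X + h *\<^sub>R e) - u (X + h *\<^sub>R f) + u X"
    by (simp add: g_def add.commute add.left_commute)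
  ultimately show thesis
    using that[of "X + s *\<^sub>R e + t *\<^sub>R f"] near[of s t] s t h by simp
qed

lemma continuous_on_bilinear_form:
  fixes H :: "'a::topological_space \<Rightarrow> real^'n^'n"
  assumes "continuous_on S H"
  shows "continuous_on S (\<lambda>Y. e \<bullet> (H Y *v f))"
proof -
  have "continuous_on S (\<lambda>Y. \<Sum>i\<in>UNIV. e $ i * (\<Sum>j\<in>UNIV. H Y $ i $ j * f $ j))"
    by (intro continuous_on_sum continuous_on_mult continuous_on_const
        bounded_linear.continuous_on[OF bounded_linear_vec_nth] assms)
  then show ?thesis by (simp add: inner_vec_def matrix_vector_mult_def)
qed

lemma hessian_symmetric:
  fixes u :: "real^'n \<Rightarrow> real"
  assumes "open S" "X \<in> S" and d: "\<And>Y. Y \<in> S \<Longrightarrow> u differentiable (at Y) \<and> grad u differentiable (at Y)"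
    and c: "continuous_on S (hessian u)" and n: "norm e \<le> 1" "norm f \<le> 1"
  shows "e \<bullet> (hessian u X *v f) = f \<bullet> (hessian u X *v e)"
proof -
  define A where "A Y = e \<bullet> (hessian u Y *v f)" for Y
  define B where "B Y = f \<bullet> (hessian u Y *v e)" for Y
  have cA: "isCont A X" "isCont B X"
    unfolding A_def B_def
    using continuous_on_bilinear_form[OF c] assms(1,2) by (simp_all add: continuous_on_eq_continuous_at)
  obtain r where r: "r > 0" "ball X r \<subseteq> S" using assms(1,2) by (meson open_contains_ball)
  have "\<bar>A X - B X\<bar> \<le> 2 * \<delta>" if "\<delta> > 0" for \<delta>
  proof -
    obtain p where p: "p > 0" "\<And>Y. dist Y X < p \<Longrightarrow> dist (A Y) (A X) < \<delta>"
      using cA(1) \<open>\<delta> > 0\<close> unfolding continuous_at_eps_delta by blast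
    obtain q where q: "q > 0" "\<And>Y. dist Y X < q \<Longrightarrow> dist (B Y) (B X) < \<delta>"
      using cA(2) \<open>\<delta> > 0\<close> unfolding continuous_at_eps_delta by blast
    define h where "h = min r (min p q) / 3"
    have h: "0 < h" "2 * h < r" "2 * h < p" "2 * h < q" using r p q by (auto simp: h_def)
    have dr: "u differentiable (at Y) \<and> grad u differentiable (at Y)" if "dist X Y < r" for Y
      using d r(2) that by auto
    obtain Y where Y: "dist X Y \<le> 2 * h"
      "u (X + h *\<^sub>R e + h *\<^sub>R f) - u (X + h *\<^sub>R e) - u (X + h *\<^sub>R f) + u X = h * h * A Y"
      using mixed_difference[OF dr n h(1,2)] unfolding A_def by metis
    obtain W where W: "dist X W \<le> 2 * h"
      "u (X + h *\<^sub>R f + h *\<^sub>R e) - u (X + h *\<^sub>R f) - u (X + h *\<^sub>R e) + u X = h * h * B W"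
      using mixed_difference[OF dr n(2,1) h(1,2)] unfolding B_def by metis
    have eq: "X + h *\<^sub>R f + h *\<^sub>R e = X + h *\<^sub>R e + h *\<^sub>R f" by simp
    have "h * h * A Y = h * h * B W" using Y(2) W(2) unfolding eq by linarith
    then have "A Y = B W" using h(1) by simp
    moreover have "dist (A Y) (A X) < \<delta>" "dist (B W) (B X) < \<delta>"
      using p(2)[of Y] q(2)[of W] Y W h by (auto simp: dist_commute)
    ultimately show ?thesis by (simp add: dist_real_def)
  qed
  then have "\<bar>A X - B X\<bar> \<le> 0 + \<delta>" if "\<delta> > 0" for \<delta>
    using that by (metis add_0 half_gt_zero mult.commute nonzero_eq_divide_eq zero_neq_numeral)
  then have "\<bar>A X - B X\<bar> \<le> 0" by (rule field_le_epsilon)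
  then show ?thesis by (simp add: A_def B_def)
qed

text \<open>The trace is invariant under the change to the orthonormal basis: with the basis as the rows of P,
  these are the diagonal entries of \<open>P H P\<^sup>T\<close>.\<close>

lemma trace_orthonormal:
  fixes H :: "real^3^3"
  assumes "e1 \<bullet> e1 = 1" "e2 \<bullet> e2 = 1" "e3 \<bullet> e3 = 1" "e1 \<bullet> e2 = 0" "e1 \<bullet> e3 = 0" "e2 \<bullet> e3 = 0"
  shows "e1 \<bullet> (H *v e1) + e2 \<bullet> (H *v e2) + e3 \<bullet> (H *v e3) = trace H"
proof -
  define P :: "real^3^3" where "P = (\<chi> i. if i = 1 then e1 else if i = 2 then e2 else e3)"
  have rows: "P $ 1 = e1" "P $ 2 = e2" "P $ 3 = e3" by (simp_all add: P_def)
  have "P ** transpose P = mat 1"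
    using assms by (simp add: vec_eq_iff matrix_matrix_mult_def transpose_def mat_def forall_3 rows
        inner_vec_def sum_3 mult.commute)
  then have PP: "transpose P ** P = mat 1" by (simp add: matrix_left_right_inverse)
  have "trace H = trace ((transpose P ** P) ** H)" by (simp add: PP)
  also have "\<dots> = trace (transpose P ** (P ** H))" by (simp add: matrix_mul_assoc)
  also have "\<dots> = trace ((P ** H) ** transpose P)" by (rule trace_mul_sym)
  also have "\<dots> = e1 \<bullet> (H *v e1) + e2 \<bullet> (H *v e2) + e3 \<bullet> (H *v e3)"
    by (simp add: trace_def sum_3 matrix_matrix_mult_def transpose_def rows inner_vec_def
        matrix_vector_mult_def algebra_simps)
  finally show ?thesis by simp
qed

section \<open>Nearly straight pieces of a Lipschitz interface\<close>

text \<open>M is the supremum of the slopes of all chords, and [a, b] carries a chord of almost this slope. On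
  [a, b] the graph cannot rise faster than M, so it lies below the line through its left end; and
  it has to reach the right end, so it does not fall behind the line by more than the
  defect of the chord. The slope M is the same for all \<open>\<eta>\<close>, so one frame serves all pieces.\<close>

lemma lipschitz_almost_affine:
  fixes \<psi> :: "real \<Rightarrow> real"
  assumes lip: "L-lipschitz_on UNIV \<psi>" and "x0 < x1"
  obtains M where "\<And>\<eta>. \<eta> > 0 \<Longrightarrow> \<exists>a b. x0 \<le> a \<and> a < b \<and> b \<le> x1 \<and>
      (\<forall>x\<in>{a..b}. \<bar>\<psi> x - (\<psi> a + M * (x - a))\<bar> \<le> \<eta> * (b - a))"
proof -
  define S where "S = {(\<psi> b - \<psi> a) / (b - a) | a b. x0 \<le> a \<and> a < b \<and> b \<le> x1}"
  define M where "M = Sup S"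
  have ne: "S \<noteq> {}" using \<open>x0 < x1\<close> by (auto simp: S_def)
  have bdd: "bdd_above S"
  proof (rule bdd_aboveI[of _ L])
    fix y assume "y \<in> S"
    then obtain a b where ab: "a < b" "y = (\<psi> b - \<psi> a) / (b - a)" by (auto simp: S_def)
    have "\<psi> b - \<psi> a \<le> L * (b - a)"
      using lipschitz_onD[OF lip, of b a] ab by (simp add: dist_real_def)
    then show "y \<le> L" using ab by (simp add: divide_le_eq mult.commute)
  qed
  have slope: "\<psi> b - \<psi> a \<le> M * (b - a)" if "x0 \<le> a" "a \<le> b" "b \<le> x1" for a b
  proof (cases "a = b")
    case False
    then have "a < b" using that by simp
    moreover from this have "(\<psi> b - \<psi> a) / (b - a) \<le> M"
      unfolding M_def using that by (intro cSup_upper bdd) (auto simp: S_def)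
    ultimately show ?thesis by (simp add: divide_le_eq mult.commute)
  qed simp
  show thesis
  proof (rule that[of M])
    fix \<eta> :: real assume "\<eta> > 0"
    then obtain y where "y \<in> S" "M - \<eta> < y"
      using less_cSup_iff[OF ne bdd, of "M - \<eta>"] unfolding M_def by auto
    then obtain a b where ab: "x0 \<le> a" "a < b" "b \<le> x1" and y: "M - \<eta> < (\<psi> b - \<psi> a) / (b - a)"
      by (auto simp: S_def)
    have big: "(M - \<eta>) * (b - a) < \<psi> b - \<psi> a" using y ab by (simp add: less_divide_eq)
    have "\<bar>\<psi> x - (\<psi> a + M * (x - a))\<bar> \<le> \<eta> * (b - a)" if x: "x \<in> {a..b}" for x
    proof -
      have "\<psi> x - \<psi> a \<le> M * (x - a)" "\<psi> b - \<psi> x \<le> M * (b - x)"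
        using slope[of a x] slope[of x b] x ab by auto
      moreover have "0 \<le> \<eta> * (b - a)" using \<open>\<eta> > 0\<close> ab by simp
      ultimately show ?thesis using big by (simp add: algebra_simps abs_le_iff)
    qed
    then show "\<exists>a b. x0 \<le> a \<and> a < b \<and> b \<le> x1 \<and>
      (\<forall>x\<in>{a..b}. \<bar>\<psi> x - (\<psi> a + M * (x - a))\<bar> \<le> \<eta> * (b - a))" using ab by blast
  qed
qed

lemma open_polyhedral_domain: "compact_polyhedral_domain \<Omega> \<Longrightarrow> open \<Omega>"
  unfolding compact_polyhedral_domain_def by auto

lemma half_ball_frontier:
  assumes "open \<Omega>" and eq: "\<Omega> \<inter> ball P r = {X \<in> ball P r. (X - P) \<bullet> n < 0}"
    and Y: "Y \<in> frontier \<Omega>" "Y \<in> ball P r"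
  shows "(Y - P) \<bullet> n = 0"
proof -
  have nY: "Y \<notin> \<Omega>" "Y \<in> closure \<Omega>" using Y(1) \<open>open \<Omega>\<close> by (auto simp: frontier_def interior_open)
  have ge: "(Y - P) \<bullet> n \<ge> 0" using nY(1) eq Y(2) by (metis (mono_tags, lifting) IntD1 mem_Collect_eq not_less)
  have "\<not> (Y - P) \<bullet> n > 0"
  proof
    assume pos: "(Y - P) \<bullet> n > 0"
    let ?U = "ball P r \<inter> {X. (X - P) \<bullet> n > 0}"
    have "open ?U" by (intro open_Int open_ball open_Collect_less continuous_intros)
    moreover have "Y \<in> ?U" using pos Y(2) by simp
    moreover have "\<Omega> \<inter> ?U = {}" using eq by force
    ultimately show False using nY(2) open_Int_closure_eq_empty[of ?U \<Omega>] by blast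
  qed
  then show ?thesis using ge by simp
qed

lemma open_face_subset_frontier:
  assumes "open \<Omega>" "F \<in> open_faces \<Omega>"
  shows "F \<subseteq> frontier \<Omega>"
proof
  fix P assume "P \<in> F"
  then obtain n where "is_outer_normal \<Omega> P n" using open_face_plane[OF assms(2)] by metis
  then obtain r where r: "norm n = 1" "r > 0" "\<Omega> \<inter> ball P r = {X \<in> ball P r. (X - P) \<bullet> n < 0}"
    unfolding is_outer_normal_def by blast
  have "P \<notin> \<Omega>"
  proof
    assume "P \<in> \<Omega>"
    then have "P \<in> {X \<in> ball P r. (X - P) \<bullet> n < 0}" using r by (metis IntI centre_in_ball)
    then show False by simp
  qed
  moreover have "P \<in> closure \<Omega>"
    unfolding closure_approachable
  proof (intro allI impI)
    fix e :: real assume "e > 0"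
    define t where "t = min e r / 2"
    have t: "0 < t" "t < e" "t < r" using \<open>e > 0\<close> r by (auto simp: t_def)
    have "n \<bullet> n = 1" using r(1) by (simp add: norm_eq_1)
    then have "P - t *\<^sub>R n \<in> {X \<in> ball P r. (X - P) \<bullet> n < 0}"
      using t r(1) by (simp add: dist_norm)
    then have "P - t *\<^sub>R n \<in> \<Omega>" using r(3) by blast
    moreover have "dist (P - t *\<^sub>R n) P < e" using t r by (simp add: dist_norm)
    ultimately show "\<exists>y\<in>\<Omega>. dist y P < e" by blast
  qed
  ultimately show "P \<in> frontier \<Omega>" using assms(1) by (simp add: frontier_def interior_open)
qed

text \<open>Within half the radius of a flat boundary point, the distance of a point from the boundary is at
  least its height above the tangent plane, so normal segments are nontangential for every
  \<open>\<alpha> > 0\<close>.\<close>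

lemma normal_segment_in_approach_region:
  assumes "\<alpha> > 0" "open \<Omega>" "norm n = 1" and eq: "\<Omega> \<inter> ball Q r = {X \<in> ball Q r. (X - Q) \<bullet> n < 0}"
    and P: "dist Q P < r / 2" "(P - Q) \<bullet> n = 0" and t: "0 < t" "t \<le> r / 4" and Q: "Q \<in> frontier \<Omega>"
  shows "P - t *\<^sub>R n \<in> approach_region \<alpha> \<Omega> P"
proof -
  define X where "X = P - t *\<^sub>R n"
  have nn: "n \<bullet> n = 1" using assms(3) by (simp add: norm_eq_1)
  have XQ: "(X - Q) \<bullet> n = - t" using P(2) nn by (simp add: X_def inner_diff_left)
  have dXP: "norm (X - P) = t" using t assms(3) by (simp add: X_def)
  have dQX: "dist Q X < 3 * r / 4" using dist_triangle[of Q X P] P(1) t dXP by (simp add: dist_norm norm_minus_commute)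
  then have "X \<in> {X \<in> ball Q r. (X - Q) \<bullet> n < 0}" using XQ t by simp
  then have X\<Omega>: "X \<in> \<Omega>" using eq by blast
  have "t \<le> infdist X (frontier \<Omega>)"
  proof -
    have "t \<le> dist X Y" if Y: "Y \<in> frontier \<Omega>" for Y
    proof (cases "Y \<in> ball Q r")
      case True
      have "(Y - Q) \<bullet> n = 0" by (rule half_ball_frontier[OF assms(2) eq Y True])
      then have "(X - Y) \<bullet> n = - t" using XQ by (simp add: inner_diff_left)
      then have "t = \<bar>(X - Y) \<bullet> n\<bar>" using t by simp
      also have "\<dots> \<le> norm (X - Y) * norm n" by (rule Cauchy_Schwarz_ineq2)
      finally show ?thesis using assms(3) by (simp add: dist_norm)
    next
      case False
      then show ?thesis using dist_triangle[of Q Y X] dQX t by simp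
    qed
    then show ?thesis unfolding infdist_def using Q by (auto intro!: cINF_greatest)
  qed
  moreover have "t < (1 + \<alpha>) * t" using assms(1) t by simp
  ultimately have "norm (X - P) < (1 + \<alpha>) * infdist X (frontier \<Omega>)"
    unfolding dXP using assms(1) mult_left_mono[of t "infdist X (frontier \<Omega>)" "1 + \<alpha>"] by linarith
  then show ?thesis using X\<Omega> by (simp add: approach_region_def X_def)
qed

text \<open>A connected face that is neither contained in E nor disjoint from it meets the frontier of E, and
  there the graph passes through the point itself.\<close>

lemma lipschitz_domain_interface_point:
  assumes E: "lipschitz_domain_of F E" and F: "connected F" and ne: "F - E \<noteq> {}"
  obtains Q \<phi> \<psi> L r where "Q \<in> F" "rectangular_coords F \<phi>" "L-lipschitz_on UNIV (\<psi> :: real \<Rightarrow> real)" "r > 0"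
    "\<And>x. \<phi> x \<in> F \<inter> ball Q r \<Longrightarrow> \<phi> x \<in> E \<longleftrightarrow> \<psi> (x$1) < x$2"
    "\<And>q. \<phi> q = Q \<Longrightarrow> q$2 = \<psi> (q$1)"
proof -
  have op: "openin (top_of_set F) E" and ne': "E \<noteq> {}" using E unfolding lipschitz_domain_of_def by auto
  have sub: "E \<subseteq> F" using openin_imp_subset[OF op] .
  have "top_of_set F frontier_of E \<noteq> {}"
  proof
    assume "top_of_set F frontier_of E = {}"
    then have "openin (top_of_set F) E \<and> closedin (top_of_set F) E"
      using clopenin_eq_frontier_of[of "top_of_set F" E] sub by simp
    then show False using F ne ne' sub unfolding connected_clopen by blast
  qed
  then obtain Q where Q: "Q \<in> top_of_set F frontier_of E" by blast
  then have QF: "Q \<in> F" using frontier_of_subset_topspace[of "top_of_set F" E] by auto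
  have Qcl: "Q \<in> top_of_set F closure_of E" and QE: "Q \<notin> E"
    using Q op by (auto simp: frontier_of_def interior_of_openin)
  obtain \<phi> \<psi> L r where c: "rectangular_coords F \<phi>" "L-lipschitz_on UNIV (\<psi> :: real \<Rightarrow> real)" "r > 0"
    "\<And>x. \<phi> x \<in> F \<inter> ball Q r \<Longrightarrow> \<phi> x \<in> E \<longleftrightarrow> \<psi> (x$1) < x$2"
    using E Q unfolding lipschitz_domain_of_def by metis
  have "q$2 = \<psi> (q$1)" if q: "\<phi> q = Q" for q
  proof -
    have le: "q$2 \<le> \<psi> (q$1)" using c(4)[of q] QE QF q c(3) by auto
    moreover have "\<not> q$2 < \<psi> (q$1)"
    proof
      assume lt: "q$2 < \<psi> (q$1)"
      have cont: "continuous_on UNIV (\<lambda>x :: real^2. \<psi> (x$1) - x$2)"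
        by (intro continuous_intros continuous_on_compose2[OF lipschitz_on_continuous_on[OF c(2)]]) auto
      have "open {x :: real^2. 0 < \<psi> (x$1) - x$2}"
        by (intro open_Collect_less cont continuous_intros)
      then obtain d where d: "d > 0" "ball q d \<subseteq> {x :: real^2. 0 < \<psi> (x$1) - x$2}"
        using lt by (metis (no_types, lifting) diff_gt_0_iff_gt mem_Collect_eq open_contains_ball)
      have "openin (top_of_set F) (F \<inter> ball Q (min d r))" by (simp add: openin_open_Int)
      moreover have "Q \<in> F \<inter> ball Q (min d r)" using QF d c(3) by simp
      ultimately obtain Y where Y: "Y \<in> E" "Y \<in> F \<inter> ball Q (min d r)"
        using Qcl unfolding in_closure_of by blast
      then obtain y where y: "Y = \<phi> y" using c(1) by (auto simp: rectangular_coords_def)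
      have "dist q y < d" using c(1) Y(2) y q by (auto simp: rectangular_coords_def)
      then have "\<not> \<psi> (y$1) < y$2" using d(2) by auto
      then show False using c(4)[of y] Y y by simp
    qed
    ultimately show ?thesis by simp
  qed
  then show thesis using that[OF QF c] by blast
qed

text \<open>Nothing is assumed about E in the strip of half-width \<open>\<epsilon>\<close> about the line s = 0. This is the
  tolerance by which the interface may deviate from the line.\<close>

definition flat_piece :: "real \<Rightarrow> (real^3) set \<Rightarrow> (real^3) set \<Rightarrow> (real^3) set \<Rightarrow>
    real^3 \<Rightarrow> real^3 \<Rightarrow> real^3 \<Rightarrow> real^3 \<Rightarrow> real \<Rightarrow> real \<Rightarrow> bool" where
  "flat_piece \<alpha> \<Omega> F E e1 e2 n c \<rho> \<epsilon> \<longleftrightarrow> (\<forall>a s. \<bar>a\<bar> \<le> \<rho> \<longrightarrow> \<bar>s\<bar> \<le> \<rho> \<longrightarrow>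
     plane_chart c e1 e2 (a, s) \<in> F \<and>
     (s \<le> - \<epsilon> \<longrightarrow> plane_chart c e1 e2 (a, s) \<in> E) \<and>
     (\<epsilon> \<le> s \<longrightarrow> plane_chart c e1 e2 (a, s) \<notin> E) \<and>
     (\<forall>t. 0 < t \<longrightarrow> t \<le> \<rho> \<longrightarrow>
       plane_chart c e1 e2 (a, s) - t *\<^sub>R n \<in> approach_region \<alpha> \<Omega> (plane_chart c e1 e2 (a, s))))"

lemma flat_interface_pieces:
  assumes \<alpha>: "\<alpha> > 0" and \<Omega>: "compact_polyhedral_domain \<Omega>" and F: "F \<in> open_faces \<Omega>"
    and E: "lipschitz_domain_of F E" and ne: "F - E \<noteq> {}"
  obtains n e1 e2 where "e1 \<bullet> e1 = 1" "e2 \<bullet> e2 = 1" "n \<bullet> n = 1" "e1 \<bullet> e2 = 0" "e1 \<bullet> n = 0" "e2 \<bullet> n = 0"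
    "\<And>P. P \<in> F \<Longrightarrow> is_outer_normal \<Omega> P n"
    "\<And>\<eta>. 0 < \<eta> \<Longrightarrow> \<eta> < 1 \<Longrightarrow> \<exists>c \<rho>. \<rho> > 0 \<and> flat_piece \<alpha> \<Omega> F E e1 e2 n c \<rho> (\<eta> * \<rho>)"
proof -
  have op: "open \<Omega>" by (rule open_polyhedral_domain[OF \<Omega>])
  have conF: "connected F" using F in_components_connected unfolding open_faces_def by blast
  obtain n where n: "norm n = 1" "\<And>P. P \<in> F \<Longrightarrow> is_outer_normal \<Omega> P n"
    "\<And>P Q. P \<in> F \<Longrightarrow> Q \<in> F \<Longrightarrow> (P - Q) \<bullet> n = 0"
    using open_face_plane[OF F] by blast
  obtain Q \<phi> \<psi> L r1 where QF: "Q \<in> F" and \<phi>: "rectangular_coords F \<phi>" and lip: "L-lipschitz_on UNIV (\<psi> :: real \<Rightarrow> real)"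
    and r1: "r1 > 0" and side: "\<And>x. \<phi> x \<in> F \<inter> ball Q r1 \<Longrightarrow> \<phi> x \<in> E \<longleftrightarrow> \<psi> (x$1) < x$2"
    and graph: "\<And>q. \<phi> q = Q \<Longrightarrow> q$2 = \<psi> (q$1)"
    using lipschitz_domain_interface_point[OF E conF ne] by metis
  obtain r0 where r0: "r0 > 0" "\<Omega> \<inter> ball Q r0 = {X \<in> ball Q r0. (X - Q) \<bullet> n < 0}"
    using n(2)[OF QF] unfolding is_outer_normal_def by blast
  obtain q where q: "\<phi> q = Q" using QF \<phi> by (auto simp: rectangular_coords_def)
  have iso: "dist (\<phi> x) (\<phi> y) = dist x y" for x y using \<phi> by (simp add: rectangular_coords_def)
  obtain f1 f2 where f: "f1 \<bullet> f1 = 1" "f2 \<bullet> f2 = 1" "f1 \<bullet> f2 = 0"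
    and aff: "\<And>x. \<phi> x = \<phi> 0 + x $ 1 *\<^sub>R f1 + x $ 2 *\<^sub>R f2"
    using isometric_plane_affine[OF iso] by metis
  obtain g1 g2 where g: "g1 \<bullet> g1 = 1" "g2 \<bullet> g2 = 1" "g1 \<bullet> g2 = 0" "g1 \<bullet> n = 0" "g2 \<bullet> n = 0"
    using orthonormal_complement[OF n(1)] by metis
  have rng: "range \<phi> = range (plane_chart Q g1 g2)"
    by (rule rectangular_coords_vimage(2)[OF F QF n(2)[OF QF] g \<phi>, of UNIV]) simp
  have plane: "(\<phi> x - Q) \<bullet> n = 0" for x
  proof -
    obtain y where "\<phi> x = plane_chart Q g1 g2 y" using rng by blast
    then show ?thesis using g by (simp add: plane_chart_def inner_add_left)
  qed
  have fn: "f1 \<bullet> n = 0" "f2 \<bullet> n = 0"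
  proof -
    have "(\<phi> (axis 1 1) - \<phi> 0) \<bullet> n = 0" "(\<phi> (axis 2 1) - \<phi> 0) \<bullet> n = 0"
      using plane[of "axis 1 1"] plane[of "axis 2 1"] plane[of 0] by (simp_all add: inner_diff_left)
    then show "f1 \<bullet> n = 0" "f2 \<bullet> n = 0"
      using aff[of "axis 1 1"] aff[of "axis 2 1"] by (simp_all add: axis_def)
  qed
  define R where "R = min r0 r1"
  have R: "R > 0" "R \<le> r0" "R \<le> r1" using r0 r1 by (auto simp: R_def)
  have L0: "L \<ge> 0" by (rule lipschitz_on_nonneg[OF lip])
  \<comment> \<open>A Lipschitz graph over an interval of half-width \<open>\<delta>\<close> about the base point stays within \<open>(L + 1) \<delta>\<close> of it;
    another \<open>2 \<delta>\<close> leaves room for the square and for the error of the line.\<close>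
  define \<delta> where "\<delta> = R / (4 * (L + 3))"
  have \<delta>: "\<delta> > 0" "\<delta> * (L + 3) = R / 4" using R L0 by (auto simp: \<delta>_def field_simps)
  have \<delta>R: "\<delta> \<le> R / 4"
  proof -
    have "\<delta> * 1 \<le> \<delta> * (L + 3)" using \<delta>(1) L0 by (intro mult_left_mono) auto
    then show ?thesis using \<delta>(2) by simp
  qed
  obtain M where M: "\<And>\<eta>. \<eta> > 0 \<Longrightarrow> \<exists>a b. q$1 - \<delta> \<le> a \<and> a < b \<and> b \<le> q$1 + \<delta> \<and>
      (\<forall>x\<in>{a..b}. \<bar>\<psi> x - (\<psi> a + M * (x - a))\<bar> \<le> \<eta> * (b - a))"
    using lipschitz_almost_affine[OF lip, of "q$1 - \<delta>" "q$1 + \<delta>"] \<delta>(1) by auto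
  define \<kappa> where "\<kappa> = sqrt (1 + M\<^sup>2)"
  have \<kappa>2: "\<kappa> * \<kappa> = 1 + M * M" unfolding \<kappa>_def by (simp add: power2_eq_square)
  have \<kappa>: "\<kappa> \<ge> 1" "\<bar>M\<bar> \<le> \<kappa>"
    unfolding \<kappa>_def by (auto intro!: real_le_rsqrt)
  have \<kappa>0: "\<kappa> > 0" using \<kappa> by linarith
  \<comment> \<open>e1 points along the line of slope M, and e2 is normal to it and points below the graph, out of E.\<close>
  define e1 where "e1 = (1 / \<kappa>) *\<^sub>R f1 + (M / \<kappa>) *\<^sub>R f2"
  define e2 where "e2 = (M / \<kappa>) *\<^sub>R f1 - (1 / \<kappa>) *\<^sub>R f2"
  have sq: "1 / (\<kappa> * \<kappa>) + M * M / (\<kappa> * \<kappa>) = 1"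
    unfolding \<kappa>2 add_divide_distrib[symmetric] by (simp add: add_nonneg_eq_0_iff)
  have e: "e1 \<bullet> e1 = 1" "e2 \<bullet> e2 = 1" "e1 \<bullet> e2 = 0" "e1 \<bullet> n = 0" "e2 \<bullet> n = 0"
    using f fn sq unfolding e1_def e2_def
    by (simp_all add: inner_add_left inner_add_right inner_diff_left inner_diff_right inner_commute[of f2 f1] add.commute)
  have nn: "n \<bullet> n = 1" using n(1) by (simp add: norm_eq_1)
  show thesis
  proof (rule that[of e1 e2 n, OF e(1,2) nn e(3-5) n(2)])
    fix \<eta> :: real assume \<eta>: "0 < \<eta>" "\<eta> < 1"
    obtain a0 b0 where ab: "q$1 - \<delta> \<le> a0" "a0 < b0" "b0 \<le> q$1 + \<delta>"
      and flat: "\<And>x. x \<in> {a0..b0} \<Longrightarrow> \<bar>\<psi> x - (\<psi> a0 + M * (x - a0))\<bar> \<le> \<eta> / 8 * (b0 - a0)"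
      using M[of "\<eta> / 8"] \<eta> by auto
    define m where "m = (a0 + b0) / 2"
    \<comment> \<open>With this half-width the rotated square lies over [a0, b0], whatever the slope of the line.\<close>
    define \<rho> where "\<rho> = (b0 - a0) / 4"
    define y where "y = \<psi> a0 + M * (m - a0)"
    define c0 :: "real^2" where "c0 = (\<chi> i. if i = 1 then m else y)"
    define c where "c = \<phi> c0"
    have m2: "2 * m = a0 + b0" and \<rho>4: "4 * \<rho> = b0 - a0" by (simp_all add: m_def \<rho>_def)
    have \<rho>: "\<rho> > 0" "\<rho> \<le> \<delta> / 2" using ab \<rho>4 by linarith+
    define x :: "real \<Rightarrow> real \<Rightarrow> real^2"
      where "x a s = (\<chi> i. if i = 1 then m + (a + s * M) / \<kappa> else y + (a * M - s) / \<kappa>)" for a s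
    have chart: "plane_chart c e1 e2 (a, s) = \<phi> (x a s)" for a s
      unfolding c_def aff[of c0] aff[of "x a s"] plane_chart_def e1_def e2_def
      by (simp add: c0_def x_def scaleR_add_left scaleR_diff_left scaleR_add_right scaleR_diff_right
          add_divide_distrib diff_divide_distrib algebra_simps)
    have dQc: "dist q c0 \<le> (L + 2) * \<delta>"
    proof -
      have m: "m \<in> {a0..b0}" "\<bar>q$1 - m\<bar> \<le> \<delta>" using ab m2 by (simp_all add: abs_le_iff)
      have "\<bar>\<psi> (q$1) - \<psi> m\<bar> \<le> L * \<delta>"
        using lipschitz_onD[OF lip, of "q$1" m] m(2) L0 mult_left_mono[OF m(2) L0] by (simp add: dist_real_def)
      moreover have "\<bar>\<psi> m - y\<bar> \<le> \<delta>"
      proof -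
        have "\<eta> / 8 * (b0 - a0) \<le> 1 / 8 * (b0 - a0)" using \<eta> ab by (intro mult_right_mono) auto
        also have "\<dots> \<le> \<delta>" using ab by simp
        finally show ?thesis unfolding y_def by (rule order_trans[OF flat[OF m(1)]])
      qed
      ultimately have "\<bar>q$2 - y\<bar> \<le> L * \<delta> + \<delta>" using graph[OF q] by linarith
      moreover have "dist q c0 \<le> \<bar>q$1 - m\<bar> + \<bar>q$2 - y\<bar>"
        unfolding dist_vec_def L2_set_def sum_2 c0_def dist_real_def
        by (simp add: sqrt_sum_squares_le_sum_abs)
      ultimately show ?thesis using m(2) by (simp add: algebra_simps)
    qed
    show "\<exists>c \<rho>. \<rho> > 0 \<and> flat_piece \<alpha> \<Omega> F E e1 e2 n c \<rho> (\<eta> * \<rho>)"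
    proof (rule exI[of _ c], rule exI[of _ \<rho>], unfold flat_piece_def, intro conjI allI impI)
      show "\<rho> > 0" by (rule \<rho>)
      fix a s :: real assume a: "\<bar>a\<bar> \<le> \<rho>" and s: "\<bar>s\<bar> \<le> \<rho>"
      have "dist (plane_chart c e1 e2 (0, 0)) (plane_chart c e1 e2 (a, s)) = sqrt (a\<^sup>2 + s\<^sup>2)"
        by (simp add: plane_chart_dist[OF e(1-3)] dist_prod_def)
      also have "\<dots> \<le> \<bar>a\<bar> + \<bar>s\<bar>" by (rule sqrt_sum_squares_le_sum_abs)
      also have "\<dots> \<le> \<delta>" using a s \<rho> by linarith
      finally have "dist c (\<phi> (x a s)) \<le> \<delta>" unfolding chart[symmetric] by (simp add: plane_chart_def)
      then have "dist Q (\<phi> (x a s)) \<le> (L + 2) * \<delta> + \<delta>"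
        using dist_triangle[of Q "\<phi> (x a s)" c] dQc iso[of q c0] unfolding q c_def by linarith
      then have dQ: "dist Q (\<phi> (x a s)) \<le> R / 4" using \<delta>(2) by (simp add: algebra_simps)
      have "\<phi> (x a s) \<in> {X \<in> ball Q r0. (X - Q) \<bullet> n = 0}" using dQ R plane by auto
      then show inF: "plane_chart c e1 e2 (a, s) \<in> F"
        unfolding chart using open_face_contains_disc[OF F QF n(1) r0] by blast
      have side': "\<phi> (x a s) \<in> E \<longleftrightarrow> \<psi> (x a s $ 1) < x a s $ 2"
        using side[of "x a s"] inF dQ R unfolding chart by auto
      have x1: "x a s $ 1 = m + (a + s * M) / \<kappa>" "x a s $ 2 = y + (a * M - s) / \<kappa>" by (simp_all add: x_def)
      have "\<bar>a + s * M\<bar> \<le> \<rho> * \<kappa> + \<rho> * \<kappa>"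
      proof -
        have "\<bar>a\<bar> * 1 \<le> \<rho> * \<kappa>" "\<bar>s\<bar> * \<bar>M\<bar> \<le> \<rho> * \<kappa>" 
          by (intro mult_mono a s \<kappa>; use \<rho> in simp)+
        then show ?thesis using abs_triangle_ineq[of a "s * M"] unfolding abs_mult by linarith
      qed
      then have "\<bar>(a + s * M) / \<kappa>\<bar> \<le> 2 * \<rho>" using \<kappa>0 by (simp add: abs_divide divide_le_eq mult_ac)
      then have "x a s $ 1 \<in> {a0..b0}" unfolding x1 atLeastAtMost_iff abs_le_iff using m2 \<rho>4 by linarith
      from flat[OF this] have fl: "\<bar>\<psi> (x a s $ 1) - (\<psi> a0 + M * (x a s $ 1 - a0))\<bar> \<le> \<eta> * \<rho> / 2"
        by (simp add: \<rho>_def)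
      have "x a s $ 2 - (\<psi> a0 + M * (x a s $ 1 - a0)) = (a * M - s) / \<kappa> - M * ((a + s * M) / \<kappa>)"
        unfolding x1 y_def by (simp add: algebra_simps)
      also have "\<dots> = - s * (\<kappa> * \<kappa>) / \<kappa>" unfolding \<kappa>2 using \<kappa>0 by (simp add: field_simps)
      finally have ver: "x a s $ 2 - (\<psi> a0 + M * (x a s $ 1 - a0)) = - s * \<kappa>" using \<kappa>0 by simp
      have pos: "\<eta> * \<rho> > 0" using \<eta> \<rho> by simp
      show "plane_chart c e1 e2 (a, s) \<in> E" if "s \<le> - (\<eta> * \<rho>)"
      proof -
        have "\<eta> * \<rho> * 1 \<le> - s * \<kappa>" using mult_mono[of "\<eta> * \<rho>" "- s" 1 \<kappa>] that pos \<kappa> by simp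
        then show ?thesis unfolding chart side' using fl ver pos by linarith
      qed
      show "plane_chart c e1 e2 (a, s) \<notin> E" if "\<eta> * \<rho> \<le> s"
      proof -
        have "\<eta> * \<rho> * 1 \<le> s * \<kappa>" using mult_mono[of "\<eta> * \<rho>" s 1 \<kappa>] that pos \<kappa> by simp
        then show ?thesis unfolding chart side' using fl ver pos by linarith
      qed
      fix t :: real assume t: "0 < t" "t \<le> \<rho>"
      show "plane_chart c e1 e2 (a, s) - t *\<^sub>R n \<in> approach_region \<alpha> \<Omega> (plane_chart c e1 e2 (a, s))"
        unfolding chart
      proof (rule normal_segment_in_approach_region[OF \<alpha> op n(1) r0(2) _ plane t(1)])
        show "dist Q (\<phi> (x a s)) < r0 / 2" using dQ R by linarith
        show "t \<le> r0 / 4" using t \<rho> \<delta>R \<delta>(1) R by linarith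
        show "Q \<in> frontier \<Omega>" using open_face_subset_frontier[OF op F] QF by blast
      qed
    qed
  qed
qed

lemma nt_max_borel: "nt_max \<alpha> \<Omega> w \<in> borel_measurable borel"
proof (rule borel_measurableI_greater)
  fix y :: ennreal
  have "{P. y < nt_max \<alpha> \<Omega> w P} = (\<Union>X\<in>{X \<in> \<Omega>. y < ennreal (norm (w X))}. {P. norm (X - P) < (1 + \<alpha>) * infdist X (frontier \<Omega>)})"
    by (auto simp: nt_max_def less_SUP_iff approach_region_def)
  also have "open \<dots>"
    by (intro open_UN ballI open_Collect_less continuous_intros)
  finally show "{P \<in> space borel. y < nt_max \<alpha> \<Omega> w P} \<in> sets borel" by simp
qed

section \<open>Square integrable functions with unbounded pairings\<close>

lemma geometric_weights_square_le:
  fixes a :: "nat \<Rightarrow> real"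
  shows "(\<Sum>k<n. (1/2)^k * a k)\<^sup>2 \<le> 2 * (\<Sum>k<n. (1/2)^k * (a k)\<^sup>2)"
proof -
  have "(\<Sum>k<n. (1/2)^k * a k)\<^sup>2 = (\<Sum>k<n. sqrt ((1/2)^k) * (sqrt ((1/2)^k) * a k))\<^sup>2"
    by (simp add: mult.assoc[symmetric] real_sqrt_mult_self)
  also have "\<dots> \<le> (\<Sum>k<n. (sqrt ((1/2)^k))\<^sup>2) * (\<Sum>k<n. (sqrt ((1/2)^k) * a k)\<^sup>2)"
    by (rule Cauchy_Schwarz_ineq_sum)
  also have "\<dots> = (\<Sum>k<n. (1/2)^k) * (\<Sum>k<n. (1/2)^k * (a k)\<^sup>2)"
    by (simp add: power_mult_distrib)
  also have "\<dots> \<le> 2 * (\<Sum>k<n. (1/2)^k * (a k)\<^sup>2)"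
    by (intro mult_right_mono sum_nonneg) (simp_all add: geometric_sum)
  finally show ?thesis .
qed

text \<open>A constructive form of the uniform boundedness principle. With p k from the family, of squared norm
  above 16 ^ k, the function g dominates the sum of the normalised p k with weights 1 / 2 ^ k; its pairing
  with p k is at least the norm of p k divided by 2 ^ k.\<close>

lemma unbounded_pairing:
  fixes \<P> :: "('a \<Rightarrow> real) set" and M :: "'a measure"
  assumes meas: "\<And>p. p \<in> \<P> \<Longrightarrow> p \<in> borel_measurable M" and nonneg: "\<And>p x. p \<in> \<P> \<Longrightarrow> 0 \<le> p x"
    and fin: "\<And>p. p \<in> \<P> \<Longrightarrow> (\<integral>\<^sup>+x. ennreal ((p x)\<^sup>2) \<partial>M) < \<infinity>"
    and unb: "\<And>C. \<exists>p\<in>\<P>. ennreal C < (\<integral>\<^sup>+x. ennreal ((p x)\<^sup>2) \<partial>M)"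
  obtains g :: "'a \<Rightarrow> real" where "g \<in> borel_measurable M" "\<And>x. 0 \<le> g x"
    "(\<integral>\<^sup>+x. ennreal ((g x)\<^sup>2) \<partial>M) < \<infinity>"
    "\<And>C. \<exists>p\<in>\<P>. ennreal C < (\<integral>\<^sup>+x. ennreal (p x * g x) \<partial>M)"
proof -
  have "\<forall>k::nat. \<exists>p. p \<in> \<P> \<and> ennreal (16 ^ k) < (\<integral>\<^sup>+x. ennreal ((p x)\<^sup>2) \<partial>M)"
    using unb by blast
  from choice[OF this] obtain p where
    p: "\<And>k. p k \<in> \<P>" "\<And>k. ennreal (16 ^ k) < (\<integral>\<^sup>+x. ennreal ((p k x)\<^sup>2) \<partial>M)" by blast
  define \<sigma> where "\<sigma> k = enn2real (\<integral>\<^sup>+x. ennreal ((p k x)\<^sup>2) \<partial>M)" for k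
  have \<sigma>: "ennreal (\<sigma> k) = (\<integral>\<^sup>+x. ennreal ((p k x)\<^sup>2) \<partial>M)" for k
    unfolding \<sigma>_def using fin[OF p(1)] by (simp add: less_top)
  have \<sigma>16: "16 ^ k < \<sigma> k" for k
    using p(2)[of k] unfolding \<sigma>[symmetric] by (simp add: ennreal_less_iff)
  have \<sigma>0: "0 < \<sigma> k" for k using \<sigma>16[of k] zero_less_power[of "16::real" k] by linarith
  note \<sigma>nn = less_imp_le[OF \<sigma>0]
  note m = meas[OF p(1)]
  have t0: "0 \<le> (1/2)^k * (p k x / sqrt (\<sigma> k))" for k x
    using nonneg[OF p(1), of k x] \<sigma>nn[of k] by simp
  define s where "s n x = (\<Sum>k<n. (1/2)^k * (p k x / sqrt (\<sigma> k)))" for n x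
  have s0: "0 \<le> s n x" for n x
    unfolding s_def by (intro sum_nonneg t0)
  have sm: "s n \<in> borel_measurable M" for n
    unfolding s_def[abs_def] using m by measurable
  have s_int: "(\<integral>\<^sup>+x. ennreal ((s n x)\<^sup>2) \<partial>M) \<le> 4" for n
  proof -
    have "(\<integral>\<^sup>+x. ennreal ((s n x)\<^sup>2) \<partial>M) \<le> (\<integral>\<^sup>+x. ennreal (2 * (\<Sum>k<n. (1/2)^k * (p k x / sqrt (\<sigma> k))\<^sup>2)) \<partial>M)"
      unfolding s_def by (intro nn_integral_mono ennreal_leI geometric_weights_square_le)
    also have "\<dots> = (\<integral>\<^sup>+x. (\<Sum>k<n. ennreal (2 * (1/2)^k / \<sigma> k) * ennreal ((p k x)\<^sup>2)) \<partial>M)"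
    proof (intro nn_integral_cong)
      fix x
      have "ennreal (2 * (\<Sum>k<n. (1/2)^k * (p k x / sqrt (\<sigma> k))\<^sup>2)) = ennreal (\<Sum>k<n. (2 * (1/2)^k / \<sigma> k) * (p k x)\<^sup>2)"
        using \<sigma>nn by (simp add: sum_distrib_left power_divide mult.assoc)
      also have "\<dots> = (\<Sum>k<n. ennreal ((2 * (1/2)^k / \<sigma> k) * (p k x)\<^sup>2))"
        by (intro sum_ennreal[symmetric] mult_nonneg_nonneg divide_nonneg_nonneg \<sigma>nn) simp_all
      also have "\<dots> = (\<Sum>k<n. ennreal (2 * (1/2)^k / \<sigma> k) * ennreal ((p k x)\<^sup>2))"
        by (intro sum.cong refl ennreal_mult divide_nonneg_nonneg \<sigma>nn) simp_all
      finally show "ennreal (2 * (\<Sum>k<n. (1/2)^k * (p k x / sqrt (\<sigma> k))\<^sup>2))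
        = (\<Sum>k<n. ennreal (2 * (1/2)^k / \<sigma> k) * ennreal ((p k x)\<^sup>2))" .
    qed
    also have "\<dots> = (\<Sum>k<n. ennreal (2 * (1/2)^k / \<sigma> k) * ennreal (\<sigma> k))"
      unfolding \<sigma> using m by (simp add: nn_integral_sum nn_integral_cmult)
    also have "\<dots> = (\<Sum>k<n. ennreal (2 * (1/2)^k))"
    proof (intro sum.cong refl)
      show "ennreal (2 * (1/2)^k / \<sigma> k) * ennreal (\<sigma> k) = ennreal (2 * (1/2)^k)" for k
        using \<sigma>nn[of k] \<sigma>0[of k] by (subst ennreal_mult[symmetric]) simp_all
    qed
    also have "\<dots> = ennreal (\<Sum>k<n. 2 * (1/2)^k)" by (intro sum_ennreal) simp
    also have "\<dots> \<le> ennreal 4"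
      by (intro ennreal_leI) (simp add: sum_distrib_left[symmetric] geometric_sum)
    finally show ?thesis by simp
  qed
  \<comment> \<open>The supremum is taken of the squares: its square root is real valued everywhere, with the value 0 on
    the null set where h is infinite, and majorises the partial sums off this set.\<close>
  define h where "h x = (SUP n. ennreal ((s n x)\<^sup>2))" for x
  have hm: "h \<in> borel_measurable M" unfolding h_def[abs_def] using sm by measurable
  have inc: "incseq (\<lambda>n x. ennreal ((s n x)\<^sup>2))"
  proof (rule incseq_SucI, rule le_funI)
    fix n x
    have "s n x \<le> s (Suc n) x"
      unfolding s_def using t0[of n x] by simp
    then show "ennreal ((s n x)\<^sup>2) \<le> ennreal ((s (Suc n) x)\<^sup>2)"
      using s0 by (intro ennreal_leI power_mono)
  qed
  have "(\<integral>\<^sup>+x. h x \<partial>M) = (SUP n. \<integral>\<^sup>+x. ennreal ((s n x)\<^sup>2) \<partial>M)"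
    unfolding h_def using sm by (intro nn_integral_monotone_convergence_SUP inc) measurable
  also have "\<dots> \<le> 4" using s_int by (intro SUP_least)
  finally have h4: "(\<integral>\<^sup>+x. h x \<partial>M) \<le> 4" .
  then have hfin: "AE x in M. h x \<noteq> \<infinity>"
    by (intro nn_integral_PInf_AE hm) (auto simp: top_unique)
  define g where "g x = sqrt (enn2real (h x))" for x
  show thesis
  proof (rule that[of g])
    show "g \<in> borel_measurable M" unfolding g_def[abs_def] using hm by measurable
    show g0: "0 \<le> g x" for x by (simp add: g_def)
    have "(\<integral>\<^sup>+x. ennreal ((g x)\<^sup>2) \<partial>M) \<le> (\<integral>\<^sup>+x. h x \<partial>M)"
    proof (rule nn_integral_mono)
      show "ennreal ((g x)\<^sup>2) \<le> h x" for x
        by (cases "h x") (simp_all add: g_def)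
    qed
    then show "(\<integral>\<^sup>+x. ennreal ((g x)\<^sup>2) \<partial>M) < \<infinity>"
      using h4 by (metis ennreal_numeral_less_top infinity_ennreal_def order.strict_trans1 order_trans)
    show "\<exists>p\<in>\<P>. ennreal C < (\<integral>\<^sup>+x. ennreal (p x * g x) \<partial>M)" for C
    proof -
      obtain k :: nat where k: "C < 2 ^ k" using real_arch_pow[of 2 C] by auto
      have ge: "AE x in M. (1/2)^k * (p k x / sqrt (\<sigma> k)) \<le> g x"
        using hfin
      proof eventually_elim
        case (elim x)
        have nn: "0 \<le> (1/2)^k * (p k x / sqrt (\<sigma> k))" using nonneg[OF p(1)] \<sigma>0[of k] by simp
        have "(1/2)^k * (p k x / sqrt (\<sigma> k)) \<le> s (Suc k) x"
          unfolding s_def by (intro member_le_sum t0) simp_all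
        then have "((1/2)^k * (p k x / sqrt (\<sigma> k)))\<^sup>2 \<le> (s (Suc k) x)\<^sup>2" using nn by (intro power_mono)
        also have "ennreal ((s (Suc k) x)\<^sup>2) \<le> h x" unfolding h_def by (rule SUP_upper) simp
        then have "(s (Suc k) x)\<^sup>2 \<le> enn2real (h x)"
          using elim by (cases "h x") (simp_all add: enn2real_ennreal)
        finally show ?case unfolding g_def by (rule real_le_rsqrt)
      qed
      have "ennreal C \<le> ennreal (2 ^ k)" using k by (intro ennreal_leI) simp
      also have "\<dots> < ennreal ((1/2)^k * sqrt (\<sigma> k))"
      proof (rule ennreal_lessI)
        have "sqrt (\<sigma> k) > 4 ^ k"
        proof (rule real_less_rsqrt)
          show "(4 ^ k)\<^sup>2 < \<sigma> k" using \<sigma>16[of k] by (simp add: power2_eq_square power_mult_distrib[symmetric])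
        qed
        then have "(1/2)^k * 4 ^ k < (1/2)^k * sqrt (\<sigma> k)" by simp
        then show "2 ^ k < (1/2)^k * sqrt (\<sigma> k)" by (simp add: power_mult_distrib[symmetric])
        then show "0 < (1/2)^k * sqrt (\<sigma> k)" using zero_less_power[of "2::real" k] by linarith
      qed
      also have "ennreal ((1/2)^k * sqrt (\<sigma> k)) = ennreal ((1/2)^k / sqrt (\<sigma> k)) * ennreal (\<sigma> k)"
      proof -
        have "(1/2)^k * sqrt (\<sigma> k) = (1/2)^k * (\<sigma> k / sqrt (\<sigma> k))"
          by (simp only: real_div_sqrt[OF \<sigma>nn])
        also have "\<dots> = (1/2)^k / sqrt (\<sigma> k) * \<sigma> k" by simp
        finally show ?thesis using \<sigma>nn[of k] by (simp add: ennreal_mult[symmetric])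
      qed
      also have "\<dots> = (\<integral>\<^sup>+x. ennreal ((1/2)^k / sqrt (\<sigma> k)) * ennreal ((p k x)\<^sup>2) \<partial>M)"
        unfolding \<sigma> using m by (simp add: nn_integral_cmult)
      also have "\<dots> \<le> (\<integral>\<^sup>+x. ennreal (p k x * g x) \<partial>M)"
      proof (rule nn_integral_mono_AE)
        show "AE x in M. ennreal ((1/2)^k / sqrt (\<sigma> k)) * ennreal ((p k x)\<^sup>2) \<le> ennreal (p k x * g x)"
          using ge
        proof eventually_elim
          case (elim x)
          have "ennreal ((1/2)^k / sqrt (\<sigma> k)) * ennreal ((p k x)\<^sup>2) = ennreal (p k x * ((1/2)^k * (p k x / sqrt (\<sigma> k))))"
            using \<sigma>0[of k] by (simp add: ennreal_mult[symmetric] power2_eq_square less_imp_le mult_ac)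
          also have "\<dots> \<le> ennreal (p k x * g x)" using elim nonneg[OF p(1)] by (intro ennreal_leI mult_left_mono)
          finally show ?case .
        qed
      qed
      finally show ?thesis using p(1) by blast
    qed
  qed
qed

section \<open>Test functions on the Neumann part\<close>

text \<open>The cut-off at height 0 times the kernel, divided by the square root of \<open>\<rho>\<close>. With this factor all
  bounds become invariant under scaling.\<close>

definition piece_weight :: "real \<Rightarrow> real \<Rightarrow> real \<times> real \<Rightarrow> real" where
  "piece_weight \<rho> \<epsilon> x = (1 - (fst x / \<rho>)\<^sup>2) * (1 - (snd x / \<rho>)\<^sup>2) * Re (kern (snd x) \<epsilon>) / sqrt \<rho>"

lemma piece_weight_nonneg:
  assumes "0 < \<rho>" "\<bar>fst x\<bar> \<le> \<rho>" "\<bar>snd x\<bar> \<le> \<rho>"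
  shows "0 \<le> piece_weight \<rho> \<epsilon> x"
proof -
  have "0 \<le> 1 - (y / \<rho>)\<^sup>2" if "\<bar>y\<bar> \<le> \<rho>" for y
    using that assms(1) by (simp add: abs_square_le_1 abs_divide)
  then show ?thesis
    unfolding piece_weight_def using assms Re_kern_nonneg[of "snd x" \<epsilon>] by simp
qed

lemma piece_weight_sq_le:
  assumes "0 < \<rho>" "0 < \<epsilon>" "\<bar>fst x\<bar> \<le> \<rho>" "\<bar>snd x\<bar> \<le> \<rho>"
  shows "(piece_weight \<rho> \<epsilon> x)\<^sup>2 \<le> 1 / (\<epsilon> * \<rho>)"
proof -
  have b: "(1 - (y / \<rho>)\<^sup>2)\<^sup>2 \<le> 1" if "\<bar>y\<bar> \<le> \<rho>" for y
  proof -
    have "(y / \<rho>)\<^sup>2 \<le> 1" using that assms(1) by (simp add: abs_square_le_1 abs_divide)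
    then show ?thesis by (simp add: abs_square_le_1 abs_le_iff)
  qed
  have k: "(Re (kern (snd x) \<epsilon>))\<^sup>2 \<le> 1 / \<epsilon>" by (rule kern_sq_le_inverse(1)) (use assms in auto)
  have "(piece_weight \<rho> \<epsilon> x)\<^sup>2 = (1 - (fst x / \<rho>)\<^sup>2)\<^sup>2 * (1 - (snd x / \<rho>)\<^sup>2)\<^sup>2 * (Re (kern (snd x) \<epsilon>))\<^sup>2 / \<rho>"
    using assms(1) by (simp add: piece_weight_def power_mult_distrib power_divide)
  also have "\<dots> \<le> 1 * 1 * (1 / \<epsilon>) / \<rho>"
    using assms(1) by (intro divide_right_mono mult_mono b assms k) auto
  finally show ?thesis by simp
qed

lemma continuous_on_piece_weight: "0 < \<epsilon> \<Longrightarrow> 0 < \<rho> \<Longrightarrow> continuous_on UNIV (piece_weight \<rho> \<epsilon>)"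
  unfolding piece_weight_def[abs_def]
  by (intro continuous_intros continuous_on_Re continuous_on_kern) auto

lemma piece_weight_sq_ge:
  assumes "0 < \<epsilon>" "0 < \<rho>" "\<bar>fst x\<bar> \<le> \<rho> / 2" "\<epsilon> \<le> snd x" "snd x \<le> \<rho> / 2"
  shows "81 / 1024 / \<rho> * (1 / snd x) \<le> (piece_weight \<rho> \<epsilon> x)\<^sup>2"
proof -
  have b: "(9/16 :: real) \<le> (1 - (y / \<rho>)\<^sup>2)\<^sup>2" if "\<bar>y\<bar> \<le> \<rho> / 2" for y
  proof -
    have "\<bar>y / \<rho>\<bar> \<le> 1 / 2" using that assms(2) by (simp add: abs_divide divide_le_eq)
    then have "\<bar>y / \<rho>\<bar>\<^sup>2 \<le> (1/2)\<^sup>2" by (intro power_mono) auto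
    then have "3/4 \<le> 1 - (y / \<rho>)\<^sup>2" by (simp add: power2_eq_square)
    then have "(3/4)\<^sup>2 \<le> (1 - (y / \<rho>)\<^sup>2)\<^sup>2" by (intro power_mono) auto
    then show ?thesis by (simp add: power2_eq_square)
  qed
  have s: "0 < snd x" "\<bar>snd x\<bar> \<le> \<rho> / 2" using assms by auto
  have "81 / 1024 / \<rho> * (1 / snd x) = 9/16 * (9/16) * (1 / (4 * snd x)) / \<rho>" by simp
  also have "\<dots> \<le> (1 - (fst x / \<rho>)\<^sup>2)\<^sup>2 * (1 - (snd x / \<rho>)\<^sup>2)\<^sup>2 * (Re (kern (snd x) \<epsilon>))\<^sup>2 / \<rho>"
    by (intro divide_right_mono mult_mono b assms s Re_kern_sq_ge) (use s assms in auto)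
  also have "\<dots> = (piece_weight \<rho> \<epsilon> x)\<^sup>2"
    using assms(2) by (simp add: piece_weight_def power_mult_distrib power_divide)
  finally show ?thesis .
qed

text \<open>Where the cut-off is bounded below, the square is at least a multiple of \<open>1 / (\<rho> s)\<close>; the integral
  in a cancels \<open>\<rho>\<close> and the integral in s gives the logarithm.\<close>

lemma piece_weight_norm_ge:
  assumes "0 < \<epsilon>" "2 * \<epsilon> \<le> \<rho>"
  shows "ennreal (81 / 1024 * ln (\<rho> / (2 * \<epsilon>))) \<le>
    (\<integral>\<^sup>+x\<in>{-\<rho>..\<rho>} \<times> {\<epsilon>..\<rho>}. ennreal ((piece_weight \<rho> \<epsilon> x)\<^sup>2) \<partial>lborel)"
proof -
  have \<rho>: "0 < \<rho>" using assms by simp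
  let ?f = "\<lambda>s. ennreal (81 / 1024 / \<rho> * (1 / s)) * indicator {\<epsilon>..\<rho> / 2} s"
  have ftc: "(\<integral>\<^sup>+s. ?f s \<partial>lborel) = ennreal (81 / 1024 / \<rho> * ln (\<rho> / 2) - 81 / 1024 / \<rho> * ln \<epsilon>)"
    by (rule nn_integral_FTC_Icc) (use assms \<rho> in \<open>auto intro!: derivative_eq_intros\<close>)
  have "ln (\<rho> / 2) - ln \<epsilon> = ln (\<rho> / (2 * \<epsilon>))" using assms \<rho> by (simp add: ln_div ln_mult)
  moreover have "\<rho> * (81 / 1024 / \<rho> * ln (\<rho> / 2) - 81 / 1024 / \<rho> * ln \<epsilon>) = 81 / 1024 * (ln (\<rho> / 2) - ln \<epsilon>)"
    using \<rho> by (simp add: field_simps)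
  ultimately have eq: "\<rho> * (81 / 1024 / \<rho> * ln (\<rho> / 2) - 81 / 1024 / \<rho> * ln \<epsilon>) = 81 / 1024 * ln (\<rho> / (2 * \<epsilon>))"
    by simp
  have "ennreal (81 / 1024 * ln (\<rho> / (2 * \<epsilon>))) = ennreal \<rho> * (\<integral>\<^sup>+s. ?f s \<partial>lborel)"
    unfolding ftc eq[symmetric] using \<rho> by (intro ennreal_mult') simp
  also have "\<dots> = (\<integral>\<^sup>+a. indicator {-\<rho>/2..\<rho>/2} a * (\<integral>\<^sup>+s. ?f s \<partial>lborel) \<partial>lborel)"
    using \<rho> by (simp add: nn_integral_multc)
  also have "\<dots> = (\<integral>\<^sup>+a. \<integral>\<^sup>+s. indicator {-\<rho>/2..\<rho>/2} a * ?f s \<partial>lborel \<partial>lborel)"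
    by (intro nn_integral_cong nn_integral_cmult[symmetric]) measurable
  also have "\<dots> = (\<integral>\<^sup>+x. indicator {-\<rho>/2..\<rho>/2} (fst x) * ?f (snd x) \<partial>(lborel \<Otimes>\<^sub>M lborel))"
  proof -
    have "(\<lambda>x. indicator {-\<rho>/2..\<rho>/2} (fst x) * ?f (snd x)) \<in> borel_measurable (lborel \<Otimes>\<^sub>M lborel)"
      by measurable
    from lborel.nn_integral_fst[OF this] show ?thesis by simp
  qed
  also have "\<dots> \<le> (\<integral>\<^sup>+x\<in>{-\<rho>..\<rho>} \<times> {\<epsilon>..\<rho>}. ennreal ((piece_weight \<rho> \<epsilon> x)\<^sup>2) \<partial>(lborel \<Otimes>\<^sub>M lborel))"
  proof (intro nn_integral_mono)
    fix x :: "real \<times> real"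
    show "indicator {-\<rho>/2..\<rho>/2} (fst x) * ?f (snd x)
        \<le> ennreal ((piece_weight \<rho> \<epsilon> x)\<^sup>2) * indicator ({-\<rho>..\<rho>} \<times> {\<epsilon>..\<rho>}) x"
    proof (cases "fst x \<in> {-\<rho>/2..\<rho>/2} \<and> snd x \<in> {\<epsilon>..\<rho>/2}")
      case True
      then have "x \<in> {-\<rho>..\<rho>} \<times> {\<epsilon>..\<rho>}" using \<rho> by (auto simp: mem_Times_iff)
      moreover have "81 / 1024 / \<rho> * (1 / snd x) \<le> (piece_weight \<rho> \<epsilon> x)\<^sup>2"
        by (rule piece_weight_sq_ge[OF assms(1) \<rho>]) (use True in auto)
      ultimately show ?thesis using True by (auto intro: ennreal_leI)
    next
      case False
      then show ?thesis by (auto simp: indicator_def)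
    qed
  qed
  finally show ?thesis by (simp add: lborel_prod)
qed

locale interface_chart =
  fixes \<Omega> F E :: "(real^3) set" and n e1 e2 :: "real^3" and \<alpha> :: real
  assumes \<alpha>: "\<alpha> > 0" and \<Omega>: "compact_polyhedral_domain \<Omega>" and F: "F \<in> open_faces \<Omega>"
    and E: "openin (top_of_set F) E"
    and e: "e1 \<bullet> e1 = 1" "e2 \<bullet> e2 = 1" "e1 \<bullet> e2 = 0" "e1 \<bullet> n = 0" "e2 \<bullet> n = 0" and nn: "n \<bullet> n = 1"
    and normal: "\<And>P. P \<in> F \<Longrightarrow> is_outer_normal \<Omega> P n"
begin

abbreviation "piece \<equiv> flat_piece \<alpha> \<Omega> F E e1 e2 n"

definition test_datum :: "real^3 \<Rightarrow> real \<Rightarrow> real \<Rightarrow> real^3 \<Rightarrow> real" where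
  "test_datum c \<rho> \<epsilon> P = indicator (F - E) P *
     (let x = ((P - c) \<bullet> e1, (P - c) \<bullet> e2) in indicator ({-\<rho>..\<rho>} \<times> {-\<rho>..\<rho>}) x * piece_weight \<rho> \<epsilon> x)"

lemma E_borel: "E \<in> sets borel" "F - E \<in> sets borel" "F \<in> sets borel"
proof -
  obtain T where "open T" "E = F \<inter> T" using E by (auto simp: openin_open)
  then show "E \<in> sets borel" "F - E \<in> sets borel" "F \<in> sets borel" using open_faces_borel[OF F] by auto
qed

lemma test_datum_borel: "0 < \<rho> \<Longrightarrow> 0 < \<epsilon> \<Longrightarrow> test_datum c \<rho> \<epsilon> \<in> borel_measurable borel"
proof -
  assume pos: "0 < \<rho>" "0 < \<epsilon>"
  have c: "(\<lambda>P. ((P - c) \<bullet> e1, (P - c) \<bullet> e2)) \<in> borel_measurable borel"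
    by (intro borel_measurable_continuous_onI continuous_intros)
  have "{-\<rho>..\<rho>} \<times> {-\<rho>..\<rho>} \<in> sets (borel :: (real \<times> real) measure)" by (intro borel_closed closed_Times) auto
  then have "(\<lambda>x. indicator ({-\<rho>..\<rho>} \<times> {-\<rho>..\<rho>}) x * piece_weight \<rho> \<epsilon> x :: real) \<in> borel_measurable borel"
    using borel_measurable_continuous_onI[OF continuous_on_piece_weight[OF pos(2,1)]]
    by (intro borel_measurable_times borel_measurable_indicator)
  from borel_measurable_times[OF borel_measurable_indicator[OF E_borel(2)] measurable_compose[OF c this]]
  show ?thesis unfolding test_datum_def[abs_def] Let_def .
qed

lemma test_datum_nonneg: "0 < \<rho> \<Longrightarrow> 0 \<le> test_datum c \<rho> \<epsilon> P"
  unfolding test_datum_def Let_def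
  by (auto simp: indicator_def abs_le_iff intro!: piece_weight_nonneg)

lemma chart_coords: "((plane_chart c e1 e2 x - c) \<bullet> e1, (plane_chart c e1 e2 x - c) \<bullet> e2) = x"
  using e by (simp add: plane_chart_def inner_add_left inner_commute[of e2 e1])

lemma test_datum_chart:
  "test_datum c \<rho> \<epsilon> (plane_chart c e1 e2 x) =
     indicator (F - E) (plane_chart c e1 e2 x) * (indicator ({-\<rho>..\<rho>} \<times> {-\<rho>..\<rho>}) x * piece_weight \<rho> \<epsilon> x)"
  unfolding test_datum_def Let_def chart_coords ..

lemma flat_piece_center:
  assumes "piece c \<rho> \<epsilon>" "0 < \<rho>" shows "c \<in> F"
  using assms unfolding flat_piece_def by (auto dest!: spec[of _ 0] simp: plane_chart_def)

lemma nn_integral_test_datum: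
  assumes fp: "piece c \<rho> \<epsilon>" and pos: "0 < \<rho>" "0 < \<epsilon>" and h: "h \<in> borel_measurable borel"
    and h0: "\<And>P. 0 \<le> h P"
  shows "(\<integral>\<^sup>+P. ennreal (h P * test_datum c \<rho> \<epsilon> P) \<partial>surface_measure \<Omega>) =
     (\<integral>\<^sup>+x\<in>{-\<rho>..\<rho>} \<times> {-\<rho>..\<rho>}. ennreal (indicator (- (plane_chart c e1 e2 -` E)) x *
        (h (plane_chart c e1 e2 x) * piece_weight \<rho> \<epsilon> x)) \<partial>lborel)"
proof -
  have c: "c \<in> F" by (rule flat_piece_center[OF fp pos(1)])
  have m: "(\<lambda>P. ennreal (h P * test_datum c \<rho> \<epsilon> P)) \<in> borel_measurable borel"
    using h test_datum_borel[OF pos] by measurable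
  have "(\<integral>\<^sup>+P. ennreal (h P * test_datum c \<rho> \<epsilon> P) \<partial>surface_measure \<Omega>)
     = (\<integral>\<^sup>+P. ennreal (h P * test_datum c \<rho> \<epsilon> P) * indicator F P \<partial>surface_measure \<Omega>)"
    by (intro nn_integral_cong) (auto simp: test_datum_def indicator_def)
  also have "\<dots> = (\<integral>\<^sup>+x. ennreal (h (plane_chart c e1 e2 x) * test_datum c \<rho> \<epsilon> (plane_chart c e1 e2 x))
      * indicator F (plane_chart c e1 e2 x) \<partial>lborel)"
    by (rule nn_integral_surface_measure_on_face[OF \<Omega> F c normal[OF c] e m])
  also have "\<dots> = (\<integral>\<^sup>+x\<in>{-\<rho>..\<rho>} \<times> {-\<rho>..\<rho>}. ennreal (indicator (- (plane_chart c e1 e2 -` E)) x *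
        (h (plane_chart c e1 e2 x) * piece_weight \<rho> \<epsilon> x)) \<partial>lborel)"
  proof (intro nn_integral_cong)
    fix x :: "real \<times> real"
    have "plane_chart c e1 e2 x \<in> F" if "x \<in> {-\<rho>..\<rho>} \<times> {-\<rho>..\<rho>}"
      using fp that unfolding flat_piece_def by (cases x) (auto simp: abs_le_iff)
    then show "ennreal (h (plane_chart c e1 e2 x) * test_datum c \<rho> \<epsilon> (plane_chart c e1 e2 x))
      * indicator F (plane_chart c e1 e2 x) = ennreal (indicator (- (plane_chart c e1 e2 -` E)) x *
        (h (plane_chart c e1 e2 x) * piece_weight \<rho> \<epsilon> x)) * indicator ({-\<rho>..\<rho>} \<times> {-\<rho>..\<rho>}) x"
      unfolding test_datum_chart by (auto simp: indicator_def)
  qed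
  finally show ?thesis .
qed

lemma test_datum_sq_chart:
  assumes fp: "piece c \<rho> \<epsilon>" and pos: "0 < \<rho>" "0 < \<epsilon>"
  shows "(\<integral>\<^sup>+P. ennreal ((test_datum c \<rho> \<epsilon> P)\<^sup>2) \<partial>surface_measure \<Omega>) =
     (\<integral>\<^sup>+x\<in>{-\<rho>..\<rho>} \<times> {-\<rho>..\<rho>}. ennreal (indicator (- (plane_chart c e1 e2 -` E)) x * (piece_weight \<rho> \<epsilon> x)\<^sup>2) \<partial>lborel)"
  unfolding power2_eq_square[of "test_datum c \<rho> \<epsilon> _"]
    nn_integral_test_datum[OF fp pos test_datum_borel[OF pos] test_datum_nonneg[OF pos(1)]]
proof (intro nn_integral_cong)
  fix x :: "real \<times> real"
  have "plane_chart c e1 e2 x \<in> F" if "x \<in> {-\<rho>..\<rho>} \<times> {-\<rho>..\<rho>}"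
    using fp that unfolding flat_piece_def by (cases x) (auto simp: abs_le_iff)
  then show "ennreal (indicator (- (plane_chart c e1 e2 -` E)) x *
        (test_datum c \<rho> \<epsilon> (plane_chart c e1 e2 x) * piece_weight \<rho> \<epsilon> x)) * indicator ({-\<rho>..\<rho>} \<times> {-\<rho>..\<rho>}) x
    = ennreal (indicator (- (plane_chart c e1 e2 -` E)) x * (piece_weight \<rho> \<epsilon> x)\<^sup>2) * indicator ({-\<rho>..\<rho>} \<times> {-\<rho>..\<rho>}) x"
    unfolding test_datum_chart by (auto simp: indicator_def power2_eq_square)
qed

lemma test_datum_norm_finite:
  assumes fp: "piece c \<rho> \<epsilon>" and pos: "0 < \<rho>" "0 < \<epsilon>"
  shows "(\<integral>\<^sup>+P. ennreal ((test_datum c \<rho> \<epsilon> P)\<^sup>2) \<partial>surface_measure \<Omega>) < \<infinity>"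
proof -
  let ?Q = "cbox (-\<rho>, -\<rho>) (\<rho>, \<rho>)"
  have Q: "{-\<rho>..\<rho>} \<times> {-\<rho>..\<rho>} = ?Q" by (auto simp: cbox_Pair_eq)
  have "(\<integral>\<^sup>+P. ennreal ((test_datum c \<rho> \<epsilon> P)\<^sup>2) \<partial>surface_measure \<Omega>) \<le>
     (\<integral>\<^sup>+x. ennreal (1 / (\<epsilon> * \<rho>)) * indicator ?Q x \<partial>lborel)"
    unfolding test_datum_sq_chart[OF assms] Q
  proof (intro nn_integral_mono)
    fix x :: "real \<times> real"
    show "ennreal (indicator (- (plane_chart c e1 e2 -` E)) x * (piece_weight \<rho> \<epsilon> x)\<^sup>2) * indicator ?Q x
        \<le> ennreal (1 / (\<epsilon> * \<rho>)) * indicator ?Q x"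
    proof (cases "x \<in> ?Q")
      case True
      then have "(piece_weight \<rho> \<epsilon> x)\<^sup>2 \<le> 1 / (\<epsilon> * \<rho>)"
        by (intro piece_weight_sq_le pos) (auto simp: cbox_Pair_eq mem_Times_iff abs_le_iff)
      then have "indicator (- (plane_chart c e1 e2 -` E)) x * (piece_weight \<rho> \<epsilon> x)\<^sup>2 \<le> 1 / (\<epsilon> * \<rho>)"
        using pos by (auto simp: indicator_def)
      then show ?thesis using True by (simp add: ennreal_leI)
    qed simp
  qed
  also have "\<dots> = ennreal (1 / (\<epsilon> * \<rho>)) * emeasure lborel ?Q"
    by (rule nn_integral_cmult_indicator) simp
  also have "\<dots> < \<infinity>" by (simp add: ennreal_mult_less_top emeasure_lborel_cbox_finite[unfolded infinity_ennreal_def])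
  finally show ?thesis .
qed

lemma test_datum_norm_ge:
  assumes fp: "piece c \<rho> \<epsilon>" and pos: "0 < \<epsilon>" "2 * \<epsilon> \<le> \<rho>"
  shows "ennreal (81 / 1024 * ln (\<rho> / (2 * \<epsilon>))) \<le> (\<integral>\<^sup>+P. ennreal ((test_datum c \<rho> \<epsilon> P)\<^sup>2) \<partial>surface_measure \<Omega>)"
proof -
  have \<rho>: "0 < \<rho>" using pos by simp
  have "(\<integral>\<^sup>+x\<in>{-\<rho>..\<rho>} \<times> {\<epsilon>..\<rho>}. ennreal ((piece_weight \<rho> \<epsilon> x)\<^sup>2) \<partial>lborel)
    \<le> (\<integral>\<^sup>+P. ennreal ((test_datum c \<rho> \<epsilon> P)\<^sup>2) \<partial>surface_measure \<Omega>)"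
    unfolding test_datum_sq_chart[OF fp \<rho> pos(1)]
  proof (intro nn_integral_mono)
    fix x :: "real \<times> real"
    have "plane_chart c e1 e2 x \<notin> E" if "x \<in> {-\<rho>..\<rho>} \<times> {\<epsilon>..\<rho>}"
      using fp that pos unfolding flat_piece_def by (cases x) (auto simp: abs_le_iff)
    then show "ennreal ((piece_weight \<rho> \<epsilon> x)\<^sup>2) * indicator ({-\<rho>..\<rho>} \<times> {\<epsilon>..\<rho>}) x
      \<le> ennreal (indicator (- (plane_chart c e1 e2 -` E)) x * (piece_weight \<rho> \<epsilon> x)\<^sup>2) * indicator ({-\<rho>..\<rho>} \<times> {-\<rho>..\<rho>}) x"
      using pos by (auto simp: indicator_def)
  qed
  then show ?thesis using piece_weight_norm_ge[OF pos] by (rule order_trans[rotated])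
qed

section \<open>Solutions have bounded pairings with the test functions\<close>

text \<open>The constant depends on the solution u and the face, but not on the piece. This turns the bound in the
  chart into one on the surface: U is u in the coordinates of the chart, with the inward normal as
  third direction.\<close>

lemma pairing_le:
  fixes u g :: "real^3 \<Rightarrow> real" and k :: ennreal
  defines "k \<equiv> \<integral>\<^sup>+P. (nt_max \<alpha> \<Omega> (grad u) P)\<^sup>2 * indicator F P \<partial>surface_measure \<Omega>"
  assumes u: "harmonic_on \<Omega> u"
    and dir: "AE P in surface_measure \<Omega>. P \<in> E \<longrightarrow> nt_limit \<alpha> \<Omega> u P 0"
    and neu: "AE P in surface_measure \<Omega>. P \<in> F - E \<longrightarrow> nt_limit \<alpha> \<Omega> (\<lambda>X. outer_normal \<Omega> P \<bullet> grad u X) P (g P)"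
    and fin: "k < \<infinity>"
    and g: "g \<in> borel_measurable borel" "\<And>P. 0 \<le> g P"
    and g2: "(\<integral>\<^sup>+P. ennreal ((g P)\<^sup>2) * indicator F P \<partial>surface_measure \<Omega>) < \<infinity>"
    and fp: "piece c \<rho> \<epsilon>" and eps: "0 < \<epsilon>" "\<epsilon> < \<rho>"
  shows "(\<integral>\<^sup>+P. ennreal (g P * test_datum c \<rho> \<epsilon> P) \<partial>surface_measure \<Omega>)
    \<le> ennreal (80 + 11 * enn2real k)"
proof -
  have rho: "0 < \<rho>" using eps by simp
  define Q where "Q = {-\<rho>..\<rho>} \<times> {-\<rho>..\<rho>}"
  define B where "B = {-\<rho>..\<rho>} \<times> {-\<rho>..\<rho>} \<times> {0<..\<rho>}"
  define M where "M = restrict_space (lborel :: (real \<times> real) measure) Q"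
  define \<phi> where "\<phi> = plane_chart c e1 e2"
  define N0 where "N0 = - (\<phi> -` E)"
  define e3 where "e3 = - n"
  define Y where "Y a s t = c + a *\<^sub>R e1 + s *\<^sub>R e2 + t *\<^sub>R e3" for a s t
  define U where "U a s t = u (Y a s t)" for a s t
  define G1 where "G1 a s t = e1 \<bullet> grad u (Y a s t)" for a s t
  define G2 where "G2 a s t = e2 \<bullet> grad u (Y a s t)" for a s t
  define G3 where "G3 a s t = e3 \<bullet> grad u (Y a s t)" for a s t
  define H1 where "H1 a s t = e1 \<bullet> (hessian u (Y a s t) *v e1)" for a s t
  define H2 where "H2 a s t = e2 \<bullet> (hessian u (Y a s t) *v e2)" for a s t
  define H3 where "H3 a s t = e3 \<bullet> (hessian u (Y a s t) *v e3)" for a s t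
  define K where "K a s t = e2 \<bullet> (hessian u (Y a s t) *v e3)" for a s t
  define Z where "Z x = enn2real (nt_max \<alpha> \<Omega> (grad u) (\<phi> x))" for x
  \<comment> \<open>The third coordinate points inwards, hence the sign.\<close>
  define \<gamma> where "\<gamma> x = - g (\<phi> x)" for x
  have on3: "e3 \<bullet> e3 = 1" "e1 \<bullet> e3 = 0" "e2 \<bullet> e3 = 0" using e nn by (auto simp: e3_def)
  have nrm: "norm e1 \<le> 1" "norm e2 \<le> 1" "norm e3 \<le> 1" using e on3 by (auto simp: norm_eq_sqrt_inner)
  have Y\<phi>: "Y a s t = \<phi> (a, s) - t *\<^sub>R n" for a s t by (simp add: Y_def \<phi>_def plane_chart_def e3_def)
  have op: "open \<Omega>" by (rule open_polyhedral_domain[OF \<Omega>])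
  have c: "c \<in> F" by (rule flat_piece_center[OF fp rho])
  have YA: "Y a s t \<in> approach_region \<alpha> \<Omega> (\<phi> (a, s))" if "(a, s, t) \<in> B" for a s t
    using fp that unfolding flat_piece_def Y\<phi> \<phi>_def B_def by (auto simp: abs_le_iff)
  then have Y\<Omega>: "Y a s t \<in> \<Omega>" if "(a, s, t) \<in> B" for a s t
    using that by (force simp: approach_region_def)
  have \<phi>F: "\<phi> x \<in> F" if "x \<in> Q" for x
    using fp that unfolding flat_piece_def \<phi>_def Q_def by (cases x) (auto simp: abs_le_iff)
  have du: "u differentiable (at X)" "grad u differentiable (at X)" if "X \<in> \<Omega>" for X
    using u that by (auto simp: harmonic_on_def)
  have ch: "continuous_on \<Omega> (hessian u)" using u by (simp add: harmonic_on_def)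
  have cu: "continuous_on \<Omega> u" "continuous_on \<Omega> (grad u)"
    using du by (auto intro!: continuous_at_imp_continuous_on differentiable_imp_continuous_within)
  have Y1: "Y x s t = (c + s *\<^sub>R e2 + t *\<^sub>R e3) + x *\<^sub>R e1"
    and Y2: "Y a x t = (c + a *\<^sub>R e1 + t *\<^sub>R e3) + x *\<^sub>R e2"
    and Y3: "Y a s x = (c + a *\<^sub>R e1 + s *\<^sub>R e2) + x *\<^sub>R e3" for a s t x
    by (simp_all add: Y_def)
  have contY: "continuous_on B (\<lambda>x. Y (fst x) (fst (snd x)) (snd (snd x)))"
    unfolding Y_def by (intro continuous_intros)
  have comp: "continuous_on B (\<lambda>(a, s, t). h (Y a s t))" if "continuous_on \<Omega> h" for h :: "real^3 \<Rightarrow> real"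
  proof -
    have "continuous_on B (\<lambda>x. h (Y (fst x) (fst (snd x)) (snd (snd x))))"
      by (rule continuous_on_compose2[OF that contY]) (use Y\<Omega> in auto)
    then show ?thesis by (simp add: split_beta')
  qed
  have Qc: "Q = cbox (-\<rho>, -\<rho>) (\<rho>, \<rho>)" by (auto simp: Q_def cbox_Pair_eq)
  have Qs: "Q \<inter> space lborel \<in> sets lborel" by (simp add: Qc)
  have AEM: "AE x in M. R (\<phi> x)" if "AE P in surface_measure \<Omega>. P \<in> F \<longrightarrow> R P" for R
  proof -
    have "AE x in lborel. \<phi> x \<in> F \<longrightarrow> (\<phi> x \<in> F \<longrightarrow> R (\<phi> x))"
      unfolding \<phi>_def by (rule AE_surface_measure_on_face[OF \<Omega> F c normal[OF c] e that])
    then have "AE x in lborel. x \<in> Q \<longrightarrow> R (\<phi> x)" by eventually_elim (use \<phi>F in auto)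
    then show ?thesis unfolding M_def AE_restrict_space_iff[OF Qs] .
  qed
  have \<phi>m: "\<phi> \<in> borel_measurable borel" unfolding \<phi>_def by (rule plane_chart_measurable)
  have intF: "(\<integral>\<^sup>+x. h (\<phi> x) \<partial>M) \<le> (\<integral>\<^sup>+P. h P * indicator F P \<partial>surface_measure \<Omega>)"
    if h: "h \<in> borel_measurable borel" for h :: "real^3 \<Rightarrow> ennreal"
  proof -
    have "(\<integral>\<^sup>+x. h (\<phi> x) \<partial>M) = (\<integral>\<^sup>+x. h (\<phi> x) * indicator Q x \<partial>lborel)"
      unfolding M_def by (rule nn_integral_restrict_space[OF Qs])
    also have "\<dots> \<le> (\<integral>\<^sup>+x. h (\<phi> x) * indicator F (\<phi> x) \<partial>lborel)"
      by (intro nn_integral_mono) (use \<phi>F in \<open>auto simp: indicator_def\<close>)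
    also have "\<dots> = (\<integral>\<^sup>+P. h P * indicator F P \<partial>surface_measure \<Omega>)"
      unfolding \<phi>_def by (rule nn_integral_surface_measure_on_face[OF \<Omega> F c normal[OF c] e h, symmetric])
    finally show ?thesis .
  qed
  have Mm: "h \<in> borel_measurable M" if "h \<in> borel_measurable borel" for h :: "real \<times> real \<Rightarrow> real"
    unfolding M_def using that by (intro measurable_restrict_space1) simp
  have ntm: "(\<lambda>P. nt_max \<alpha> \<Omega> (grad u) P) \<in> borel_measurable borel" by (rule nt_max_borel)
  have ntm2: "(\<lambda>P. (nt_max \<alpha> \<Omega> (grad u) P)\<^sup>2) \<in> borel_measurable borel" using ntm by measurable
  have ntfin: "AE x in M. nt_max \<alpha> \<Omega> (grad u) (\<phi> x) \<noteq> \<infinity>"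
  proof -
    have m: "(\<lambda>x. (nt_max \<alpha> \<Omega> (grad u) (\<phi> x))\<^sup>2) \<in> borel_measurable M"
      unfolding M_def by (rule measurable_restrict_space1) (use measurable_compose[OF \<phi>m ntm2] in simp)
    have "(\<integral>\<^sup>+x. (nt_max \<alpha> \<Omega> (grad u) (\<phi> x))\<^sup>2 \<partial>M) \<noteq> \<infinity>"
      using order.strict_trans1[OF intF[OF ntm2, folded k_def] fin] by simp
    from nn_integral_PInf_AE[OF m this] show ?thesis
      by eventually_elim (auto simp: power2_eq_square ennreal_mult_eq_top_iff top_unique)
  qed
  have Zm: "Z \<in> borel_measurable M"
    unfolding Z_def[abs_def] by (rule Mm) (use measurable_compose[OF \<phi>m ntm] in measurable)
  have Zint: "(\<integral>\<^sup>+x. ennreal ((Z x)\<^sup>2) \<partial>M) \<le> k"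
  proof (rule order_trans[OF nn_integral_mono intF[OF ntm2, folded k_def]])
    show "ennreal ((Z x)\<^sup>2) \<le> (nt_max \<alpha> \<Omega> (grad u) (\<phi> x))\<^sup>2" for x
      unfolding Z_def by (cases "nt_max \<alpha> \<Omega> (grad u) (\<phi> x)") (simp_all add: ennreal_power)
  qed
  have Z2: "integrable M (\<lambda>x. (Z x)\<^sup>2)"
    using Zm order.strict_trans1[OF Zint fin] by (intro integrableI_nonneg) auto
  have Z2le: "(LINT x|M. (Z x)\<^sup>2) \<le> enn2real k"
    using Zm Zint fin by (subst integral_eq_nn_integral) (auto intro!: enn2real_mono)
  have gm: "(\<lambda>x. g (\<phi> x)) \<in> borel_measurable borel" by (rule measurable_compose[OF \<phi>m g(1)])
  have gx2: "integrable M (\<lambda>x. (g (\<phi> x))\<^sup>2)"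
  proof (rule integrableI_nonneg)
    show "(\<lambda>x. (g (\<phi> x))\<^sup>2) \<in> borel_measurable M" using Mm[OF gm] by measurable
    have "(\<lambda>P. ennreal ((g P)\<^sup>2)) \<in> borel_measurable borel" using g(1) by measurable
    then show "(\<integral>\<^sup>+x. ennreal ((g (\<phi> x))\<^sup>2) \<partial>M) < \<infinity>"
      by (rule order.strict_trans1[OF intF g2])
  qed simp
  have N0b: "N0 \<in> sets borel"
    using measurable_sets[OF \<phi>m E_borel(1)] by (simp add: N0_def Compl_eq_Diff_UNIV)
  interpret flat_mixed_piece \<rho> \<epsilon> U G1 G2 G3 H1 H2 H3 K Z \<gamma> N0 Q B M
  proof (unfold_locales, fold Q_def B_def, fold M_def)
    show "0 < \<epsilon>" "\<epsilon> < \<rho>" by (rule eps)+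
    show "Z \<in> borel_measurable M" by (rule Zm)
    show "\<gamma> \<in> borel_measurable M" unfolding \<gamma>_def[abs_def] using Mm[OF gm] by measurable
    show "integrable M (\<lambda>x. (Z x)\<^sup>2)" by (rule Z2)
    show "N0 \<in> sets borel" by (rule N0b)
    show "snd x \<le> \<epsilon>" if "x \<in> Q - N0" for x
      using fp that unfolding flat_piece_def Q_def N0_def \<phi>_def by (cases x) (force simp: abs_le_iff)
    fix a s t assume b: "(a, s, t) \<in> B"
    note y = Y\<Omega>[OF b]
    show "((\<lambda>x. U a x t) has_real_derivative G2 a s t) (at s)"
      using y unfolding U_def G2_def Y2 by (intro directional_derivative du)
    show "((\<lambda>x. U a s x) has_real_derivative G3 a s t) (at t)"
      using y unfolding U_def G3_def Y3 by (intro directional_derivative du)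
    show "((\<lambda>x. G1 x s t) has_real_derivative H1 a s t) (at a)"
      using y unfolding G1_def H1_def Y1 by (intro directional_derivative_grad du)
    show "((\<lambda>x. G2 a x t) has_real_derivative H2 a s t) (at s)"
      using y unfolding G2_def H2_def Y2 by (intro directional_derivative_grad du)
    show "((\<lambda>x. G3 a s x) has_real_derivative H3 a s t) (at t)"
      using y unfolding G3_def H3_def Y3 by (intro directional_derivative_grad du)
    show "((\<lambda>x. G2 a s x) has_real_derivative K a s t) (at t)"
      using y unfolding G2_def K_def Y3 by (intro directional_derivative_grad du)
    have "K a s t = e3 \<bullet> (hessian u (Y a s t) *v e2)"
      unfolding K_def using du by (intro hessian_symmetric[OF op y _ ch nrm(2,3)]) blast
    then show "((\<lambda>x. G3 a x t) has_real_derivative K a s t) (at s)"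
      using y unfolding G3_def Y2 by (simp add: directional_derivative_grad du)
    show "H1 a s t + H2 a s t + H3 a s t = 0"
      unfolding H1_def H2_def H3_def trace_orthonormal[OF e(1,2) on3(1) e(3) on3(2,3)]
      using u y by (simp add: harmonic_on_def laplacian_def)
  next
    show "continuous_on B (\<lambda>(a, s, t). U a s t)" unfolding U_def by (rule comp[OF cu(1)])
    show "continuous_on B (\<lambda>(a, s, t). G1 a s t)" unfolding G1_def by (rule comp) (intro continuous_intros cu)
    show "continuous_on B (\<lambda>(a, s, t). G2 a s t)" unfolding G2_def by (rule comp) (intro continuous_intros cu)
    show "continuous_on B (\<lambda>(a, s, t). G3 a s t)" unfolding G3_def by (rule comp) (intro continuous_intros cu)
    show "continuous_on B (\<lambda>(a, s, t). H1 a s t)" unfolding H1_def by (rule comp) (intro continuous_on_bilinear_form ch)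
    show "continuous_on B (\<lambda>(a, s, t). H2 a s t)" unfolding H2_def by (rule comp) (intro continuous_on_bilinear_form ch)
    show "continuous_on B (\<lambda>(a, s, t). H3 a s t)" unfolding H3_def by (rule comp) (intro continuous_on_bilinear_form ch)
    show "continuous_on B (\<lambda>(a, s, t). K a s t)" unfolding K_def by (rule comp) (intro continuous_on_bilinear_form ch)
    have AEQ: "AE x in M. x \<in> Q" using AE_space[of M] by (simp add: M_def space_restrict_space)
    have le_nt: "\<bar>f \<bullet> grad u (Y a s t)\<bar> \<le> Z (a, s)"
      if f: "norm f \<le> 1" and b: "(a, s, t) \<in> B" and fin: "nt_max \<alpha> \<Omega> (grad u) (\<phi> (a, s)) \<noteq> \<infinity>" for f a s t
    proof -
      have "ennreal (norm (grad u (Y a s t))) \<le> nt_max \<alpha> \<Omega> (grad u) (\<phi> (a, s))"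
        unfolding nt_max_def by (rule SUP_upper[OF YA[OF b]])
      then have "norm (grad u (Y a s t)) \<le> Z (a, s)"
        unfolding Z_def using fin by (cases "nt_max \<alpha> \<Omega> (grad u) (\<phi> (a, s))") simp_all
      moreover have "\<bar>f \<bullet> grad u (Y a s t)\<bar> \<le> norm f * norm (grad u (Y a s t))" by (rule Cauchy_Schwarz_ineq2)
      moreover have "norm f * norm (grad u (Y a s t)) \<le> 1 * norm (grad u (Y a s t))" using f by (intro mult_right_mono) auto
      ultimately show ?thesis by linarith
    qed
    show "AE x in M. \<forall>t\<in>{0<..\<rho>}. \<bar>G1 (fst x) (snd x) t\<bar> \<le> Z x \<and> \<bar>G2 (fst x) (snd x) t\<bar> \<le> Z x \<and> \<bar>G3 (fst x) (snd x) t\<bar> \<le> Z x"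
      using ntfin AEQ
    proof eventually_elim
      case (elim x)
      obtain a s where x: "x = (a, s)" by (cases x)
      show ?case
      proof
        fix t assume "t \<in> {0<..\<rho>}"
        then have "(a, s, t) \<in> B" using elim(2) x by (auto simp: B_def Q_def)
        then show "\<bar>G1 (fst x) (snd x) t\<bar> \<le> Z x \<and> \<bar>G2 (fst x) (snd x) t\<bar> \<le> Z x \<and> \<bar>G3 (fst x) (snd x) t\<bar> \<le> Z x"
          using le_nt nrm elim(1) unfolding G1_def G2_def G3_def x by simp
      qed
    qed
    have approach: "filterlim (\<lambda>t. Y (fst x) (snd x) t) (at (\<phi> x) within approach_region \<alpha> \<Omega> (\<phi> x)) (at_right 0)"
      if "x \<in> Q" for x
    proof -
      obtain a s where x: "x = (a, s)" by (cases x)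
      have "((\<lambda>t. \<phi> (a, s) - t *\<^sub>R n) \<longlongrightarrow> \<phi> (a, s) - 0 *\<^sub>R n) (at_right 0)" by (intro tendsto_intros)
      then have "(Y a s \<longlongrightarrow> \<phi> (a, s)) (at_right 0)" by (simp add: Y\<phi>[abs_def])
      moreover have "\<forall>\<^sub>F t in at_right 0. Y a s t \<in> approach_region \<alpha> \<Omega> (\<phi> (a, s)) \<and> Y a s t \<noteq> \<phi> (a, s)"
        unfolding eventually_at_right_field
      proof (intro exI[of _ \<rho>] conjI allI impI rho)
        fix t assume t: "0 < t" "t < \<rho>"
        then show "Y a s t \<in> approach_region \<alpha> \<Omega> (\<phi> (a, s))" using that x by (intro YA) (auto simp: B_def Q_def)
        have "n \<noteq> 0" using nn by auto
        then show "Y a s t \<noteq> \<phi> (a, s)" unfolding Y\<phi> using t by simp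
      qed
      ultimately show ?thesis unfolding filterlim_at x by simp
    qed
    have "AE x in M. (\<phi> x \<in> E \<longrightarrow> nt_limit \<alpha> \<Omega> u (\<phi> x) 0)"
      by (rule AEM) (use dir in \<open>auto elim: eventually_mono\<close>)
    with AEQ show "AE x in M. snd x \<le> - \<epsilon> \<longrightarrow> (U (fst x) (snd x) \<longlongrightarrow> 0) (at_right 0)"
    proof eventually_elim
      case (elim x)
      show ?case
      proof
        assume "snd x \<le> - \<epsilon>"
        then have "\<phi> x \<in> E" using fp elim(1) unfolding flat_piece_def \<phi>_def Q_def by (cases x) (auto simp: abs_le_iff)
        then have "(u \<longlongrightarrow> 0) (at (\<phi> x) within approach_region \<alpha> \<Omega> (\<phi> x))" using elim(2) by (simp add: nt_limit_def)
        from filterlim_compose[OF this approach[OF elim(1)]]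
        show "(U (fst x) (snd x) \<longlongrightarrow> 0) (at_right 0)" by (simp add: U_def[abs_def])
      qed
    qed
    have "AE x in M. (\<phi> x \<in> F - E \<longrightarrow> nt_limit \<alpha> \<Omega> (\<lambda>X. outer_normal \<Omega> (\<phi> x) \<bullet> grad u X) (\<phi> x) (g (\<phi> x)))"
      by (rule AEM) (use neu in \<open>auto elim: eventually_mono\<close>)
    with AEQ show "AE x in M. x \<in> N0 \<longrightarrow> (G3 (fst x) (snd x) \<longlongrightarrow> \<gamma> x) (at_right 0)"
    proof eventually_elim
      case (elim x)
      show ?case
      proof
        assume "x \<in> N0"
        then have "\<phi> x \<in> F - E" using \<phi>F[OF elim(1)] by (simp add: N0_def)
        moreover have "outer_normal \<Omega> (\<phi> x) = n" by (rule outer_normal_eq[OF normal[OF \<phi>F[OF elim(1)]]])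
        ultimately have "((\<lambda>X. n \<bullet> grad u X) \<longlongrightarrow> g (\<phi> x)) (at (\<phi> x) within approach_region \<alpha> \<Omega> (\<phi> x))"
          using elim(2) by (simp add: nt_limit_def)
        from tendsto_minus[OF filterlim_compose[OF this approach[OF elim(1)]]]
        show "(G3 (fst x) (snd x) \<longlongrightarrow> \<gamma> x) (at_right 0)" by (simp add: G3_def[abs_def] \<gamma>_def e3_def)
      qed
    qed
  qed (simp_all add: Q_def B_def M_def)
  define f where "f x = indicator N0 x * (g (\<phi> x) * piece_weight \<rho> \<epsilon> x)" for x :: "real \<times> real"
  have f_eq: "f x = - (1 / sqrt \<rho>) * (indicator N0 x * (cutoff (fst x) (snd x) 0 * v (snd x) 0 * \<gamma> x))" for x
    by (simp add: f_def cutoff_def bump_def piece_weight_def \<gamma>_def)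
  have inQ: "\<bar>fst x\<bar> \<le> \<rho>" "\<bar>snd x\<bar> \<le> \<rho>" if "x \<in> Q" for x using that by (auto simp: Q_def abs_le_iff)
  have f0: "0 \<le> f x" if "x \<in> Q" for x
    unfolding f_def using piece_weight_nonneg[OF rho inQ[OF that], of \<epsilon>] g(2) by simp
  have fm: "f \<in> borel_measurable M"
    unfolding f_def[abs_def]
    using gm N0b borel_measurable_continuous_onI[OF continuous_on_piece_weight[OF eps(1) rho]]
    by (intro Mm borel_measurable_times borel_measurable_indicator)
  have fi: "integrable M f"
  proof (rule Bochner_Integration.integrable_bound[of M "\<lambda>x. 1 / (\<epsilon> * \<rho>) + (g (\<phi> x))\<^sup>2"])
    show "integrable M (\<lambda>x. 1 / (\<epsilon> * \<rho>) + (g (\<phi> x))\<^sup>2)"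
      by (intro Bochner_Integration.integrable_add const_integrable gx2)
    show "AE x in M. norm (f x) \<le> norm (1 / (\<epsilon> * \<rho>) + (g (\<phi> x))\<^sup>2)"
      using AE_Q
    proof eventually_elim
      case (elim x)
      have "2 * g (\<phi> x) * piece_weight \<rho> \<epsilon> x \<le> (g (\<phi> x))\<^sup>2 + (piece_weight \<rho> \<epsilon> x)\<^sup>2" by (rule sum_squares_bound)
      moreover have "(piece_weight \<rho> \<epsilon> x)\<^sup>2 \<le> 1 / (\<epsilon> * \<rho>)" by (rule piece_weight_sq_le[OF rho eps(1) inQ[OF elim]])
      moreover have "0 \<le> g (\<phi> x) * piece_weight \<rho> \<epsilon> x" using piece_weight_nonneg[OF rho inQ[OF elim], of \<epsilon>] g(2) by simp
      moreover have "f x \<le> g (\<phi> x) * piece_weight \<rho> \<epsilon> x" using calculation(3) by (simp add: f_def indicator_def)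
      ultimately have "f x \<le> 1 / (\<epsilon> * \<rho>) + (g (\<phi> x))\<^sup>2" by linarith
      then show ?case using f0[OF elim] by simp
    qed
  qed (rule fm)
  have "(\<integral>\<^sup>+P. ennreal (g P * test_datum c \<rho> \<epsilon> P) \<partial>surface_measure \<Omega>) = (\<integral>\<^sup>+x. ennreal (f x) \<partial>M)"
    unfolding nn_integral_test_datum[OF fp rho eps(1) g] M_def nn_integral_restrict_space[OF Qs]
    by (simp add: f_def N0_def \<phi>_def Q_def)
  also have "\<dots> = ennreal (LINT x|M. f x)"
  proof (rule nn_integral_eq_integral[OF fi])
    show "AE x in M. 0 \<le> f x" using AE_Q by eventually_elim (rule f0)
  qed
  also have "\<dots> \<le> ennreal (80 + 11 * enn2real k)"
  proof (rule ennreal_leI)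
    have "\<bar>LINT x|M. f x\<bar> = (1 / sqrt \<rho>) * \<bar>LINT x|M. indicator N0 x * (cutoff (fst x) (snd x) 0 * v (snd x) 0 * \<gamma> x)\<bar>"
      unfolding f_eq integral_mult_right_zero abs_mult using rho by simp
    also have "\<dots> \<le> (1 / sqrt \<rho>) * (sqrt \<rho> * (80 + 11 * (LINT x|M. (Z x)\<^sup>2)))"
      by (intro mult_left_mono mixed_pairing_bound) (use rho in simp)
    also have "\<dots> = 80 + 11 * (LINT x|M. (Z x)\<^sup>2)" using rho by simp
    finally show "(LINT x|M. f x) \<le> 80 + 11 * enn2real k"
      using Z2le by linarith
  qed
  finally show ?thesis .
qed

end

section \<open>Data without a solution\<close>

lemma L2_on_zero: "L2_on M A (\<lambda>_. 0)"
  by (simp add: L2_on_def set_borel_measurable_def set_integrable_def)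

lemma W12_boundary_zero: "W12_boundary \<Omega> (\<lambda>_. 0)"
  unfolding W12_boundary_def
proof (intro conjI exI[of _ "\<lambda>_. 0 :: real^3"] allI impI L2_on_zero)
qed (simp add: set_lebesgue_integral_def)

theorem theorem3p4:
  fixes \<Omega> D N F :: "(real^3) set" and \<alpha> :: real
  assumes "\<alpha> > 0"
    and "compact_polyhedral_domain \<Omega>"
    and "D \<union> N = frontier \<Omega>" and "D \<inter> N = {}"
    and "F \<in> open_faces \<Omega>"
    and "lipschitz_domain_of F (F \<inter> D)"
    and "F \<inter> N \<noteq> {}"
  shows "\<exists>f g :: real^3 \<Rightarrow> real.
           W12_boundary \<Omega> f \<and> L2_on (surface_measure \<Omega>) N g \<and>
           \<not> (\<exists>u :: real^3 \<Rightarrow> real.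
                harmonic_on \<Omega> u \<and>
                (AE P in surface_measure \<Omega>. P \<in> D \<longrightarrow> nt_limit \<alpha> \<Omega> u P (f P)) \<and>
                (AE P in surface_measure \<Omega>. P \<in> N \<longrightarrow>
                   nt_limit \<alpha> \<Omega> (\<lambda>X. outer_normal \<Omega> P \<bullet> grad u X) P (g P)) \<and>
                (\<integral>\<^sup>+P\<in>frontier \<Omega>. (nt_max \<alpha> \<Omega> (grad u) P)\<^sup>2 \<partial>surface_measure \<Omega>) < \<infinity>)"
proof -
  let ?\<sigma> = "surface_measure \<Omega>"
  define E where "E = F \<inter> D"
  have Ffr: "F \<subseteq> frontier \<Omega>"
    using open_face_subset_frontier[OF open_polyhedral_domain[OF assms(2)] assms(5)] .
  have FE: "F - E \<noteq> {}" using assms(4,7) by (auto simp: E_def)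
  have FEN: "F - E \<subseteq> N" using Ffr assms(3) by (auto simp: E_def)
  have lip: "lipschitz_domain_of F E" using assms(6) by (simp add: E_def)
  obtain n e1 e2 where e: "e1 \<bullet> e1 = 1" "e2 \<bullet> e2 = 1" "n \<bullet> n = 1" "e1 \<bullet> e2 = 0" "e1 \<bullet> n = 0" "e2 \<bullet> n = 0"
    and normal: "\<And>P. P \<in> F \<Longrightarrow> is_outer_normal \<Omega> P n"
    and pieces: "\<And>\<eta>. 0 < \<eta> \<Longrightarrow> \<eta> < 1 \<Longrightarrow> \<exists>c \<rho>. \<rho> > 0 \<and> flat_piece \<alpha> \<Omega> F E e1 e2 n c \<rho> (\<eta> * \<rho>)"
    by (rule flat_interface_pieces[OF assms(1,2,5) lip FE]) (rule that)
  have oE: "openin (top_of_set F) E" using lip by (simp add: lipschitz_domain_of_def)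
  interpret interface_chart \<Omega> F E n e1 e2 \<alpha>
    by unfold_locales (use assms oE e normal in auto)
  define \<P> where "\<P> = {test_datum c \<rho> \<epsilon> | c \<rho> \<epsilon>. 0 < \<epsilon> \<and> \<epsilon> < \<rho> \<and> flat_piece \<alpha> \<Omega> F E e1 e2 n c \<rho> \<epsilon>}"
  have \<P>_meas: "p \<in> borel_measurable ?\<sigma>" if "p \<in> \<P>" for p
    using that by (auto simp: \<P>_def intro!: test_datum_borel)
  have \<P>_nonneg: "0 \<le> p P" if "p \<in> \<P>" for p P
    using that by (auto simp: \<P>_def intro!: test_datum_nonneg)
  have \<P>_fin: "(\<integral>\<^sup>+P. ennreal ((p P)\<^sup>2) \<partial>?\<sigma>) < \<infinity>" if p: "p \<in> \<P>" for p
  proof -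
    obtain c \<rho> \<epsilon> where "p = test_datum c \<rho> \<epsilon>" "0 < \<epsilon>" "\<epsilon> < \<rho>" "flat_piece \<alpha> \<Omega> F E e1 e2 n c \<rho> \<epsilon>" using p by (auto simp: \<P>_def)
    then show ?thesis using test_datum_norm_finite[of c \<rho> \<epsilon>] by simp
  qed
  have \<P>_unb: "\<exists>p\<in>\<P>. ennreal C < (\<integral>\<^sup>+P. ennreal ((p P)\<^sup>2) \<partial>?\<sigma>)" for C :: real
  proof -
    define B where "B = 1024 / 81 * (\<bar>C\<bar> + 1)"
    \<comment> \<open>The lower bound for the squared norm is a multiple of \<open>ln (1 / (2 \<eta>))\<close>, here equal to B.\<close>
    define \<eta> where "\<eta> = exp (- B) / 2"
    have B: "0 < B" by (simp add: B_def)
    have \<eta>: "0 < \<eta>" "\<eta> < 1/2" using B by (auto simp: \<eta>_def)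
    obtain c \<rho> where \<rho>: "\<rho> > 0" and fp: "flat_piece \<alpha> \<Omega> F E e1 e2 n c \<rho> (\<eta> * \<rho>)"
      using pieces[of \<eta>] \<eta> by auto
    have \<epsilon>: "0 < \<eta> * \<rho>" "2 * (\<eta> * \<rho>) \<le> \<rho>" "\<eta> * \<rho> < \<rho>"
      using \<eta> \<rho> mult_strict_right_mono[of \<eta> "1/2" \<rho>] by auto
    have "\<rho> / (2 * (\<eta> * \<rho>)) = exp B" using \<rho> by (simp add: \<eta>_def exp_minus field_simps)
    then have eq: "81 / 1024 * ln (\<rho> / (2 * (\<eta> * \<rho>))) = \<bar>C\<bar> + 1" by (simp add: B_def)
    have "ennreal (\<bar>C\<bar> + 1) \<le> (\<integral>\<^sup>+P. ennreal ((test_datum c \<rho> (\<eta> * \<rho>) P)\<^sup>2) \<partial>?\<sigma>)"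
      using test_datum_norm_ge[OF fp \<epsilon>(1,2)] unfolding eq .
    moreover have "ennreal C < ennreal (\<bar>C\<bar> + 1)" by (intro ennreal_lessI) auto
    moreover have "test_datum c \<rho> (\<eta> * \<rho>) \<in> \<P>" using fp \<epsilon> by (auto simp: \<P>_def)
    ultimately show ?thesis by (meson order.strict_trans2)
  qed
  obtain g0 where g0: "g0 \<in> borel_measurable ?\<sigma>" "\<And>P. 0 \<le> g0 P" "(\<integral>\<^sup>+P. ennreal ((g0 P)\<^sup>2) \<partial>?\<sigma>) < \<infinity>"
    and unb: "\<And>C. \<exists>p\<in>\<P>. ennreal C < (\<integral>\<^sup>+P. ennreal (p P * g0 P) \<partial>?\<sigma>)"
  proof (rule unbounded_pairing[of \<P> ?\<sigma>])
    show "p \<in> borel_measurable ?\<sigma>" if "p \<in> \<P>" for p using that by (rule \<P>_meas)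
    show "0 \<le> p P" if "p \<in> \<P>" for p P using that by (rule \<P>_nonneg)
    show "(\<integral>\<^sup>+P. ennreal ((p P)\<^sup>2) \<partial>?\<sigma>) < \<infinity>" if "p \<in> \<P>" for p using that by (rule \<P>_fin)
    show "\<exists>p\<in>\<P>. ennreal C < (\<integral>\<^sup>+P. ennreal ((p P)\<^sup>2) \<partial>?\<sigma>)" for C by (rule \<P>_unb)
  qed (rule that)
  define g where "g P = indicator (F - E) P * g0 P" for P
  have gb: "g \<in> borel_measurable borel"
    unfolding g_def[abs_def] using g0(1) E_borel(2)
    by (intro borel_measurable_times borel_measurable_indicator) simp_all
  have gnn: "0 \<le> g P" for P using g0(2) by (simp add: g_def)
  have g2: "(\<integral>\<^sup>+P. ennreal ((g P)\<^sup>2) \<partial>?\<sigma>) < \<infinity>"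
    by (rule order.strict_trans1[OF nn_integral_mono g0(3)]) (simp add: g_def indicator_def)
  have L2g: "L2_on ?\<sigma> N g"
  proof -
    have gN: "indicator N P *\<^sub>R g P = g P" "indicator N P *\<^sub>R (norm (g P))\<^sup>2 = (g P)\<^sup>2" for P
      using FEN by (auto simp: g_def indicator_def)
    have "integrable ?\<sigma> (\<lambda>P. (g P)\<^sup>2)"
      using gb g2 by (intro integrableI_nonneg) auto
    then show ?thesis
      unfolding L2_on_def set_borel_measurable_def set_integrable_def gN using gb by simp
  qed
  have "\<not> (\<exists>u :: real^3 \<Rightarrow> real.
                harmonic_on \<Omega> u \<and>
                (AE P in ?\<sigma>. P \<in> D \<longrightarrow> nt_limit \<alpha> \<Omega> u P 0) \<and>
                (AE P in ?\<sigma>. P \<in> N \<longrightarrow> nt_limit \<alpha> \<Omega> (\<lambda>X. outer_normal \<Omega> P \<bullet> grad u X) P (g P)) \<and>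
                (\<integral>\<^sup>+P\<in>frontier \<Omega>. (nt_max \<alpha> \<Omega> (grad u) P)\<^sup>2 \<partial>?\<sigma>) < \<infinity>)"
  proof (rule notI, elim exE conjE)
    fix u :: "real^3 \<Rightarrow> real"
    assume u: "harmonic_on \<Omega> u"
      and dir: "AE P in ?\<sigma>. P \<in> D \<longrightarrow> nt_limit \<alpha> \<Omega> u P 0"
      and neu: "AE P in ?\<sigma>. P \<in> N \<longrightarrow> nt_limit \<alpha> \<Omega> (\<lambda>X. outer_normal \<Omega> P \<bullet> grad u X) P (g P)"
      and fin: "(\<integral>\<^sup>+P\<in>frontier \<Omega>. (nt_max \<alpha> \<Omega> (grad u) P)\<^sup>2 \<partial>?\<sigma>) < \<infinity>"
    define k where "k = (\<integral>\<^sup>+P. (nt_max \<alpha> \<Omega> (grad u) P)\<^sup>2 * indicator F P \<partial>?\<sigma>)"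
    have kfin: "k < \<infinity>"
      unfolding k_def
      by (rule order.strict_trans1[OF nn_integral_mono fin]) (use Ffr in \<open>auto simp: indicator_def\<close>)
    have dir': "AE P in ?\<sigma>. P \<in> E \<longrightarrow> nt_limit \<alpha> \<Omega> u P 0"
      using dir by eventually_elim (auto simp: E_def)
    have neu': "AE P in ?\<sigma>. P \<in> F - E \<longrightarrow> nt_limit \<alpha> \<Omega> (\<lambda>X. outer_normal \<Omega> P \<bullet> grad u X) P (g P)"
      using neu by eventually_elim (use FEN in auto)
    have gF: "(\<integral>\<^sup>+P. ennreal ((g P)\<^sup>2) * indicator F P \<partial>?\<sigma>) < \<infinity>"
      by (rule order.strict_trans1[OF nn_integral_mono g2]) (simp add: indicator_def)
    obtain p where p: "p \<in> \<P>" "ennreal (80 + 11 * enn2real k) < (\<integral>\<^sup>+P. ennreal (p P * g0 P) \<partial>?\<sigma>)"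
      using unb by blast
    then obtain c \<rho> \<epsilon> where pc: "p = test_datum c \<rho> \<epsilon>" "0 < \<epsilon>" "\<epsilon> < \<rho>" "flat_piece \<alpha> \<Omega> F E e1 e2 n c \<rho> \<epsilon>"
      by (auto simp: \<P>_def)
    have "(\<integral>\<^sup>+P. ennreal (p P * g0 P) \<partial>?\<sigma>) = (\<integral>\<^sup>+P. ennreal (g P * test_datum c \<rho> \<epsilon> P) \<partial>?\<sigma>)"
      by (intro nn_integral_cong) (auto simp: pc(1) g_def test_datum_def indicator_def mult.commute)
    also have "\<dots> \<le> ennreal (80 + 11 * enn2real k)"
      unfolding k_def
      by (rule pairing_le[OF u dir' neu' kfin[unfolded k_def] gb gnn gF pc(4,2,3)])
    finally show False using p(2) by simp
  qed
  then show ?thesis using W12_boundary_zero L2g by (intro exI[of _ "\<lambda>_. 0"] exI[of _ g]) blast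
qed

end
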